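(* Let $\ell\ge 1$ be an integer and $a\in\mathbb C^{*}$. The coproduct $\Delta$ is well-defined on the tensor product $V(Y_{\ell,a})\otimes V(Y_{0,aq^{\ell}}^{-1})$, and it endows this tensor product with a structure of integrable $\mathcal U_q(\hat{sl}_\infty)$-module.
   Context: Algebra. Fix $t\in\mathbb C$ such that $q=e^{t}$ is not a root of unity, and put $q^{r}=e^{tr}$ for $r\in\mathbb Q$. For $i,j\in\mathbb Z$ let $C_{ii}=2$, $C_{i,i\pm1}=-1$, $C_{ij}=0$ otherwise; $\mathfrak h=\bigoplus_{i\in\mathbb Z}\mathbb Q h_i$; $\Lambda_i\in\mathfrak h^*$ with $\Lambda_i(h_j)=\delta_{ij}$; $\alpha_i=2\Lambda_i-\Lambda_{i-1}-\Lambda_{i+1}$; $P=\bigoplus_i\mathbb Z\Lambda_i$. The algebra $\mathcal U_q(\hat{sl}_\infty)$ is the $\mathbb C$-algebra generated by $x_{i,r}^{\pm}$ ($i,r\in\mathbb Z$), $k_h$ ($h\in\mathfrak h$), $h_{i,m}$ ($i\in\mathbb Z$, $m\in\mathbb Z\setminus\{0\}$). With $x_i^\pm(z)=\sum_{r}x_{i,r}^\pm z^r$, $\phi_i^\pm(z)=\sum_{m\ge0}\phi^\pm_{i,\pm m}z^{\pm m}=k_{\pm h_i}\exp(\pm(q-q^{-1})\sum_{m\ge1}h_{i,\pm m}z^{\pm m})$, $\delta(z)=\sum_{s\in\mathbb Z}z^s$, the relations are: $k_hk_{h'}=k_{h+h'}$, $k_0=1$; all $k_h$ and all coefficients of the $\phi_i^\pm(z)$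 commute; $k_hx_j^\pm(z)k_{-h}=q^{\pm\alpha_j(h)}x_j^\pm(z)$; for $\epsilon\in\{+,-\}$, $(w-q^{\pm C_{ij}}z)\phi_i^{\epsilon}(z)x_j^\pm(w)=(q^{\pm C_{ij}}w-z)x_j^\pm(w)\phi_i^{\epsilon}(z)$; $[x_i^+(z),x_j^-(w)]=\frac{\delta_{ij}}{q-q^{-1}}\big(\delta(w/z)\phi_i^+(w)-\delta(z/w)\phi_i^-(z)\big)$; $(w-q^{\pm C_{ij}}z)x_i^\pm(z)x_j^\pm(w)=(q^{\pm C_{ij}}w-z)x_j^\pm(w)x_i^\pm(z)$; for $|i-j|=1$, $x_i^\pm(z_1)x_i^\pm(z_2)x_j^\pm(w)-(q+q^{-1})x_i^\pm(z_1)x_j^\pm(w)x_i^\pm(z_2)+x_j^\pm(w)x_i^\pm(z_1)x_i^\pm(z_2)+(z_1\leftrightarrow z_2)=0$; and $[x_i^\pm(z),x_j^\pm(w)]=0$ for $|i-j|\ge2$. Integrable: a module $V$ is integrable if $V=\bigoplus_{\nu\in P}V_\nu$ with $V_\nu=\{v: k_{h_i}v=q^{\nu(h_i)}v\ \forall i\in\mathbb Z\}$ and all $x_{i,0}^\pm$ are locally nilpotent on $V$. Fundamental modules. Put $\psi(z)=\frac{q-q^{-1}z}{1-z}$. For $\ell\in\mathbb Z$ let $\mathcal T_\ell^+$ be the set of strictly increasing integer sequences $T=(\cdots<i_{\ell-1}<i_\ell)$ indexed by $p\le\ell$ with $i_p=p$ for $p\ll0$; for $s\in\mathbb Z$ let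 $\mathcal T_s^-$ be the set of strictly increasing sequences $T=(i_{s+1}<i_{s+2}<\cdots)$ indexed by $p\ge s+1$ with $i_p=p$ for $p\gg0$. For such $T$, $\tilde e_iT$ is obtained by replacing the entry $i+1$ by $i$ (and is $0$ if $i+1\notin T$ or $i\in T$), and $\tilde f_iT$ by replacing $i$ by $i+1$ (and is $0$ if $i\notin T$ or $i+1\in T$). $V(Y_{\ell,a})$ is the fundamental module (the simple $\ell$-highest weight module generated by $v$ with $x_{i,r}^+v=0$, $\phi_\ell^\pm(z)v=\psi(aqz)v$, $\phi_i^\pm(z)v=v$ for $i\ne\ell$), and $V(Y_{s,a}^{-1})$ is the simple $\ell$-lowest weight module generated by $v$ with $x_{i,r}^-v=0$, $\phi_s^\pm(z)v=\psi(aqz)^{-1}v$, $\phi_i^\pm(z)v=v$ for $i\neq s$. They have bases $\{T_a\}$ indexed by $T\in\mathcal T_\ell^+$, respectively $T\in\mathcal T_s^-$, with action (put $N=\ell$, respectively $N=s$; $0_a=0$; rational functions are expanded in $z^{\pm1}$ for $\phi_i^\pm$): $x_i^+(z)T_a=\sum_p\delta_{\{i_p=i+1\}}\delta(aq^{i+N+1-2p}z)(\tilde e_iT)_a$; $x_i^-(z)T_a=\sum_p\delta_{\{i_p=i\}}\delta(aq^{i+N+1-2p}z)(\tilde f_iT)_a$; $\phi_i^\pm(z)T_a=\psi(aq^{i+N+3-2p}z)^{-1}T_a$ if $i_p=i+1$ for some $p$ and $i\notin T$; $=\psi(aq^{i+N+1-2p}z)T_a$ if $i_p=i$ for some $p$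 and $i+1\notin T$; $=T_a$ otherwise. Drinfeld coproduct: $\Delta(x_i^+(z))=x_i^+(z)\otimes1+\phi_i^-(z)\otimes x_i^+(z)$, $\Delta(x_i^-(z))=x_i^-(z)\otimes\phi_i^+(z)+1\otimes x_i^-(z)$, $\Delta(\phi_i^\pm(z))=\phi_i^\pm(z)\otimes\phi_i^\pm(z)$. On tensors of basis vectors on which $\phi_i^\pm(z)$ acts by a rational function and $x_i^\pm(z)$ by delta series, a product of a rational function $f(z)$ and $\delta(cz)$ is understood as $f(c^{-1})\delta(cz)$, and $\Delta$ is called well-defined if $f$ never has a pole at the relevant point $c^{-1}$. *)

theory Defs
  imports "HOL-Complex_Analysis.Complex_Analysis" "HOL-Library.Poly_Mapping" "HOL-Library.FuncSet"
begin

section \<open>The quantum affinization of $sl_\infty$ and its modules\<close>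

datatype sign = Plus | Minus

primrec sg :: "sign \<Rightarrow> int" where
  "sg Plus = 1"
| "sg Minus = -1"

definition cartan :: "int \<Rightarrow> int \<Rightarrow> int" where
  "cartan i j = (if i = j then 2 else if \<bar>i - j\<bar> = 1 then -1 else 0)"

type_synonym cartan_space = "int \<Rightarrow>\<^sub>0 rat"
type_synonym weight = "int \<Rightarrow>\<^sub>0 int"

text \<open>An element of the Cartan space is the finitely supported family of its coordinates in the
  basis \<open>h\<^sub>i\<close>, an element of the weight lattice \<open>P\<close> that of its coordinates in the basis
  \<open>\<Lambda>\<^sub>i\<close>. Thus \<open>\<Lambda>\<^sub>i(h) = lookup h i\<close>, and \<open>\<nu>(h\<^sub>i) = lookup \<nu> i\<close>.\<close>

definition h_elt :: "int \<Rightarrow> cartan_space" where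
  "h_elt i = Poly_Mapping.single i 1"

definition simple_root :: "int \<Rightarrow> cartan_space \<Rightarrow> rat" where
  "simple_root j h = 2 * Poly_Mapping.lookup h j - Poly_Mapping.lookup h (j - 1) - Poly_Mapping.lookup h (j + 1)"

definition qrat :: "complex \<Rightarrow> rat \<Rightarrow> complex" where
  "qrat t r = exp (t * of_rat r)"

text \<open>A complex vector space (whose carrier is the whole type) with one operator for each generator:
  \<open>xop M e i r\<close> for \<open>x\<^sub>i\<^sub>,\<^sub>r\<close> of sign \<open>e\<close>, \<open>kop M h\<close> for \<open>k\<^sub>h\<close>, and \<open>hop M i m\<close> for \<open>h\<^sub>i\<^sub>,\<^sub>m\<close>.
  The value of \<open>hop M i 0\<close> is never used.\<close>

record 'v uq_ops =
  scl :: "complex \<Rightarrow> 'v \<Rightarrow> 'v"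
  xop :: "sign \<Rightarrow> int \<Rightarrow> int \<Rightarrow> 'v \<Rightarrow> 'v"
  kop :: "cartan_space \<Rightarrow> 'v \<Rightarrow> 'v"
  hop :: "int \<Rightarrow> int \<Rightarrow> 'v \<Rightarrow> 'v"

text \<open>\<open>ser_pow A n m\<close> is the coefficient of \<open>z^m\<close> in the \<open>n\<close>-th power of the operator-valued
  series \<open>\<Sum>\<^sub>k\<^sub>\<ge>\<^sub>1 A k z^k\<close>. It vanishes for \<open>m < n\<close>, so that the sum over \<open>n \<le> m\<close>
  below is the whole coefficient of the exponential series.\<close>

primrec ser_pow :: "(nat \<Rightarrow> 'v \<Rightarrow> 'v) \<Rightarrow> nat \<Rightarrow> nat \<Rightarrow> 'v \<Rightarrow> ('v::ab_group_add)" where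
  "ser_pow A 0 m v = (if m = 0 then v else 0)"
| "ser_pow A (Suc n) m v = (\<Sum>k=1..m. A k (ser_pow A n (m - k) v))"

definition ser_exp :: "(complex \<Rightarrow> 'v \<Rightarrow> 'v) \<Rightarrow> (nat \<Rightarrow> 'v \<Rightarrow> 'v) \<Rightarrow> nat \<Rightarrow> 'v \<Rightarrow> ('v::ab_group_add)" where
  "ser_exp s A m v = (\<Sum>n\<le>m. s (1 / fact n) (ser_pow A n m v))"

text \<open>\<open>phi t M e i m\<close> is the coefficient of \<open>z^m\<close> (\<open>m\<close> an integer) in \<open>\<phi>\<^sub>i(z)\<close> of sign \<open>e\<close>;
  it is zero unless \<open>m\<close> has sign \<open>e\<close> or is zero.\<close>

definition phi :: "complex \<Rightarrow> ('v::ab_group_add) uq_ops \<Rightarrow> sign \<Rightarrow> int \<Rightarrow> int \<Rightarrow> 'v \<Rightarrow> 'v" where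
  "phi t M e i m v =
    (if 0 \<le> sg e * m then
       kop M (Poly_Mapping.single i (of_int (sg e)))
         (ser_exp (scl M)
            (\<lambda>n u. scl M (of_int (sg e) * (exp t - 1 / exp t)) (hop M i (sg e * int n) u))
            (nat (sg e * m)) v)
     else 0)"

text \<open>The defining relations between the generating series are stated coefficientwise, for the
  coefficient of \<open>z^m w^s\<close>, \<open>z^r w^s\<close> or \<open>z\<^sub>1^r\<^sub>1 z\<^sub>2^r\<^sub>2 w^s\<close>. In \<open>x_x\<close>, the
  coefficient of \<open>z^r w^s\<close> in both \<open>\<delta>(w/z) \<phi>(w)\<close> and \<open>\<delta>(z/w) \<phi>(z)\<close> is the coefficient of
  index \<open>r + s\<close> of \<open>\<phi>\<close>.\<close>

locale uq_module =
  fixes t :: complex and M :: "('v::ab_group_add) uq_ops"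
  assumes vs: "vector_space (scl M)"
    and lin_x: "Vector_Spaces.linear (scl M) (scl M) (xop M e i r)"
    and lin_k: "Vector_Spaces.linear (scl M) (scl M) (kop M h)"
    and lin_h: "m \<noteq> 0 \<Longrightarrow> Vector_Spaces.linear (scl M) (scl M) (hop M i m)"
    and k_add: "kop M h (kop M h' v) = kop M (h + h') v"
    and k_zero: "kop M 0 v = v"
    and k_phi: "kop M h (phi t M e i m v) = phi t M e i m (kop M h v)"
    and phi_phi: "phi t M e i m (phi t M e' j n v) = phi t M e' j n (phi t M e i m v)"
    and k_x: "kop M h (xop M e j r (kop M (- h) v)) =
                scl M (qrat t (of_int (sg e) * simple_root j h)) (xop M e j r v)"
    and phi_x: "phi t M e' i m (xop M e j (s - 1) v)
                  - scl M (exp t powi (sg e * cartan i j)) (phi t M e' i (m - 1) (xop M e j s v)) =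
                scl M (exp t powi (sg e * cartan i j)) (xop M e j (s - 1) (phi t M e' i m v))
                  - xop M e j s (phi t M e' i (m - 1) v)"
    and x_x: "xop M Plus i r (xop M Minus j s v) - xop M Minus j s (xop M Plus i r v) =
                (if i = j then scl M (1 / (exp t - 1 / exp t))
                                 (phi t M Plus i (r + s) v - phi t M Minus i (r + s) v)
                 else 0)"
    and x_quad: "xop M e i r (xop M e j (s - 1) v)
                   - scl M (exp t powi (sg e * cartan i j)) (xop M e i (r - 1) (xop M e j s v)) =
                 scl M (exp t powi (sg e * cartan i j)) (xop M e j (s - 1) (xop M e i r v))
                   - xop M e j s (xop M e i (r - 1) v)"
    and serre: "\<bar>i - j\<bar> = 1 \<Longrightarrow>
                (\<Sum>(r1, r2)\<leftarrow>[(r, r'), (r', r)].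
                   xop M e i r1 (xop M e i r2 (xop M e j s v))
                   - scl M (exp t + 1 / exp t) (xop M e i r1 (xop M e j s (xop M e i r2 v)))
                   + xop M e j s (xop M e i r1 (xop M e i r2 v))) = 0"
    and x_far: "\<bar>i - j\<bar> \<ge> 2 \<Longrightarrow> xop M e i r (xop M e j s v) = xop M e j s (xop M e i r v)"

definition weight_space :: "complex \<Rightarrow> 'v uq_ops \<Rightarrow> weight \<Rightarrow> 'v set" where
  "weight_space t M \<nu> =
    {v. \<forall>i. kop M (h_elt i) v = scl M (exp t powi Poly_Mapping.lookup \<nu> i) v}"

text \<open>The decomposition \<open>V = \<Oplus>\<^sub>\<nu> V\<^sub>\<nu>\<close>: every vector has exactly one finitely supported
  family of components.\<close>

definition integrable_module :: "complex \<Rightarrow> ('v::ab_group_add) uq_ops \<Rightarrow> bool" where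
  "integrable_module t M \<longleftrightarrow>
    (\<forall>v. \<exists>!F :: weight \<Rightarrow>\<^sub>0 'v.
        (\<forall>\<nu>. Poly_Mapping.lookup F \<nu> \<in> weight_space t M \<nu>) \<and>
        v = (\<Sum>\<nu>\<in>Poly_Mapping.keys F. Poly_Mapping.lookup F \<nu>)) \<and>
    (\<forall>e i v. \<exists>n. (xop M e i 0 ^^ n) v = 0)"

definition submodule :: "('v::ab_group_add) uq_ops \<Rightarrow> 'v set \<Rightarrow> bool" where
  "submodule M S \<longleftrightarrow>
    module.subspace (scl M) S \<and>
    (\<forall>v\<in>S. (\<forall>e i r. xop M e i r v \<in> S) \<and> (\<forall>h. kop M h v \<in> S) \<and>
            (\<forall>i m. m \<noteq> 0 \<longrightarrow> hop M i m v \<in> S))"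

definition simple_module :: "('v::ab_group_add) uq_ops \<Rightarrow> bool" where
  "simple_module M \<longleftrightarrow>
    (\<exists>v::'v. v \<noteq> 0) \<and> (\<forall>S. submodule M S \<longrightarrow> S = {0} \<or> S = UNIV)"

definition generated_by :: "('v::ab_group_add) uq_ops \<Rightarrow> 'v \<Rightarrow> bool" where
  "generated_by M v \<longleftrightarrow> (\<forall>S. submodule M S \<and> v \<in> S \<longrightarrow> S = UNIV)"

section \<open>Fundamental modules\<close>

definition psi :: "complex \<Rightarrow> complex \<Rightarrow> complex" where
  "psi q z = (q - inverse q * z) / (1 - z)"

text \<open>\<open>\<phi>\<^sub>i(z) v = f(z) v\<close> for both signs, the rational function \<open>f\<close> being expanded in powers of
  \<open>z\<close> for the sign plus and in powers of \<open>z\<^sup>-\<^sup>1\<close> for the sign minus.\<close>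

definition phi_acts :: "complex \<Rightarrow> ('v::ab_group_add) uq_ops \<Rightarrow> int \<Rightarrow> 'v \<Rightarrow> (complex \<Rightarrow> complex) \<Rightarrow> bool" where
  "phi_acts t M i v f \<longleftrightarrow>
    (\<exists>c d. f has_laurent_expansion fps_to_fls c \<and>
           (\<lambda>u. f (1 / u)) has_laurent_expansion fps_to_fls d \<and>
           (\<forall>m. phi t M Plus i (int m) v = scl M (fps_nth c m) v \<and>
                phi t M Minus i (- int m) v = scl M (fps_nth d m) v))"

definition fundamental_plus :: "complex \<Rightarrow> int \<Rightarrow> complex \<Rightarrow> ('v::ab_group_add) uq_ops \<Rightarrow> bool" where
  "fundamental_plus t l a M \<longleftrightarrow>
    uq_module t M \<and> simple_module M \<and>
    (\<exists>v. v \<noteq> 0 \<and> generated_by M v \<and>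
         (\<forall>i r. xop M Plus i r v = 0) \<and>
         phi_acts t M l v (\<lambda>z. psi (exp t) (a * exp t * z)) \<and>
         (\<forall>i. i \<noteq> l \<longrightarrow> phi_acts t M i v (\<lambda>z. 1)))"

definition fundamental_minus :: "complex \<Rightarrow> int \<Rightarrow> complex \<Rightarrow> ('v::ab_group_add) uq_ops \<Rightarrow> bool" where
  "fundamental_minus t s a M \<longleftrightarrow>
    uq_module t M \<and> simple_module M \<and>
    (\<exists>v. v \<noteq> 0 \<and> generated_by M v \<and>
         (\<forall>i r. xop M Minus i r v = 0) \<and>
         phi_acts t M s v (\<lambda>z. inverse (psi (exp t) (a * exp t * z))) \<and>
         (\<forall>i. i \<noteq> s \<longrightarrow> phi_acts t M i v (\<lambda>z. 1)))"

subsection \<open>Tableaux\<close>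

text \<open>A sequence indexed by a set \<open>J\<close> of integers is an extensional function on \<open>J\<close>.\<close>

definition tab_plus :: "int \<Rightarrow> (int \<Rightarrow> int) set" where
  "tab_plus l = {T \<in> extensional {..l}. strict_mono_on {..l} T \<and> (\<exists>N\<le>l. \<forall>p\<le>N. T p = p)}"

definition tab_minus :: "int \<Rightarrow> (int \<Rightarrow> int) set" where
  "tab_minus s = {T \<in> extensional {s+1..}. strict_mono_on {s+1..} T \<and> (\<exists>N\<ge>s+1. \<forall>p\<ge>N. T p = p)}"

definition replace_entry :: "int set \<Rightarrow> int \<Rightarrow> int \<Rightarrow> (int \<Rightarrow> int) \<Rightarrow> (int \<Rightarrow> int) option" where
  "replace_entry J i j T =
    (if i \<in> T ` J \<and> j \<notin> T ` J then Some (\<lambda>p. if p \<in> J \<and> T p = i then j else T p) else None)"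

definition e_tilde :: "int set \<Rightarrow> int \<Rightarrow> (int \<Rightarrow> int) \<Rightarrow> (int \<Rightarrow> int) option" where
  "e_tilde J i T = replace_entry J (i + 1) i T"

definition f_tilde :: "int set \<Rightarrow> int \<Rightarrow> (int \<Rightarrow> int) \<Rightarrow> (int \<Rightarrow> int) option" where
  "f_tilde J i T = replace_entry J i (i + 1) T"

definition entry_pos :: "int set \<Rightarrow> (int \<Rightarrow> int) \<Rightarrow> int \<Rightarrow> int" where
  "entry_pos J T i = (THE p. p \<in> J \<and> T p = i)"

text \<open>An indexed family of vectors \<open>b\<^sub>T\<close> on which \<open>\<phi>\<^sub>i(z)\<close> acts by the rational function
  \<open>eig i T\<close> and \<open>x\<^sub>i(z)\<close> of sign \<open>e\<close> by delta series:
  \<open>x\<^sub>i(z) b\<^sub>T = \<Sum> \<delta>(c z) b\<^sub>T\<^sub>'\<close>, summed over the finite set of pairs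
  \<open>(c, T') \<in> delta e i T\<close>.\<close>

record 'i delta_data =
  idx :: "'i set"
  eig :: "int \<Rightarrow> 'i \<Rightarrow> complex \<Rightarrow> complex"
  delta :: "sign \<Rightarrow> int \<Rightarrow> 'i \<Rightarrow> (complex \<times> 'i) set"

definition is_basis :: "(complex \<Rightarrow> 'v \<Rightarrow> 'v) \<Rightarrow> ('v::ab_group_add) set \<Rightarrow> bool" where
  "is_basis s B \<longleftrightarrow> \<not> module.dependent s B \<and> module.span s B = UNIV"

definition delta_basis ::
    "complex \<Rightarrow> ('v::ab_group_add) uq_ops \<Rightarrow> 'i delta_data \<Rightarrow> ('i \<Rightarrow> 'v) \<Rightarrow> bool" where
  "delta_basis t M D b \<longleftrightarrow>
    inj_on b (idx D) \<and> is_basis (scl M) (b ` idx D) \<and>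
    (\<forall>T\<in>idx D. \<forall>i.
       phi_acts t M i (b T) (eig D i T) \<and>
       (\<forall>e r. xop M e i r (b T) = (\<Sum>(c, T')\<in>delta D e i T. scl M (c powi r) (b T'))))"

definition tableau_eig ::
    "complex \<Rightarrow> complex \<Rightarrow> int \<Rightarrow> int set \<Rightarrow> int \<Rightarrow> (int \<Rightarrow> int) \<Rightarrow> complex \<Rightarrow> complex" where
  "tableau_eig q a N J i T z =
    (if i + 1 \<in> T ` J \<and> i \<notin> T ` J
       then inverse (psi q (a * q powi (i + N + 3 - 2 * entry_pos J T (i + 1)) * z))
     else if i \<in> T ` J \<and> i + 1 \<notin> T ` J
       then psi q (a * q powi (i + N + 1 - 2 * entry_pos J T i) * z)
     else 1)"

definition tableau_delta ::
    "complex \<Rightarrow> complex \<Rightarrow> int \<Rightarrow> int set \<Rightarrow> sign \<Rightarrow> int \<Rightarrow> (int \<Rightarrow> int) \<Rightarrow> (complex \<times> (int \<Rightarrow> int)) set" where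
  "tableau_delta q a N J e i T =
    (case e of
       Plus \<Rightarrow> {(a * q powi (i + N + 1 - 2 * p), T') | p T'.
                  p \<in> J \<and> T p = i + 1 \<and> e_tilde J i T = Some T'}
     | Minus \<Rightarrow> {(a * q powi (i + N + 1 - 2 * p), T') | p T'.
                  p \<in> J \<and> T p = i \<and> f_tilde J i T = Some T'})"

definition tab_plus_data :: "complex \<Rightarrow> int \<Rightarrow> complex \<Rightarrow> (int \<Rightarrow> int) delta_data" where
  "tab_plus_data q l a =
    \<lparr>idx = tab_plus l, eig = tableau_eig q a l {..l}, delta = tableau_delta q a l {..l}\<rparr>"

definition tab_minus_data :: "complex \<Rightarrow> int \<Rightarrow> complex \<Rightarrow> (int \<Rightarrow> int) delta_data" where
  "tab_minus_data q s a =
    \<lparr>idx = tab_minus s, eig = tableau_eig q a s {s+1..}, delta = tableau_delta q a s {s+1..}\<rparr>"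

section \<open>Tensor products and the Drinfeld coproduct\<close>

definition is_tensor_product ::
    "(complex \<Rightarrow> 'v \<Rightarrow> 'v) \<Rightarrow> (complex \<Rightarrow> 'w \<Rightarrow> 'w) \<Rightarrow> (complex \<Rightarrow> 'u \<Rightarrow> 'u) \<Rightarrow>
     ('v::ab_group_add \<Rightarrow> 'w::ab_group_add \<Rightarrow> 'u::ab_group_add) \<Rightarrow> bool" where
  "is_tensor_product sV sW sU \<tau> \<longleftrightarrow>
    vector_space sU \<and>
    (\<forall>w. Vector_Spaces.linear sV sU (\<lambda>v. \<tau> v w)) \<and>
    (\<forall>v. Vector_Spaces.linear sW sU (\<tau> v)) \<and>
    (\<forall>B C. is_basis sV B \<and> is_basis sW C \<longrightarrow>
       inj_on (\<lambda>(v, w). \<tau> v w) (B \<times> C) \<and> is_basis sU ((\<lambda>(v, w). \<tau> v w) ` (B \<times> C)))"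

definition coproduct_well_defined :: "'i delta_data \<Rightarrow> 'j delta_data \<Rightarrow> bool" where
  "coproduct_well_defined D E \<longleftrightarrow>
    (\<forall>T\<in>idx D. \<forall>S\<in>idx E. \<forall>i.
       (\<forall>(c, S')\<in>delta E Plus i S. \<not> is_pole (eig D i T) (inverse c)) \<and>
       (\<forall>(c, T')\<in>delta D Minus i T. \<not> is_pole (eig E i S) (inverse c)))"

text \<open>\<open>U\<close> is a family of operators on the tensor product given by the coproduct, in terms of the
  bases \<open>b\<close> and \<open>b'\<close>. A product \<open>f(z) \<delta>(c z)\<close> is read as \<open>f(c\<^sup>-\<^sup>1) \<delta>(c z)\<close>. The rational
  functions used here (\<open>\<psi>\<close>, its inverse and 1) have no removable singularities at which their
  value as a HOL function would be wrong. The
  \<open>k\<^sub>h\<close> are group-like, in accordance with \<open>\<phi>\<^sub>i\<^sub>,\<^sub>0\<close> being \<open>k\<close> of plus or minus \<open>h\<^sub>i\<close>; the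
  action of the \<open>h\<^sub>i\<^sub>,\<^sub>m\<close> is determined by that of the \<open>\<phi>\<^sub>i(z)\<close>.\<close>

definition coproduct_action ::
    "complex \<Rightarrow> ('v::ab_group_add) uq_ops \<Rightarrow> 'i delta_data \<Rightarrow> ('i \<Rightarrow> 'v) \<Rightarrow>
     ('w::ab_group_add) uq_ops \<Rightarrow> 'j delta_data \<Rightarrow> ('j \<Rightarrow> 'w) \<Rightarrow>
     ('v \<Rightarrow> 'w \<Rightarrow> 'u) \<Rightarrow> ('u::ab_group_add) uq_ops \<Rightarrow> bool" where
  "coproduct_action t V D b W E b' \<tau> U \<longleftrightarrow>
    (\<forall>h v w. kop U h (\<tau> v w) = \<tau> (kop V h v) (kop W h w)) \<and>
    (\<forall>e i m v w. phi t U e i (sg e * int m) (\<tau> v w) =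
       (\<Sum>j\<le>m. \<tau> (phi t V e i (sg e * int j) v) (phi t W e i (sg e * int (m - j)) w))) \<and>
    (\<forall>T\<in>idx D. \<forall>S\<in>idx E. \<forall>i r.
       xop U Plus i r (\<tau> (b T) (b' S)) =
         \<tau> (xop V Plus i r (b T)) (b' S)
         + (\<Sum>(c, S')\<in>delta E Plus i S.
              scl U (eig D i T (inverse c) * c powi r) (\<tau> (b T) (b' S'))) \<and>
       xop U Minus i r (\<tau> (b T) (b' S)) =
         (\<Sum>(c, T')\<in>delta D Minus i T.
              scl U (eig E i S (inverse c) * c powi r) (\<tau> (b T') (b' S)))
         + \<tau> (b T) (xop W Minus i r (b' S)))"

end

theory Submission
  imports Defs
begin

text \<open>In both tensor factors, \<open>x\<^sub>i(z)\<close> acts on a basis vector through at most one entry of the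
  tableau, with a delta function at \<open>c = a q\<^bsup>l+i+1-2p\<^esup>\<close> where \<open>p\<close> is the position of that entry, and
  \<open>\<phi>\<^sub>i(z)\<close> has its only pole at \<open>z = 1 / c\<close>. As \<open>T\<^sub>p \<ge> p\<close> in the first factor and \<open>S\<^sub>p \<le> p\<close> in the
  second one, the positions at which \<open>i\<close> or \<open>i + 1\<close> can be exchanged are never equal in \<open>T\<close> and
  \<open>S\<close>. So the poles are never hit and the products of two eigenvalues have simple poles only.
  All relations then follow from identities between the rational functions
  \<open>(y - q\<^sup>2 c) / (q (y - c))\<close> and \<open>(q\<^sup>2 y - c) / (q (y - c))\<close>, since a move by \<open>x\<^sub>j\<close> with
  \<open>|i - j| = 1\<close> either creates or destroys a possible \<open>i\<close>-move, at a parameter shifted by \<open>q\<close>.\<close>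

section \<open>Eigenvalues and combinatorial data of a module\<close>

text \<open>The parameter of the second factor is chosen so that both factors get the same prefactor
  \<open>A = a q^l\<close>; as \<open>q\<close> is not a root of unity, two poles for the same
  \<open>i\<close> can then coincide only if the positions do. The coproduct of each
  \<open>x\<^sub>i(z)\<close> is a sum of two operators, one moving each factor, and every relation
  splits according to which factor each letter moves. Words that stay in one factor vanish or obey
  the relations of that factor. The mixed words carry the content, because one of the two summands
  is weighted by an eigenvalue of the factor that the other one moves. Two families of operators are
  not written down by the data. The modules prescribe \<open>\<phi>\<^sub>i\<close>, hence
  \<open>k\<^sub>h\<close> only for integral combinations \<open>h\<close> of the
  \<open>h\<^sub>i\<close>; for rational \<open>h\<close> it has to be deduced that
  \<open>k\<^sub>h\<close> is diagonal. On the tensor product the coproduct gives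
  \<open>\<phi>\<^sub>i\<close> but no formula for \<open>h\<^sub>i\<^sub>,\<^sub>m\<close>, so that
  logarithms of series are needed.\<close>

primrec neg :: "sign \<Rightarrow> sign" where
  "neg Plus = Minus"
| "neg Minus = Plus"

lemma neg_neg [simp]: "neg (neg e) = e"
  by (cases e) auto

lemma neg_neq [simp]: "neg e \<noteq> e" "e \<noteq> neg e"
  by (cases e; simp)+

lemma sg_neg [simp]: "sg (neg e) = - sg e"
  by (cases e) auto

text \<open>\<open>None\<close> if both \<open>x\<^sub>i(z)\<close> kill a basis vector, and \<open>Some (e, c)\<close> if only the one of sign \<open>e\<close> acts,
  with \<open>\<delta>(c z)\<close>. This determines the eigenvalue of \<open>\<phi>\<^sub>i(z)\<close>; \<open>eig_at\<close> is its value at \<open>z = 1 / y\<close>.\<close>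

type_synonym state = "(sign \<times> complex) option"

definition eig_at :: "complex \<Rightarrow> state \<Rightarrow> complex \<Rightarrow> complex" where
  "eig_at q x y =
    (case x of
       None \<Rightarrow> 1
     | Some (e, c) \<Rightarrow> (case e of Plus \<Rightarrow> (y - q\<^sup>2 * c) / (q * (y - c))
                               | Minus \<Rightarrow> (q\<^sup>2 * y - c) / (q * (y - c))))"

lemma eig_at_None [simp]: "eig_at q None y = 1"
  by (simp add: eig_at_def)

lemma eig_at_Plus: "eig_at q (Some (Plus, c)) y = (y - q\<^sup>2 * c) / (q * (y - c))"
  and eig_at_Minus: "eig_at q (Some (Minus, c)) y = (q\<^sup>2 * y - c) / (q * (y - c))"
  by (simp_all add: eig_at_def)

text \<open>The two numerators add up to \<open>(1 + q\<^sup>2) * (y - c)\<close>, which cancels the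
  pole. The resulting constant is the coefficient of the middle term of the Serre relations, where
  the identity is used.\<close>

lemma eig_at_sum:
  assumes "q \<noteq> 0" "y \<noteq> c"
  shows "eig_at q (Some (e, c)) y + eig_at q (Some (neg e, c)) y = q + 1 / q"
  using assms by (cases e) (simp_all add: eig_at_Plus eig_at_Minus divide_simps power2_eq_square, simp_all add: algebra_simps)

definition regular_at :: "state \<Rightarrow> complex \<Rightarrow> bool" where
  "regular_at x y \<longleftrightarrow> (\<forall>e c. x = Some (e, c) \<longrightarrow> c \<noteq> y)"

lemma regular_at_None [simp]: "regular_at None y"
  and regular_at_Some [simp]: "regular_at (Some (e, c)) y \<longleftrightarrow> c \<noteq> y"
  by (auto simp: regular_at_def)

text \<open>\<open>nx i F\<close> is the basis vector to which the nonzero \<open>x\<^sub>i(z)\<close> moves \<open>F\<close>; it is junk if there is none.\<close>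

locale thin =
  fixes q :: complex and I :: "'i set"
    and st :: "int \<Rightarrow> 'i \<Rightarrow> state" and nx :: "int \<Rightarrow> 'i \<Rightarrow> 'i"
  assumes q_nz: "q \<noteq> 0"
    and closed: "F \<in> I \<Longrightarrow> st i F \<noteq> None \<Longrightarrow> nx i F \<in> I"
    and st_nz: "F \<in> I \<Longrightarrow> st i F = Some (e, c) \<Longrightarrow> c \<noteq> 0"
    and st_nx: "F \<in> I \<Longrightarrow> st i F = Some (e, c) \<Longrightarrow> st i (nx i F) = Some (neg e, c)"
    and nx_nx: "F \<in> I \<Longrightarrow> st i F \<noteq> None \<Longrightarrow> nx i (nx i F) = F"
    and st_far: "F \<in> I \<Longrightarrow> st i F \<noteq> None \<Longrightarrow> 2 \<le> \<bar>i - j\<bar> \<Longrightarrow> st j (nx i F) = st j F"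
    and nx_far: "F \<in> I \<Longrightarrow> st i F \<noteq> None \<Longrightarrow> st j F \<noteq> None \<Longrightarrow> 2 \<le> \<bar>i - j\<bar> \<Longrightarrow>
                   nx i (nx j F) = nx j (nx i F)"
    and st_near: "F \<in> I \<Longrightarrow> st i F = Some (e, c) \<Longrightarrow> \<bar>i - j\<bar> = 1 \<Longrightarrow>
                   st j F = None \<and> st j (nx i F) = Some (e, c * q powi - sg e) \<or>
                   st j F = Some (neg e, c * q powi sg e) \<and> st j (nx i F) = None"
begin

lemma near_cases:
  assumes "F \<in> I" "st i F = Some (e, c)" "\<bar>i - j\<bar> = 1"
  obtains (created) "st j F = None" "st j (nx i F) = Some (e, c * q powi - sg e)"
  | (destroyed) "st j F = Some (neg e, c * q powi sg e)" "st j (nx i F) = None"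
  using st_near[OF assms] that by argo

lemma index_cases:
  obtains (same) "j = i" | (near) "\<bar>i - j\<bar> = 1" | (far) "2 \<le> \<bar>i - (j::int)\<bar>"
  by linarith

text \<open>The relation between \<open>\<phi>\<^sub>j(z)\<close> and \<open>x\<^sub>i(w)\<close>,
  evaluated at \<open>z = 1 / y\<close> and at the support \<open>w = 1 / c\<close> of the delta
  series, with denominators cleared. It measures how a move of one factor changes the weight with
  which the other factor is moved.\<close>

lemma exch:
  assumes F: "F \<in> I" and i: "st i F = Some (e, c)"
    and ap: "regular_at (st j F) y" "regular_at (st j (nx i F)) y"
  shows "(c - q powi (sg e * cartan i j) * y) * eig_at q (st j F) y =
         (q powi (sg e * cartan i j) * c - y) * eig_at q (st j (nx i F)) y"
proof (cases rule: index_cases[where i = i and j = j])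
  case same
  then show ?thesis
    using i st_nx[OF F i] ap q_nz
    by (cases e) (simp_all add: cartan_def eig_at_Plus eig_at_Minus power_int_minus divide_simps power2_eq_square, simp_all add: algebra_simps)
next
  case near
  then have C: "cartan i j = -1" by (auto simp: cartan_def)
  show ?thesis
    using F i near
  proof (cases rule: near_cases)
    case created
    with ap q_nz show ?thesis unfolding C
      by (cases e) (simp_all add: eig_at_Plus eig_at_Minus power_int_minus divide_simps power2_eq_square, simp_all add: algebra_simps)
  next
    case destroyed
    with ap q_nz show ?thesis unfolding C
      by (cases e) (simp_all add: eig_at_Plus eig_at_Minus power_int_minus divide_simps power2_eq_square, simp_all add: algebra_simps)
  qed
next
  case far
  then have C: "cartan i j = 0" by (auto simp: cartan_def)
  show ?thesis using st_far[OF F _ far] i by (simp add: C)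
qed

end

section \<open>Expansions of the eigenvalues\<close>

text \<open>Both expansions of \<open>1 / (1 - c z)\<close> are treated as the power series quotient
  \<open>a / (a - c b)\<close> with \<open>b / a = z\<close>: the variable is \<open>z\<close> for the sign plus and \<open>1 / z\<close> for
  the sign minus.\<close>

definition zden :: "sign \<Rightarrow> complex fps" where "zden e = (case e of Plus \<Rightarrow> 1 | Minus \<Rightarrow> fps_X)"
definition znum :: "sign \<Rightarrow> complex fps" where "znum e = (case e of Plus \<Rightarrow> fps_X | Minus \<Rightarrow> 1)"

definition geo :: "sign \<Rightarrow> complex \<Rightarrow> complex fps" where
  "geo e c = (case e of Plus \<Rightarrow> Abs_fps (\<lambda>n. c ^ n)
                      | Minus \<Rightarrow> Abs_fps (\<lambda>n. if n = 0 then 0 else - ((1 / c) ^ n)))"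

lemma geo_eq: 
  assumes "c \<noteq> 0"
  shows "geo e c * (zden e - fps_const c * znum e) = zden e"
proof (cases e)
  case Plus
  have "Abs_fps (\<lambda>n. c ^ n) * (1 - fps_const c * fps_X) = 1"
  proof (rule fps_ext)
    fix n show "(Abs_fps (\<lambda>n. c ^ n) * (1 - fps_const c * fps_X)) $ n = 1 $ n"
      by (cases n) (simp_all add: algebra_simps fps_mult_fps_X_commute[symmetric] flip: fps_const_mult_left)
  qed
  then show ?thesis by (simp add: Plus geo_def zden_def znum_def)
next
  case Minus
  have "Abs_fps (\<lambda>n. if n = 0 then 0 else - ((1 / c) ^ n)) * (fps_X - fps_const c) = fps_X"
  proof (rule fps_ext)
    fix n show "(Abs_fps (\<lambda>n. if n = 0 then 0 else - ((1 / c) ^ n)) * (fps_X - fps_const c)) $ n = fps_X $ n"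
      using assms by (cases n) (auto simp: algebra_simps fps_X_nth)
  qed
  then show ?thesis by (simp add: Minus geo_def zden_def znum_def)
qed

lemma zden_znum_nz: "c \<noteq> 0 \<Longrightarrow> zden e - fps_const c * znum e \<noteq> 0"
  using geo_eq[of c e] by (cases e) (auto simp: zden_def znum_def)

text \<open>The partial fraction form of the eigenvalue: it equals \<open>q powi - sg e'\<close> at
  \<open>z = 0\<close> and \<open>q powi sg e'\<close> at infinity. The pole sits in the single
  summand \<open>geo\<close>, so that residues can be read off.\<close>

definition eig_ser :: "complex \<Rightarrow> sign \<Rightarrow> state \<Rightarrow> complex fps" where
  "eig_ser q e x =
    (case x of
       None \<Rightarrow> 1
     | Some (e', c) \<Rightarrow> fps_const (q powi sg e') + fps_const (q powi - sg e' - q powi sg e') * geo e c)"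

lemma eig_ser_None [simp]: "eig_ser q e None = 1"
  by (simp add: eig_ser_def)

lemma eig_ser_Some:
  "eig_ser q e (Some (e', c)) =
     fps_const (q powi sg e') + fps_const (q powi - sg e' - q powi sg e') * geo e c"
  by (simp add: eig_ser_def)

lemma eig_ser_mult:
  assumes "c \<noteq> 0"
  shows "eig_ser q e (Some (e', c)) * (zden e - fps_const c * znum e) =
         fps_const (q powi - sg e') * zden e - fps_const (q powi sg e' * c) * znum e"
proof -
  have "eig_ser q e (Some (e', c)) * (zden e - fps_const c * znum e) =
     fps_const (q powi sg e') * (zden e - fps_const c * znum e)
     + fps_const (q powi - sg e' - q powi sg e') * (geo e c * (zden e - fps_const c * znum e))"
    by (simp add: eig_ser_Some algebra_simps)
  also have "\<dots> = fps_const (q powi - sg e') * zden e - fps_const (q powi sg e' * c) * znum e"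
    unfolding geo_eq[OF assms]
    by (simp add: algebra_simps fps_const_sub[symmetric] fps_const_mult[symmetric] del: fps_const_mult fps_const_sub)
  finally show ?thesis .
qed

text \<open>Partial fractions for two distinct simple poles. Multiplying by both denominators, which
  are nonzero in an integral domain, lets one computation serve both expansions.\<close>

lemma geo_mult:
  assumes "c \<noteq> 0" "d \<noteq> 0" "c \<noteq> d"
  shows "geo e c * geo e d = fps_const (c / (c - d)) * geo e c + fps_const (d / (d - c)) * geo e d"
proof -
  let ?C = "zden e - fps_const c * znum e" and ?D = "zden e - fps_const d * znum e"
  have *: "fps_const (c / (c - d)) - fps_const (d / (c - d)) = 1"
    using assms by (simp add: fps_const_sub flip: diff_divide_distrib)
  have **: "fps_const (c / (c - d)) * fps_const d = fps_const (d / (c - d)) * fps_const c"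
    by (simp add: fps_const_mult)
  have m: "fps_const (d / (d - c)) = - fps_const (d / (c - d))"
    by (metis fps_const_neg minus_diff_eq minus_divide_right)
  have ring: "(x * g - y * h) * (u * v) = x * v * (g * u) - y * u * (h * v)" for x y g h u v :: "complex fps"
    by (simp add: algebra_simps)
  have "(fps_const (c / (c - d)) * geo e c + fps_const (d / (d - c)) * geo e d) * (?C * ?D)
     = fps_const (c / (c - d)) * ?D * (geo e c * ?C) - fps_const (d / (c - d)) * ?C * (geo e d * ?D)"
    unfolding m mult_minus_left add_uminus_conv_diff by (rule ring)
  also have "\<dots> = zden e * (zden e * (fps_const (c / (c - d)) - fps_const (d / (c - d)))
       - znum e * (fps_const (c / (c - d)) * fps_const d - fps_const (d / (c - d)) * fps_const c))"
    unfolding geo_eq[OF assms(1)] geo_eq[OF assms(2)]  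
    by (simp only: algebra_simps)
  also have "\<dots> = (geo e c * ?C) * (geo e d * ?D)"
    unfolding geo_eq[OF assms(1)] geo_eq[OF assms(2)] * ** by simp
  also have "\<dots> = (geo e c * geo e d) * (?C * ?D)"
    by (simp only: mult_ac)
  finally show ?thesis
    using zden_znum_nz[OF assms(1)] zden_znum_nz[OF assms(2)] by simp
qed

lemma eig_at_partial_fraction:
  assumes "q \<noteq> 0" "y \<noteq> 0" "c \<noteq> y"
  shows "eig_at q (Some (e, c)) y = q powi sg e + (q powi - sg e - q powi sg e) * (y / (y - c))"
  using assms
  by (cases e) (simp_all add: eig_at_Plus eig_at_Minus divide_simps power2_eq_square power_int_minus,
      simp_all add: algebra_simps)

text \<open>The residue at \<open>1 / c\<close> of a product of two factors with distinct poles is the residue of one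
  factor times the value of the other one.\<close>

lemma eig_ser_product:
  assumes "q \<noteq> 0" "c \<noteq> 0" "d \<noteq> 0" "c \<noteq> d"
  shows "eig_ser q e (Some (e1, c)) * eig_ser q e (Some (e2, d)) =
      fps_const (q powi sg e1 * q powi sg e2)
    + fps_const ((q powi - sg e1 - q powi sg e1) * eig_at q (Some (e2, d)) c) * geo e c
    + fps_const ((q powi - sg e2 - q powi sg e2) * eig_at q (Some (e1, c)) d) * geo e d"
proof -
  define A1 A2 B1 B2 where A: "A1 = q powi sg e1" "A2 = q powi sg e2"
    "B1 = q powi - sg e1 - q powi sg e1" "B2 = q powi - sg e2 - q powi sg e2"
  define x y where xy: "x = c / (c - d)" "y = d / (d - c)"
  have "eig_ser q e (Some (e1, c)) * eig_ser q e (Some (e2, d)) =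
    fps_const (A1 * A2) + fps_const (A1 * B2) * geo e d + fps_const (A2 * B1) * geo e c
     + fps_const (B1 * B2) * (geo e c * geo e d)"
    unfolding eig_ser_Some unfolding A(3,4)[symmetric] unfolding A(1,2)[symmetric]
    by (simp add: algebra_simps fps_const_mult[symmetric] del: fps_const_mult)
  also have "\<dots> = fps_const (A1 * A2) + fps_const (B1 * (A2 + B2 * (c / (c - d)))) * geo e c
      + fps_const (B2 * (A1 + B1 * (d / (d - c)))) * geo e d"
    unfolding geo_mult[OF assms(2-4)] xy[symmetric]
    by (simp add: algebra_simps fps_const_mult[symmetric] fps_const_add[symmetric] del: fps_const_mult fps_const_add)
  finally show ?thesis
    using assms by (simp add: eig_at_partial_fraction A)
qed

text \<open>The coefficient of \<open>z\<^sup>m\<close>; for the sign minus, \<open>F\<close> is a series in \<open>1 / z\<close>.\<close>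

definition zcoeff :: "sign \<Rightarrow> complex fps \<Rightarrow> int \<Rightarrow> complex" where
  "zcoeff e F m = (if 0 \<le> sg e * m then fps_nth F (nat (sg e * m)) else 0)"

lemma zcoeff_const_mult [simp]: "zcoeff e (fps_const k * F) m = k * zcoeff e F m"
  and zcoeff_add [simp]: "zcoeff e (F + G) m = zcoeff e F m + zcoeff e G m"
  by (auto simp: zcoeff_def)

lemma zcoeff_1: "zcoeff e (fps_const k) m = (if m = 0 then k else 0)"
  by (cases e) (auto simp: zcoeff_def)

lemma zcoeff_1_diff: "zcoeff Plus (fps_const k) m - zcoeff Minus (fps_const k) m = 0"
  by (simp add: zcoeff_1)

text \<open>The expansions of \<open>1 / (1 - c z)\<close> at zero and at infinity differ by the
  delta series \<open>\<delta>(c z)\<close>: the first supplies the exponents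
  \<open>m \<ge> 0\<close>, the negative of the second those with \<open>m < 0\<close>.\<close>

lemma zcoeff_geo_diff:
  assumes "c \<noteq> 0"
  shows "zcoeff Plus (geo Plus c) m - zcoeff Minus (geo Minus c) m = c powi m"
  using assms by (auto simp: zcoeff_def geo_def power_int_def power_inverse[symmetric] divide_simps)

lemma eig_ser_1_diff:
  assumes "c \<noteq> 0"
  shows "zcoeff Plus (eig_ser q Plus (Some (e, c))) m - zcoeff Minus (eig_ser q Minus (Some (e, c))) m
       = (q powi - sg e - q powi sg e) * c powi m"
proof -
  have "zcoeff Plus (eig_ser q Plus (Some (e, c))) m - zcoeff Minus (eig_ser q Minus (Some (e, c))) m
       = (zcoeff Plus (fps_const (q powi sg e)) m - zcoeff Minus (fps_const (q powi sg e)) m)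
       + (q powi - sg e - q powi sg e) * (zcoeff Plus (geo Plus c) m - zcoeff Minus (geo Minus c) m)"
    unfolding eig_ser_Some zcoeff_add zcoeff_const_mult by (simp only: algebra_simps)
  then show ?thesis
    unfolding zcoeff_1_diff zcoeff_geo_diff[OF assms] by simp
qed

text \<open>Constants cancel and each \<open>geo\<close> turns into a delta series, so the two
  residues remain. The poles must be distinct: a double pole would contribute a derivative of a
  delta series.\<close>

lemma eig_ser_product_diff:
  assumes "q \<noteq> 0" "c \<noteq> 0" "d \<noteq> 0" "c \<noteq> d"
  shows "zcoeff Plus (eig_ser q Plus (Some (e1, c)) * eig_ser q Plus (Some (e2, d))) m
       - zcoeff Minus (eig_ser q Minus (Some (e1, c)) * eig_ser q Minus (Some (e2, d))) m
    = (q powi - sg e1 - q powi sg e1) * eig_at q (Some (e2, d)) c * c powi m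
    + (q powi - sg e2 - q powi sg e2) * eig_at q (Some (e1, c)) d * d powi m"
proof -
  have "zcoeff Plus (eig_ser q Plus (Some (e1, c)) * eig_ser q Plus (Some (e2, d))) m
       - zcoeff Minus (eig_ser q Minus (Some (e1, c)) * eig_ser q Minus (Some (e2, d))) m
    = (zcoeff Plus (fps_const (q powi sg e1 * q powi sg e2)) m - zcoeff Minus (fps_const (q powi sg e1 * q powi sg e2)) m)
    + ((q powi - sg e1 - q powi sg e1) * eig_at q (Some (e2, d)) c) * (zcoeff Plus (geo Plus c) m - zcoeff Minus (geo Minus c) m)
    + ((q powi - sg e2 - q powi sg e2) * eig_at q (Some (e1, c)) d) * (zcoeff Plus (geo Plus d) m - zcoeff Minus (geo Minus d) m)"
    unfolding eig_ser_product[OF assms] zcoeff_add zcoeff_const_mult by (simp only: algebra_simps)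
  then show ?thesis
    unfolding zcoeff_1_diff zcoeff_geo_diff[OF assms(2)] zcoeff_geo_diff[OF assms(3)] by simp
qed

text \<open>The hypothesis is the homogenised form of \<open>F (1 - k c z) = G (k - c z)\<close>.
  For the sign minus it carries an extra factor \<open>1 / z\<close>, so the coefficient of
  \<open>z^m\<close> is found at index \<open>1 - m\<close> of the series, and the boundary case is
  \<open>m = 1\<close> instead of \<open>m = 0\<close>.\<close>

lemma zcoeff_exch:
  assumes "F * (zden e - fps_const (k * c) * znum e) = G * (fps_const k * zden e - fps_const c * znum e)"
  shows "zcoeff e F m - k * c * zcoeff e F (m - 1) = k * zcoeff e G m - c * zcoeff e G (m - 1)"
proof (cases e)
  case Plus
  have "F - fps_const (k * c) * (fps_X * F) = F * (1 - fps_const (k * c) * fps_X)"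
    "fps_const k * G - fps_const c * (fps_X * G) = G * (fps_const k - fps_const c * fps_X)"
    by (simp_all only: right_diff_distrib mult_ac mult_1_right)
  with assms have "F - fps_const (k * c) * (fps_X * F) = fps_const k * G - fps_const c * (fps_X * G)"
    by (simp only: Plus zden_def znum_def sign.case mult_1_right)
  from arg_cong[OF this, of "\<lambda>f. fps_nth f n" for n]
  have *: "F $ n - k * c * (if n = 0 then 0 else F $ (n - 1)) = k * G $ n - c * (if n = 0 then 0 else G $ (n - 1))" for n
    by (simp only: fps_sub_nth fps_mult_left_const_nth fps_X_mult_nth)
  consider "m < 0" | "m = 0" | "m > 0" by linarith
  then show ?thesis
  proof cases
    case 3
    then have "nat m - 1 = nat (m - 1)" by simp
    with 3 *[of "nat m"] show ?thesis by (simp add: Plus zcoeff_def)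
  qed (use *[of 0] in \<open>simp_all add: Plus zcoeff_def\<close>)
next
  case Minus
  have "fps_X * F - fps_const (k * c) * F = F * (fps_X - fps_const (k * c))"
    "fps_const k * (fps_X * G) - fps_const c * G = G * (fps_const k * fps_X - fps_const c)"
    by (simp_all only: right_diff_distrib mult_ac mult_1_right)
  with assms have "fps_X * F - fps_const (k * c) * F = fps_const k * (fps_X * G) - fps_const c * G"
    by (simp only: Minus zden_def znum_def sign.case mult_1_right)
  from arg_cong[OF this, of "\<lambda>f. fps_nth f n" for n]
  have *: "(if n = 0 then 0 else F $ (n - 1)) - k * c * F $ n = k * (if n = 0 then 0 else G $ (n - 1)) - c * G $ n" for n
    by (simp only: fps_sub_nth fps_mult_left_const_nth fps_X_mult_nth)
  consider "m > 1" | "m = 1" | "m < 1" by linarith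
  then show ?thesis
  proof cases
    case 3
    then have "nat (1 - m) - 1 = nat (- m)" by simp
    with 3 *[of "nat (1 - m)"] show ?thesis by (simp add: Minus zcoeff_def)
  qed (use *[of 0] in \<open>simp_all add: Minus zcoeff_def\<close>)
qed

text \<open>Here \<open>b / a\<close> plays the role of \<open>z\<close>. The eigenvalues before and
  after an \<open>i\<close>-move have the same denominator \<open>a - C * b\<close>, and their
  numerators are \<open>R\<close> times the two factors of the exchange relation.\<close>

lemma exch_ser_same_aux:
  fixes f f' a b C R S :: "'a :: idom"
  assumes "R * S = 1" "f' * (a - C * b) = S * a - R * C * b" "f * (a - C * b) = R * a - S * C * b"
    and nz: "a - C * b \<noteq> 0"
  shows "f' * (a - S * S * C * b) = f * (S * S * a - C * b)"
proof -
  have 1: "S * a - R * C * b = R * (S * S * a - C * b)"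
    and 2: "R * a - S * C * b = R * (a - S * S * C * b)"
    using assms(1) by (simp_all add: right_diff_distrib mult.assoc[symmetric])
  have "(a - C * b) * (f' * (a - S * S * C * b)) = (f' * (a - C * b)) * (a - S * S * C * b)"
    by (simp only: mult_ac)
  also have "\<dots> = (f * (a - C * b)) * (S * S * a - C * b)"
    unfolding assms(2,3) 1 2 by (simp only: mult_ac)
  also have "\<dots> = (a - C * b) * (f * (S * S * a - C * b))"
    by (simp only: mult_ac)
  finally show ?thesis using mult_left_cancel[OF nz] by blast
qed

lemma exch_ser_destroyed_aux:
  fixes f a b C R S :: "'a :: idom"
  assumes RS: "R * S = 1" and f: "f * (a - S * C * b) = S * a - C * b"
  shows "a - R * C * b = f * (R * a - C * b)"
proof -
  have "R * a - C * b = R * (a - S * C * b)" "a - R * C * b = R * (S * a - C * b)"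
    using RS by (simp_all add: right_diff_distrib mult.assoc[symmetric])
  then show ?thesis using f by (metis mult.left_commute)
qed

context thin
begin

text \<open>The analogue of \<open>exch\<close> for whole series, as needed for all coefficients of
  \<open>\<phi>\<^sub>j\<close>. Nothing is evaluated at a point, so regularity plays no part;
  denominators are only multiplied out or cancelled as nonzero series.\<close>

lemma exch_ser:
  fixes i j :: int
  assumes F: "F \<in> I" and i: "st i F = Some (e, c)"
  defines "k \<equiv> q powi (sg e * cartan i j)"
  shows "eig_ser q e' (st j (nx i F)) * (zden e' - fps_const (k * c) * znum e') =
         eig_ser q e' (st j F) * (fps_const k * zden e' - fps_const c * znum e')"
proof -
  have c: "c \<noteq> 0" using st_nz[OF F i] .
  define R S where "R = q powi - sg e" and "S = q powi sg e"
  have RS: "R * S = 1" and c': "R * c \<noteq> 0" "S * c \<noteq> 0"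
    using q_nz c by (cases e; simp add: R_def S_def power_int_minus)+
  have RS': "fps_const R * fps_const S = 1" using RS by simp
  consider (same) "j = i" | (near) "\<bar>i - j\<bar> = 1" | (far) "2 \<le> \<bar>i - j\<bar>"
    by linarith
  then show ?thesis
  proof cases
    case same
    have k: "k = S * S"
      using q_nz by (cases e) (simp_all add: S_def k_def same cartan_def power_int_def power2_eq_square)
    have "eig_ser q e' (st j (nx i F)) * (zden e' - fps_const (S * S * c) * znum e') =
         eig_ser q e' (st j F) * (fps_const (S * S) * zden e' - fps_const c * znum e')"
      unfolding fps_const_mult[symmetric]
    proof (rule exch_ser_same_aux[OF RS'])
      show "eig_ser q e' (st j (nx i F)) * (zden e' - fps_const c * znum e') =
         fps_const S * zden e' - fps_const R * fps_const c * znum e'"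
        using eig_ser_mult[OF c, of q e' "neg e"] st_nx[OF F i]
        unfolding same R_def S_def fps_const_mult sg_neg minus_minus by simp
      show "eig_ser q e' (st j F) * (zden e' - fps_const c * znum e') =
         fps_const R * zden e' - fps_const S * fps_const c * znum e'"
        using eig_ser_mult[OF c, of q e' e] i
        unfolding same R_def S_def fps_const_mult by simp
    qed (rule zden_znum_nz[OF c])
    then show ?thesis unfolding k .
  next
    case near
    then have k: "k = R" by (auto simp: k_def R_def cartan_def)
    show ?thesis
      using F i near
    proof (cases rule: near_cases)
      case created
      then have *: "st j (nx i F) = Some (e, R * c)" by (simp add: R_def mult.commute)
      have "q powi sg e * (R * c) = c" using RS by (simp add: S_def mult.commute mult.assoc[symmetric])
      with eig_ser_mult[OF c'(1), of q e' e] show ?thesis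
        unfolding * k created(1) R_def[symmetric] by simp
    next
      case destroyed
      then have *: "st j F = Some (neg e, S * c)" by (simp add: S_def mult.commute)
      have "eig_ser q e' (st j F) * (zden e' - fps_const S * fps_const c * znum e') =
         fps_const S * zden e' - fps_const c * znum e'"
      proof -
        have "R * (S * c) = c" using RS by (simp add: mult.assoc[symmetric])
        with eig_ser_mult[OF c'(2), of q e' "neg e"] show ?thesis
          unfolding * fps_const_mult sg_neg minus_minus R_def[symmetric] S_def[symmetric] by simp
      qed
      from exch_ser_destroyed_aux[OF RS' this] show ?thesis
        unfolding k destroyed(2) by simp
    qed
  next
    case far
    then show ?thesis using st_far[OF F _ far] i by (auto simp: k_def cartan_def)
  qed
qed

text \<open>The extra series \<open>H\<close> is the eigenvalue of the other tensor factor, which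
  the move leaves unchanged.\<close>

lemma exch_zcoeff:
  fixes i j :: int
  assumes F: "F \<in> I" and i: "st i F = Some (e, c)"
  defines "k \<equiv> q powi (sg e * cartan j i)"
  shows "zcoeff e' (eig_ser q e' (st j (nx i F)) * H) m - k * c * zcoeff e' (eig_ser q e' (st j (nx i F)) * H) (m - 1) =
         k * zcoeff e' (eig_ser q e' (st j F) * H) m - c * zcoeff e' (eig_ser q e' (st j F) * H) (m - 1)"
proof (rule zcoeff_exch)
  have "cartan j i = cartan i j" by (auto simp: cartan_def)
  then have k: "k = q powi (sg e * cartan i j)" by (simp add: k_def)
  show "eig_ser q e' (st j (nx i F)) * H * (zden e' - fps_const (k * c) * znum e') =
    eig_ser q e' (st j F) * H * (fps_const k * zden e' - fps_const c * znum e')"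
    unfolding k mult.assoc[of _ H] mult.commute[of H] 
    unfolding mult.assoc[symmetric] exch_ser[OF F i, of e' j] ..
qed

end

section \<open>Relations between the raising or lowering operators\<close>

text \<open>One sign \<open>e\<close> of the coproduct: \<open>x\<^sub>i(z)\<close> acts on \<open>F \<otimes> G\<close> as \<open>A i\<close>, which moves \<open>F\<close>, plus
  \<open>B i\<close>, which moves \<open>G\<close> with the weight \<open>\<phi>\<^sub>i\<close> of \<open>F\<close>. For the sign minus, the second tensor
  factor plays the role of \<open>F\<close>.\<close>

locale half_coproduct = F: thin q I st nx + G: thin q J st' nx' + vector_space scale
  for q :: complex
    and I :: "'i set" and st :: "int \<Rightarrow> 'i \<Rightarrow> state" and nx
    and J :: "'j set" and st' :: "int \<Rightarrow> 'j \<Rightarrow> state" and nx'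
    and scale :: "complex \<Rightarrow> 'u::ab_group_add \<Rightarrow> 'u" (infixr "\<odot>" 75) +
  fixes e :: sign and u :: "'i \<Rightarrow> 'j \<Rightarrow> 'u" and A B :: "int \<Rightarrow> int \<Rightarrow> 'u \<Rightarrow> 'u"
  assumes apart: "F \<in> I \<Longrightarrow> G \<in> J \<Longrightarrow> st i F = Some (e1, c) \<Longrightarrow> st' i G = Some (e2, d) \<Longrightarrow> c \<noteq> d"
    and lin_A: "module_hom scale scale (A i r)"
    and lin_B: "module_hom scale scale (B i r)"
    and A_u: "F \<in> I \<Longrightarrow> G \<in> J \<Longrightarrow> A i r (u F G) =
               (case st i F of None \<Rightarrow> 0
                | Some (e', c) \<Rightarrow> if e' = e then c powi r \<odot> u (nx i F) G else 0)"
    and B_u: "F \<in> I \<Longrightarrow> G \<in> J \<Longrightarrow> B i r (u F G) =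
               (case st' i G of None \<Rightarrow> 0
                | Some (e', d) \<Rightarrow> if e' = e then (eig_at q (st i F) d * d powi r) \<odot> u F (nx' i G) else 0)"
    and span_u: "span {u F G | F G. F \<in> I \<and> G \<in> J} = UNIV"
begin

abbreviation "endo \<equiv> module_hom scale scale"

lemma ext_u:
  assumes "endo L" "endo L'" "\<And>F G. F \<in> I \<Longrightarrow> G \<in> J \<Longrightarrow> L (u F G) = L' (u F G)"
  shows "L v = L' v"
proof -
  interpret module_pair scale scale ..
  show ?thesis
    by (rule module_hom_eq_on_span[where B = "{u F G | F G. F \<in> I \<and> G \<in> J}"])
      (use assms span_u in auto)
qed

lemma endo_A: "endo f \<Longrightarrow> endo (\<lambda>v. A i r (f v))"
  and endo_B: "endo f \<Longrightarrow> endo (\<lambda>v. B i r (f v))"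
  using module_hom_compose[OF _ lin_A] module_hom_compose[OF _ lin_B] by (auto simp: o_def)

lemma endo_intros:
  "endo f \<Longrightarrow> endo g \<Longrightarrow> endo (\<lambda>v. f v + g v)"
  "endo f \<Longrightarrow> endo g \<Longrightarrow> endo (\<lambda>v. f v - g v)"
  "endo f \<Longrightarrow> endo (\<lambda>v. k \<odot> f v)"
  "endo (\<lambda>v. 0)" "endo (\<lambda>v. v)"
proof -
  interpret module_pair scale scale ..
  show "endo f \<Longrightarrow> endo g \<Longrightarrow> endo (\<lambda>v. f v + g v)"
    "endo f \<Longrightarrow> endo g \<Longrightarrow> endo (\<lambda>v. f v - g v)"
    "endo f \<Longrightarrow> endo (\<lambda>v. k \<odot> f v)"
    "endo (\<lambda>v. 0)"
    by (simp_all add: module_hom_add module_hom_sub module_hom_scale module_hom_zero)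
  show "endo (\<lambda>v. v)" by (simp add: module_hom_iff module_axioms)
qed

lemmas endos = endo_A endo_B endo_intros

lemmas A_simps [simp] = module_hom.zero[OF lin_A] module_hom.add[OF lin_A] module_hom.diff[OF lin_A] module_hom.scale[OF lin_A]
lemmas B_simps [simp] = module_hom.zero[OF lin_B] module_hom.add[OF lin_B] module_hom.diff[OF lin_B] module_hom.scale[OF lin_B]

lemma A_on: "F \<in> I \<Longrightarrow> G \<in> J \<Longrightarrow> st i F = Some (e, c) \<Longrightarrow> A i r (u F G) = c powi r \<odot> u (nx i F) G"
  and A_off: "F \<in> I \<Longrightarrow> G \<in> J \<Longrightarrow> (\<And>c. st i F \<noteq> Some (e, c)) \<Longrightarrow> A i r (u F G) = 0"
  and B_on: "F \<in> I \<Longrightarrow> G \<in> J \<Longrightarrow> st' i G = Some (e, d) \<Longrightarrow>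
               B i r (u F G) = (eig_at q (st i F) d * d powi r) \<odot> u F (nx' i G)"
  and B_off: "F \<in> I \<Longrightarrow> G \<in> J \<Longrightarrow> (\<And>d. st' i G \<noteq> Some (e, d)) \<Longrightarrow> B i r (u F G) = 0"
  by (auto simp: A_u B_u split: option.split)

lemma closed_F: "F \<in> I \<Longrightarrow> st i F = Some p \<Longrightarrow> nx i F \<in> I"
  and closed_G: "G \<in> J \<Longrightarrow> st' i G = Some p \<Longrightarrow> nx' i G \<in> J"
  using F.closed G.closed by auto

lemma apart_FG: "F \<in> I \<Longrightarrow> G \<in> J \<Longrightarrow> st' i G = Some (e2, d) \<Longrightarrow> regular_at (st i F) d"
  by (auto simp: regular_at_def dest: apart)

text \<open>The two moves act on different factors and interact only because \<open>A i\<close>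
  changes the weight of \<open>B j\<close>. That change is \<open>exch\<close> at
  \<open>y = d\<close>, which is regular both before and after the move of \<open>F\<close> since
  poles of the two factors never meet.\<close>

lemma AB_quad:
  fixes v
  defines "k i j \<equiv> q powi (sg e * cartan i j)"
  shows "A i r (B j (s - 1) v) - k i j \<odot> A i (r - 1) (B j s v) =
         k i j \<odot> B j (s - 1) (A i r v) - B j s (A i (r - 1) v)"
proof (rule ext_u[of _ _ v], goal_cases)
  case (3 F G)
  show ?case
  proof (cases "\<exists>c d. st i F = Some (e, c) \<and> st' j G = Some (e, d)")
    case True
    then obtain c d where c: "st i F = Some (e, c)" and d: "st' j G = Some (e, d)" by auto
    note F' = closed_F[OF 3(1) c] and G' = closed_G[OF 3(2) d]
    have nz: "c \<noteq> 0" "d \<noteq> 0" using F.st_nz[OF 3(1) c] G.st_nz[OF 3(2) d] by auto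
    note K = F.exch[OF 3(1) c apart_FG[OF 3 d] apart_FG[OF F' 3(2) d]]
    have "A i r (B j (s - 1) (u F G)) - k i j \<odot> A i (r - 1) (B j s (u F G)) =
      (c powi r * d powi s / (c * d) * ((c - k i j * d) * eig_at q (st j F) d)) \<odot> u (nx i F) (nx' j G)"
      using nz by (simp add: B_on[OF 3 d] A_on[OF 3(1) G' c] scale_left_diff_distrib[symmetric] 
          power_int_diff field_simps)
    also have "\<dots> = k i j \<odot> B j (s - 1) (A i r (u F G)) - B j s (A i (r - 1) (u F G))"
      unfolding k_def K
      using nz by (simp add: B_on[OF F' 3(2) d] A_on[OF 3 c] scale_left_diff_distrib[symmetric] 
          power_int_diff field_simps)
    finally show ?thesis .
  next
    case False
    show ?thesis
    proof (cases "\<exists>c. st i F = Some (e, c)")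
      case True
      then obtain c where c: "st i F = Some (e, c)" by auto
      note F' = closed_F[OF 3(1) c]
      show ?thesis using False c
        by (simp add: B_off[OF 3] A_on[OF 3 c] B_off[OF F' 3(2)])
    next
      case False
      show ?thesis
      proof (cases "\<exists>d. st' j G = Some (e, d)")
        case True
        then obtain d where d: "st' j G = Some (e, d)" by auto
        with False show ?thesis by (simp add: B_on[OF 3 d] A_off[OF 3(1) closed_G[OF 3(2) d]] A_off[OF 3])
      qed (use False in \<open>simp add: A_off[OF 3] B_off[OF 3]\<close>)
    qed
  qed
qed (intro endos)+

text \<open>The quadratic relation changes only by a sign under the exchange of
  \<open>(i, r)\<close> and \<open>(j, s)\<close>, as the Cartan matrix is symmetric.\<close>

lemma BA_quad:
  fixes v
  defines "k i j \<equiv> q powi (sg e * cartan i j)"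
  shows "B i r (A j (s - 1) v) - k i j \<odot> B i (r - 1) (A j s v) =
         k i j \<odot> A j (s - 1) (B i r v) - A j s (B i (r - 1) v)"
proof -
  have k: "k i j = k j i" by (auto simp: k_def cartan_def)
  show ?thesis
    using AB_quad[of j s i r v, folded k_def] unfolding k by (simp add: algebra_simps)
qed

lemma A_twice: "A i r (A i s v) = 0"
proof (rule ext_u[of _ _ v], goal_cases)
  case (3 F G)
  show ?case
  proof (cases "\<exists>c. st i F = Some (e, c)")
    case True
    then obtain c where c: "st i F = Some (e, c)" by auto
    then show ?thesis
      using A_off[OF closed_F[OF 3(1) c] 3(2)] F.st_nx[OF 3(1) c] by (simp add: A_on[OF 3 c])
  qed (simp add: A_off 3)
qed (intro endos)+

lemma B_twice: "B i r (B i s v) = 0"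
proof (rule ext_u[of _ _ v], goal_cases)
  case (3 F G)
  show ?case
  proof (cases "\<exists>c. st' i G = Some (e, c)")
    case True
    then obtain c where c: "st' i G = Some (e, c)" by auto
    then show ?thesis
      using B_off[OF 3(1) closed_G[OF 3(2) c]] G.st_nx[OF 3(2) c] by (simp add: B_on[OF 3 c])
  qed (simp add: B_off 3)
qed (intro endos)+

text \<open>If \<open>A i\<close> still acts after \<open>A j\<close>, its state was created by that
  move, at the parameter \<open>c * q powi - sg e\<close>. The two delta series are therefore tied
  together, and each side of the quadratic relation vanishes by itself.\<close>

lemma A_near:
  assumes ij: "\<bar>i - j\<bar> = 1"
  shows "A i r (A j (s - 1) v) = q powi - sg e \<odot> A i (r - 1) (A j s v)"
proof (rule ext_u[of _ _ v], goal_cases)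
  case (3 F G)
  show ?case
  proof (cases "\<exists>c. st j F = Some (e, c)")
    case True
    then obtain c where c: "st j F = Some (e, c)" by auto
    note F' = closed_F[OF 3(1) c]
    have nz: "c \<noteq> 0" "q \<noteq> 0" using F.st_nz[OF 3(1) c] F.q_nz by auto
    from ij have "\<bar>j - i\<bar> = 1" by simp
    with 3(1) c show ?thesis
    proof (cases rule: F.near_cases)
      case created
      then show ?thesis using nz
        by (simp add: A_on[OF 3 c] A_on[OF F' 3(2)] power_int_diff field_simps)
    next
      case destroyed
      then show ?thesis
        by (simp add: A_on[OF 3 c] A_off[OF F' 3(2)])
    qed
  qed (simp add: A_off 3)
qed (intro endos)+

lemma B_near:
  assumes ij: "\<bar>i - j\<bar> = 1"
  shows "B i r (B j (s - 1) v) = q powi - sg e \<odot> B i (r - 1) (B j s v)"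
proof (rule ext_u[of _ _ v], goal_cases)
  case (3 F G)
  show ?case
  proof (cases "\<exists>c. st' j G = Some (e, c)")
    case True
    then obtain c where c: "st' j G = Some (e, c)" by auto
    note G' = closed_G[OF 3(2) c]
    have nz: "c \<noteq> 0" "q \<noteq> 0" using G.st_nz[OF 3(2) c] G.q_nz by auto
    from ij have "\<bar>j - i\<bar> = 1" by simp
    with 3(2) c show ?thesis
    proof (cases rule: G.near_cases)
      case created
      then show ?thesis using nz
        by (simp add: B_on[OF 3 c] B_on[OF 3(1) G'] power_int_diff field_simps)
    next
      case destroyed
      then show ?thesis
        by (simp add: B_on[OF 3 c] B_off[OF 3(1) G'])
    qed
  qed (simp add: B_off 3)
qed (intro endos)+

lemma A_far:
  assumes ij: "2 \<le> \<bar>i - j\<bar>"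
  shows "A i r (A j s v) = A j s (A i r v)"
proof (rule ext_u[of _ _ v], goal_cases)
  case (3 F G)
  from ij have ji: "2 \<le> \<bar>j - i\<bar>" by simp
  show ?case
  proof (cases "\<exists>c. st i F = Some (e, c)")
    case True
    then obtain c where c: "st i F = Some (e, c)" by auto
    note F' = closed_F[OF 3(1) c]
    have j: "st j (nx i F) = st j F" using F.st_far[OF 3(1) _ ij] c by simp
    show ?thesis
    proof (cases "\<exists>d. st j F = Some (e, d)")
      case True
      then obtain d where d: "st j F = Some (e, d)" by auto
      note F'' = closed_F[OF 3(1) d]
      have i: "st i (nx j F) = st i F" using F.st_far[OF 3(1) _ ji] d by simp
      have "nx i (nx j F) = nx j (nx i F)" using F.nx_far[OF 3(1) _ _ ij] c d by simp
      with i j c d show ?thesis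
        by (simp add: A_on[OF 3 c] A_on[OF 3 d] A_on[OF F' 3(2)] A_on[OF F'' 3(2)] mult.commute)
    next
      case False
      with j c show ?thesis by (simp add: A_on[OF 3 c] A_off[OF F' 3(2)] A_off[OF 3])
    qed
  next
    case False
    then have i: "\<And>c. st j F \<noteq> None \<Longrightarrow> st i (nx j F) \<noteq> Some (e, c)" using F.st_far[OF 3(1) _ ji] by simp
    show ?thesis
    proof (cases "\<exists>d. st j F = Some (e, d)")
      case True
      then obtain d where d: "st j F = Some (e, d)" by auto
      with i False show ?thesis by (simp add: A_on[OF 3 d] A_off[OF closed_F[OF 3(1) d] 3(2)] A_off[OF 3])
    qed (use False in \<open>simp add: A_off[OF 3]\<close>)
  qed
qed (intro endos)+

lemma B_far:
  assumes ij: "2 \<le> \<bar>i - j\<bar>"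
  shows "B i r (B j s v) = B j s (B i r v)"
proof (rule ext_u[of _ _ v], goal_cases)
  case (3 F G)
  from ij have ji: "2 \<le> \<bar>j - i\<bar>" by simp
  show ?case
  proof (cases "\<exists>c. st' i G = Some (e, c)")
    case True
    then obtain c where c: "st' i G = Some (e, c)" by auto
    note G' = closed_G[OF 3(2) c]
    have j: "st' j (nx' i G) = st' j G" using G.st_far[OF 3(2) _ ij] c by simp
    show ?thesis
    proof (cases "\<exists>d. st' j G = Some (e, d)")
      case True
      then obtain d where d: "st' j G = Some (e, d)" by auto
      note G'' = closed_G[OF 3(2) d]
      have i: "st' i (nx' j G) = st' i G" using G.st_far[OF 3(2) _ ji] d by simp
      have "nx' i (nx' j G) = nx' j (nx' i G)" using G.nx_far[OF 3(2) _ _ ij] c d by simp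
      with i j c d show ?thesis
        by (simp add: B_on[OF 3 c] B_on[OF 3 d] B_on[OF 3(1) G'] B_on[OF 3(1) G''] mult_ac)
    next
      case False
      with j c show ?thesis by (simp add: B_on[OF 3 c] B_off[OF 3(1) G'] B_off[OF 3])
    qed
  next
    case False
    then have i: "\<And>c. st' j G \<noteq> None \<Longrightarrow> st' i (nx' j G) \<noteq> Some (e, c)" using G.st_far[OF 3(2) _ ji] by simp
    show ?thesis
    proof (cases "\<exists>d. st' j G = Some (e, d)")
      case True
      then obtain d where d: "st' j G = Some (e, d)" by auto
      with i False show ?thesis by (simp add: B_on[OF 3 d] B_off[OF 3(1) closed_G[OF 3(2) d]] B_off[OF 3])
    qed (use False in \<open>simp add: B_off[OF 3]\<close>)
  qed
qed (intro endos)+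

lemma AB_far:
  assumes ij: "2 \<le> \<bar>i - j\<bar>"
  shows "A i r (B j s v) = B j s (A i r v)"
proof (rule ext_u[of _ _ v], goal_cases)
  case (3 F G)
  show ?case
  proof (cases "\<exists>c. st i F = Some (e, c)")
    case True
    then obtain c where c: "st i F = Some (e, c)" by auto
    note F' = closed_F[OF 3(1) c]
    have j: "st j (nx i F) = st j F" using F.st_far[OF 3(1) _ ij] c by simp
    show ?thesis
    proof (cases "\<exists>d. st' j G = Some (e, d)")
      case True
      then obtain d where d: "st' j G = Some (e, d)" by auto
      note G' = closed_G[OF 3(2) d]
      show ?thesis
        by (simp add: A_on[OF 3 c] B_on[OF 3 d] A_on[OF 3(1) G' c] B_on[OF F' 3(2) d] j mult_ac)
    next
      case False
      then show ?thesis by (simp add: A_on[OF 3 c] B_off[OF F' 3(2)] B_off[OF 3])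
    qed
  next
    case False
    show ?thesis
    proof (cases "\<exists>d. st' j G = Some (e, d)")
      case True
      then obtain d where d: "st' j G = Some (e, d)" by auto
      with False show ?thesis by (simp add: B_on[OF 3 d] A_off[OF 3(1) closed_G[OF 3(2) d]] A_off[OF 3])
    qed (use False in \<open>simp add: A_off[OF 3] B_off[OF 3]\<close>)
  qed
qed (intro endos)+

lemma cartan_cases:
  obtains (same) "i = j" | (near) "\<bar>i - j\<bar> = 1" "\<bar>j - i\<bar> = 1" "cartan i j = - 1"
  | (far) "2 \<le> \<bar>i - j\<bar>" "2 \<le> \<bar>j - i\<bar>" "cartan i j = 0"
proof -
  consider "i = j" | "\<bar>i - j\<bar> = 1" | "2 \<le> \<bar>i - j\<bar>" by linarith
  then show thesis by cases (use that in \<open>auto simp: cartan_def\<close>)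
qed

lemma AA_quad:
  "A i r (A j (s - 1) v) - q powi (sg e * cartan i j) \<odot> A i (r - 1) (A j s v) =
   q powi (sg e * cartan i j) \<odot> A j (s - 1) (A i r v) - A j s (A i (r - 1) v)"
proof (cases rule: cartan_cases[of i j])
  case same
  then show ?thesis by (simp add: A_twice)
next
  case near
  then show ?thesis using A_near[of i j r s v] A_near[of j i s r v] by simp
next
  case far
  then show ?thesis by (simp add: A_far)
qed

lemma BB_quad:
  "B i r (B j (s - 1) v) - q powi (sg e * cartan i j) \<odot> B i (r - 1) (B j s v) =
   q powi (sg e * cartan i j) \<odot> B j (s - 1) (B i r v) - B j s (B i (r - 1) v)"
proof (cases rule: cartan_cases[of i j])
  case same
  then show ?thesis by (simp add: B_twice)
next
  case near
  then show ?thesis using B_near[of i j r s v] B_near[of j i s r v] by simp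
next
  case far
  then show ?thesis by (simp add: B_far)
qed

definition X :: "int \<Rightarrow> int \<Rightarrow> 'u \<Rightarrow> 'u" where "X i r v = A i r v + B i r v"

lemma X_quad:
  "X i r (X j (s - 1) v) - q powi (sg e * cartan i j) \<odot> X i (r - 1) (X j s v) =
   q powi (sg e * cartan i j) \<odot> X j (s - 1) (X i r v) - X j s (X i (r - 1) v)"
proof -
  have expand: "X i r (X j s v) = A i r (A j s v) + A i r (B j s v) + B i r (A j s v) + B i r (B j s v)" for i j r s
    by (simp add: X_def)
  \<comment> \<open>On the right the two currents stand in the opposite order, so that the word
    \<open>A B\<close> on the left corresponds to \<open>B A\<close> on the right; hence
    \<open>c3\<close> and \<open>d3\<close> come before \<open>c2\<close> and
    \<open>d2\<close>.\<close>
  have add4: "(a1 + a2 + a3 + a4) - (b1 + b2 + b3 + b4) = (c1 + c3 + c2 + c4) - (d1 + d3 + d2 + d4)"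
    if "a1 - b1 = c1 - d1" "a2 - b2 = c2 - d2" "a3 - b3 = c3 - d3" "a4 - b4 = c4 - d4"
    for a1 a2 a3 a4 b1 b2 b3 b4 c1 c2 c3 c4 d1 d2 d3 d4 :: 'u
    using arg_cong2[OF arg_cong2[OF that(1,2), of "(+)"] arg_cong2[OF that(3,4), of "(+)"], of "(+)"]
    by (simp add: algebra_simps)
  show ?thesis
    unfolding expand scale_right_distrib
    by (rule add4 AA_quad AB_quad BA_quad BB_quad)+
qed

lemma X_far:
  assumes "2 \<le> \<bar>i - j\<bar>"
  shows "X i r (X j s v) = X j s (X i r v)"
proof -
  from assms have "2 \<le> \<bar>j - i\<bar>" by simp
  with assms show ?thesis
    by (simp add: X_def A_far B_far AB_far[of i j] AB_far[of j i])
qed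

end

section \<open>Serre relations and cubes of one half of the coproduct\<close>

context thin
begin

text \<open>The factor in \<open>exch\<close> is itself an eigenvalue of
  \<open>\<phi>\<^sub>i\<close>, taken after the move and at the parameter where a
  \<open>j\<close>-move at \<open>y\<close> in the other factor would create an
  \<open>i\<close>-move. In this form it combines with \<open>eig_at_sum\<close>.\<close>

lemma exch_created:
  assumes F: "F \<in> I" and i: "st i F = Some (e, c)" and ij: "\<bar>i - j\<bar> = 1"
    and ap: "regular_at (st j F) y" "regular_at (st j (nx i F)) y" "c \<noteq> y * q powi - sg e"
  shows "eig_at q (st j F) y = eig_at q (Some (neg e, c)) (y * q powi - sg e) * eig_at q (st j (nx i F)) y"
  using F i ij
proof (cases rule: near_cases)
  case created
  with ap q_nz show ?thesis
    by (cases e) (simp_all add: eig_at_Plus eig_at_Minus power_int_minus divide_simps power2_eq_square, simp_all add: algebra_simps)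
next
  case destroyed
  with ap q_nz show ?thesis
    by (cases e) (simp_all add: eig_at_Plus eig_at_Minus power_int_minus divide_simps power2_eq_square, simp_all add: algebra_simps)
qed

text \<open>The counterpart for the opposite order in the other factor: an \<open>i\<close>-move at
  \<open>y\<close> creates a \<open>j\<close>-move at \<open>y * q powi - sg e\<close>, and the
  exchange factor there is the eigenvalue of \<open>\<phi>\<^sub>i\<close> at \<open>y\<close>
  before the move.\<close>

lemma exch_moved:
  assumes F: "F \<in> I" and i: "st i F = Some (e, c)" and ij: "\<bar>i - j\<bar> = 1"
    and ap: "regular_at (st j F) (y * q powi - sg e)" "regular_at (st j (nx i F)) (y * q powi - sg e)" "c \<noteq> y"
  shows "eig_at q (st j (nx i F)) (y * q powi - sg e) = eig_at q (st i F) y * eig_at q (st j F) (y * q powi - sg e)"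
  using F i ij
proof (cases rule: near_cases)
  case created
  with i ap q_nz show ?thesis
    by (cases e) (simp_all add: eig_at_Plus eig_at_Minus power_int_minus divide_simps power2_eq_square, simp_all add: algebra_simps)
next
  case destroyed
  with i ap q_nz show ?thesis
    by (cases e) (simp_all add: eig_at_Plus eig_at_Minus power_int_minus divide_simps power2_eq_square, simp_all add: algebra_simps)
qed

end

context half_coproduct
begin

text \<open>The first move leaves a state of sign \<open>neg e\<close> at \<open>i\<close>, and a
  neighbouring move of sign \<open>e\<close> can only destroy it. So one factor never admits two
  \<open>i\<close>-moves of the same sign around a \<open>j\<close>-move.\<close>

lemma A_A_A: "\<bar>i - j\<bar> = 1 \<Longrightarrow> A i r (A j s (A i r' v)) = 0"
proof (rule ext_u[of _ _ v], goal_cases)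
  case (3 F G)
  show ?case
  proof (cases "\<exists>c. st i F = Some (e, c)")
    case True
    then obtain c where c: "st i F = Some (e, c)" by auto
    note F' = closed_F[OF 3(2) c] and c' = F.st_nx[OF 3(2) c]
    show ?thesis
    proof (cases "\<exists>d. st j (nx i F) = Some (e, d)")
      case True
      then obtain d where d: "st j (nx i F) = Some (e, d)" by auto
      note F'' = closed_F[OF F' d]
      from 3(1) have "\<bar>j - i\<bar> = 1" by simp
      with F' d have "st i (nx j (nx i F)) = None"
        by (cases rule: F.near_cases) (use c' in auto)
      then show ?thesis
        by (simp add: A_on[OF 3(2,3) c] A_on[OF F' 3(3) d] A_off[OF F'' 3(3)])
    qed (simp add: A_on[OF 3(2,3) c] A_off[OF F' 3(3)])
  qed (simp add: A_off 3)
qed (intro endos)+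

lemma B_B_B: "\<bar>i - j\<bar> = 1 \<Longrightarrow> B i r (B j s (B i r' v)) = 0"
proof (rule ext_u[of _ _ v], goal_cases)
  case (3 F G)
  show ?case
  proof (cases "\<exists>c. st' i G = Some (e, c)")
    case True
    then obtain c where c: "st' i G = Some (e, c)" by auto
    note G' = closed_G[OF 3(3) c] and c' = G.st_nx[OF 3(3) c]
    show ?thesis
    proof (cases "\<exists>d. st' j (nx' i G) = Some (e, d)")
      case True
      then obtain d where d: "st' j (nx' i G) = Some (e, d)" by auto
      note G'' = closed_G[OF G' d]
      from 3(1) have "\<bar>j - i\<bar> = 1" by simp
      with G' d have "st' i (nx' j (nx' i G)) = None"
        by (cases rule: G.near_cases) (use c' in auto)
      then show ?thesis
        by (simp add: B_on[OF 3(2,3) c] B_on[OF 3(2) G' d] B_off[OF 3(2) G''])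
    qed (simp add: B_on[OF 3(2,3) c] B_off[OF 3(2) G'])
  qed (simp add: B_off 3)
qed (intro endos)+

lemma A_B_A: "A i r (B j s (A i r' v)) = 0"
proof (rule ext_u[of _ _ v], goal_cases)
  case (3 F G)
  show ?case
  proof (cases "\<exists>c. st i F = Some (e, c)")
    case True
    then obtain c where c: "st i F = Some (e, c)" by auto
    note F' = closed_F[OF 3(1) c] and c' = F.st_nx[OF 3(1) c]
    show ?thesis
    proof (cases "\<exists>d. st' j G = Some (e, d)")
      case True
      then obtain d where d: "st' j G = Some (e, d)" by auto
      show ?thesis using c'
        by (simp add: A_on[OF 3 c] B_on[OF F' 3(2) d] A_off[OF F' closed_G[OF 3(2) d]])
    qed (simp add: A_on[OF 3 c] B_off[OF F' 3(2)])
  qed (simp add: A_off 3)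
qed (intro endos)+

lemma B_A_B: "B i r (A j s (B i r' v)) = 0"
proof (rule ext_u[of _ _ v], goal_cases)
  case (3 F G)
  show ?case
  proof (cases "\<exists>c. st' i G = Some (e, c)")
    case True
    then obtain c where c: "st' i G = Some (e, c)" by auto
    note G' = closed_G[OF 3(2) c] and c' = G.st_nx[OF 3(2) c]
    show ?thesis
    proof (cases "\<exists>d. st j F = Some (e, d)")
      case True
      then obtain d where d: "st j F = Some (e, d)" by auto
      show ?thesis using c'
        by (simp add: B_on[OF 3 c] A_on[OF 3(1) G' d] B_off[OF closed_F[OF 3(1) d] G'])
    qed (simp add: B_on[OF 3 c] A_off[OF 3(1) G'])
  qed (simp add: B_off 3)
qed (intro endos)+

lemma A_line: "F \<in> I \<Longrightarrow> G \<in> J \<Longrightarrow> \<exists>x F'. F' \<in> I \<and> A j s (u F G) = x \<odot> u F' G"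
  by (cases "\<exists>c. st j F = Some (e, c)") (use A_on A_off closed_F scale_zero_left in metis)+

lemma B_line: "F \<in> I \<Longrightarrow> G \<in> J \<Longrightarrow> \<exists>x G'. G' \<in> J \<and> B j s (u F G) = x \<odot> u F G'"
  by (cases "\<exists>c. st' j G = Some (e, c)") (use B_on B_off closed_G scale_zero_left in metis)+

text \<open>All moves but \<open>B i\<close> act on \<open>F\<close>, and the words differ in the
  moment at which \<open>B i\<close> reads its weight off \<open>F\<close>. Where the product is
  nonzero, \<open>F\<close> has no state at \<open>i\<close> at one end, which gives the weight
  \<open>1\<close> of the middle term. At the other two moments its state has opposite signs at one
  parameter, and \<open>eig_at_sum\<close> applies.\<close>

lemma serre_A:
  assumes ij: "\<bar>i - j\<bar> = 1"
  defines "k \<equiv> q + 1 / q"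
  shows "A i r (B i r' (A j s v)) + B i r' (A i r (A j s v))
       - k \<odot> (A i r (A j s (B i r' v)) + B i r' (A j s (A i r v)))
       + (A j s (A i r (B i r' v)) + A j s (B i r' (A i r v))) = 0"
proof (rule ext_u[of _ _ v], goal_cases)
  case (3 F G)
  from ij have ji: "\<bar>j - i\<bar> = 1" by simp
  show ?case
  proof (cases "\<exists>y. st' i G = Some (e, y)")
    case True
    then obtain y where y: "st' i G = Some (e, y)" by auto
    note G' = closed_G[OF 3(2) y]
    note B_on' = B_on[OF _ 3(2) y]
    have sum: "k = eig_at q (Some (e, c)) y + eig_at q (Some (neg e, c)) y" if "c \<noteq> y" for c
      using eig_at_sum[OF F.q_nz, of y c e] that by (simp add: k_def)
    have comb: "a1 \<odot> w + a2 \<odot> w = a3 \<odot> w" if "a1 + a2 = a3" for a1 a2 a3 w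
      using that by (simp add: scale_left_distrib[symmetric])
    show ?thesis
    proof (cases "\<exists>c. st j F = Some (e, c)")
      case True
      then obtain c where c: "st j F = Some (e, c)" by auto
      note F' = closed_F[OF 3(1) c]
      from 3(1) c ji show ?thesis
      proof (cases rule: F.near_cases)
        case created
        note d = created(2)
        note F'' = closed_F[OF F' d]
        have ne: "c * q powi - sg e \<noteq> y" using apart[OF F' 3(2) d y] .
        show ?thesis
          by (simp add: A_on[OF 3 c] A_on[OF 3(1) G' c] A_on[OF F' 3(2) d] A_on[OF F' G' d] created(1) 
              A_off[OF 3] A_off[OF 3(1) G'] B_on'[OF 3(1)] B_on'[OF F'] B_on'[OF F''])
            (rule comb, simp add: F.st_nx[OF F' d] d sum[OF ne] algebra_simps)
      next
        case destroyed
        then show ?thesis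
          by (simp add: A_on[OF 3 c] A_on[OF 3(1) G' c] A_off[OF 3] A_off[OF 3(1) G'] A_off[OF F' 3(2)]
              A_off[OF F' G'] B_on'[OF 3(1)] B_on'[OF F'])
      qed
    next
      case j: False
      show ?thesis
      proof (cases "\<exists>c. st i F = Some (e, c)")
        case True
        then obtain c where c: "st i F = Some (e, c)" by auto
        note F' = closed_F[OF 3(1) c]
        note c' = F.st_nx[OF 3(1) c]
        have j': "A j n (u F G) = 0" "A j n (u F (nx' i G)) = 0" for n
          using j A_off[OF 3] A_off[OF 3(1) G'] by auto
        from 3(1) c ij show ?thesis
        proof (cases rule: F.near_cases)
          case created
          note d = created(2)
          note F'' = closed_F[OF F' d]
          have ne: "c \<noteq> y" using apart[OF 3 c y] .
          from F' d ji have "st i (nx j (nx i F)) = None"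
            by (cases rule: F.near_cases) (use c' in auto)
          then show ?thesis
            by (simp add: A_on[OF 3 c] A_on[OF 3(1) G' c] A_on[OF F' 3(2) d] A_on[OF F' G' d] j'
              B_on'[OF 3(1)] B_on'[OF F'] B_on'[OF F''] c c')
              (rule comb, simp add: sum[OF ne] algebra_simps)
        next
          case destroyed
          then show ?thesis
            by (simp add: A_on[OF 3 c] A_on[OF 3(1) G' c] j' A_off[OF F' 3(2)]
              A_off[OF F' G'] B_on'[OF 3(1)] B_on'[OF F'])
        qed
      next
        case False
        then show ?thesis using j
          by (simp add: A_off[OF 3] A_off[OF 3(1) G'] B_on'[OF 3(1)])
      qed
    qed
  next
    case False
    \<comment> \<open>\<open>B i\<close> kills \<open>u F G\<close> for every \<open>F\<close>, so
      it suffices that the moves by \<open>A\<close> keep the second index \<open>G\<close> and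
      yield a multiple of one basis vector.\<close>
    then have off: "F \<in> I \<Longrightarrow> B i n (u F G) = 0" for F n
      using B_off[OF _ 3(2), where i = i] by blast
    obtain x1 F1 where 1: "F1 \<in> I" "A i r (u F G) = x1 \<odot> u F1 G" using A_line[OF 3] by blast
    obtain x2 F2 where 2: "F2 \<in> I" "A j s (u F G) = x2 \<odot> u F2 G" using A_line[OF 3] by blast
    obtain x3 F3 where 3: "F3 \<in> I" "A j s (u F1 G) = x3 \<odot> u F3 G" using A_line[OF 1(1) 3(2)] by blast
    obtain x4 F4 where 4: "F4 \<in> I" "A i r (u F2 G) = x4 \<odot> u F4 G" using A_line[OF 2(1) \<open>G \<in> J\<close>] by blast
    show ?thesis using 1 2 3 4 \<open>F \<in> I\<close> by (simp add: off)
  qed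
qed (intro endos)+

text \<open>Here \<open>A i\<close> changes the weights of both \<open>B i\<close> and
  \<open>B j\<close>. The exchange lemmas \<open>exch_created\<close> and \<open>exch_moved\<close>
  express the changed weight of \<open>B j\<close> through an eigenvalue of
  \<open>\<phi>\<^sub>i\<close>; a common factor splits off and \<open>eig_at_sum\<close>
  remains.\<close>

lemma serre_B:
  assumes ij: "\<bar>i - j\<bar> = 1"
  defines "k \<equiv> q + 1 / q"
  shows "A i r (B i r' (B j s v)) + B i r' (A i r (B j s v))
       - k \<odot> (A i r (B j s (B i r' v)) + B i r' (B j s (A i r v)))
       + (B j s (A i r (B i r' v)) + B j s (B i r' (A i r v))) = 0"
proof (rule ext_u[of _ _ v], goal_cases)
  case (3 F G)
  from ij have ji: "\<bar>j - i\<bar> = 1" by simp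
  show ?case
  proof (cases "\<exists>c. st i F = Some (e, c)")
    case True
    then obtain c where c: "st i F = Some (e, c)" by auto
    note F' = closed_F[OF 3(1) c]
    note A_on' = A_on[OF 3(1) _ c]
    note c' = F.st_nx[OF 3(1) c]
    have sum: "k = eig_at q (Some (e, c)) y + eig_at q (Some (neg e, c)) y" if "c \<noteq> y" for y
      using eig_at_sum[OF F.q_nz, of y c e] that by (simp add: k_def)
    have comb: "a1 \<odot> w + a2 \<odot> w = a3 \<odot> w" if "a1 + a2 = a3" for a1 a2 a3 w
      using that by (simp add: scale_left_distrib[symmetric])
    show ?thesis
    proof (cases "\<exists>y. st' j G = Some (e, y)")
      case True
      then obtain y where y: "st' j G = Some (e, y)" by auto
      note G' = closed_G[OF 3(2) y]
      from 3(2) y ji show ?thesis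
      proof (cases rule: G.near_cases)
        case created
        note d = created(2)
        note G'' = closed_G[OF G' d]
        \<comment> \<open>The parameter \<open>y * q powi - sg e\<close> is a pole of the moved
          \<open>G\<close>, to which \<open>apart\<close> applies just as well as to
          \<open>G\<close>.\<close>
        have ne: "c \<noteq> y * q powi - sg e" using apart[OF 3(1) G' c d] .
        note ex = F.exch_created[OF 3(1) c ij apart_FG[OF 3 y] apart_FG[OF F' 3(2) y] ne]
        show ?thesis
          by (simp add: B_on[OF 3 y] B_on[OF F' 3(2) y] B_on[OF 3(1) G' d] B_on[OF F' G' d] created(1) 
              B_off[OF 3] B_off[OF F' 3(2)] A_on'[OF 3(2)] A_on'[OF G'] A_on'[OF G''])
            (rule comb, simp add: c c' sum[OF ne] ex algebra_simps)
      next
        case destroyed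
        then show ?thesis
          by (simp add: B_on[OF 3 y] B_on[OF F' 3(2) y] B_off[OF 3] B_off[OF F' 3(2)] B_off[OF 3(1) G']
              B_off[OF F' G'] A_on'[OF 3(2)] A_on'[OF G'])
      qed
    next
      case j: False
      show ?thesis
      proof (cases "\<exists>y. st' i G = Some (e, y)")
        case True
        then obtain y where y: "st' i G = Some (e, y)" by auto
        note G' = closed_G[OF 3(2) y]
        have j': "B j n (u F G) = 0" "B j n (u (nx i F) G) = 0" for n
          using j B_off[OF 3] B_off[OF F' 3(2)] by auto
        from 3(2) y ij show ?thesis
        proof (cases rule: G.near_cases)
          case created
          note d = created(2)
          note G'' = closed_G[OF G' d]
          have ne: "c \<noteq> y" using apart[OF 3 c y] .
          note ex = F.exch_moved[OF 3(1) c ij apart_FG[OF 3(1) G' d] apart_FG[OF F' G' d] ne]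
          show ?thesis
            by (simp add: B_on[OF 3 y] B_on[OF F' 3(2) y] B_on[OF 3(1) G' d] B_on[OF F' G' d] j'
              A_on'[OF 3(2)] A_on'[OF G'] A_on'[OF G''])
              (rule comb, simp add: c c' sum[OF ne] ex algebra_simps)
        next
          case destroyed
          then show ?thesis
            by (simp add: B_on[OF 3 y] B_on[OF F' 3(2) y] j' B_off[OF 3(1) G']
              B_off[OF F' G'] A_on'[OF 3(2)] A_on'[OF G'])
        qed
      next
        case False
        then show ?thesis using j
          by (simp add: B_off[OF 3] B_off[OF F' 3(2)] A_on'[OF 3(2)])
      qed
    qed
  next
    case False
    then have off: "G \<in> J \<Longrightarrow> A i n (u F G) = 0" for G n
      using A_off[OF 3(1), where i = i] by blast
    obtain x1 G1 where 1: "G1 \<in> J" "B i r' (u F G) = x1 \<odot> u F G1" using B_line[OF 3] by blast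
    obtain x2 G2 where 2: "G2 \<in> J" "B j s (u F G) = x2 \<odot> u F G2" using B_line[OF 3] by blast
    obtain x3 G3 where 3: "G3 \<in> J" "B j s (u F G1) = x3 \<odot> u F G3" using B_line[OF 3(1) 1(1)] by blast
    obtain x4 G4 where 4: "G4 \<in> J" "B i r' (u F G2) = x4 \<odot> u F G4" using B_line[OF \<open>F \<in> I\<close> 2(1)] by blast
    show ?thesis using 1 2 3 4 \<open>G \<in> J\<close> by (simp add: off)
  qed
qed (intro endos)+

lemma X_simps [simp]:
  "X i r 0 = 0" "X i r (v + w) = X i r v + X i r w" "X i r (v - w) = X i r v - X i r w" "X i r (k \<odot> v) = k \<odot> X i r v"
  by (simp_all add: X_def algebra_simps)

text \<open>Of the eight words of each triple product, only those survive whose two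
  \<open>i\<close>-moves fall on different factors. \<open>SA\<close> and \<open>SB\<close> sort
  them by the factor that the \<open>j\<close>-move acts on. In \<open>SA r r'\<close> the index
  \<open>r\<close> belongs to \<open>F\<close> and \<open>r'\<close> to \<open>G\<close>, so its
  words come from both summands of the symmetrisation.\<close>

lemma X_serre:
  assumes ij: "\<bar>i - j\<bar> = 1"
  shows "(\<Sum>(r1, r2)\<leftarrow>[(r, r'), (r', r)].
            X i r1 (X i r2 (X j s v)) - (q + 1 / q) \<odot> X i r1 (X j s (X i r2 v))
            + X j s (X i r1 (X i r2 v))) = 0"
proof -
  define k where "k = q + 1 / q"
  define SA where "SA r r' = A i r (B i r' (A j s v)) + B i r' (A i r (A j s v))
       - k \<odot> (A i r (A j s (B i r' v)) + B i r' (A j s (A i r v)))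
       + (A j s (A i r (B i r' v)) + A j s (B i r' (A i r v)))" for r r'
  define SB where "SB r r' = A i r (B i r' (B j s v)) + B i r' (A i r (B j s v))
       - k \<odot> (A i r (B j s (B i r' v)) + B i r' (B j s (A i r v)))
       + (B j s (A i r (B i r' v)) + B j s (B i r' (A i r v)))" for r r'
  have zero: "SA r r' = 0" "SB r r' = 0" for r r'
    using serre_A[OF ij] serre_B[OF ij] by (simp_all add: SA_def SB_def k_def)
  have "(\<Sum>(r1, r2)\<leftarrow>[(r, r'), (r', r)].
            X i r1 (X i r2 (X j s v)) - k \<odot> X i r1 (X j s (X i r2 v))
            + X j s (X i r1 (X i r2 v))) = SA r r' + SA r' r + (SB r r' + SB r' r)"
    by (simp add: X_def SA_def SB_def scale_right_distrib A_twice B_twice A_A_A[OF ij] B_B_B[OF ij] A_B_A B_A_B)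
  then show ?thesis by (simp add: zero k_def)
qed

text \<open>A word of length three in \<open>A i\<close> and \<open>B i\<close> has a repeated
  neighbour or alternates, and vanishes either way, as each factor admits at most one
  \<open>i\<close>-move of the given sign. This bounds the nilpotency by a uniform exponent.\<close>

lemma X_cube: "X i r (X i s (X i n v)) = 0"
proof -
  have "A i r (B i s (B i n v)) = 0" "B i r (A i s (A i n v)) = 0"
    "A i r (A i s w) = 0" "B i r (B i s w) = 0" for w
    by (simp_all add: A_twice B_twice)
  then show ?thesis by (simp add: X_def A_twice B_twice A_B_A B_A_B)
qed

end

section \<open>Relations with the Cartan part\<close>

context half_coproduct
begin

text \<open>A move changes the eigenvalue series of one factor only; the series of the other is the
  \<open>H\<close> of \<open>exch_zcoeff\<close>. The weight in \<open>B\<close> belongs to the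
  unmoved \<open>F\<close> and is a common constant.\<close>

lemma X_phi:
  fixes i j :: int
  assumes endo: "\<And>m. endo (\<Phi> m)"
    and \<Phi>: "\<And>F G m. F \<in> I \<Longrightarrow> G \<in> J \<Longrightarrow>
           \<Phi> m (u F G) = zcoeff e' (eig_ser q e' (st i F) * eig_ser q e' (st' i G)) m \<odot> u F G"
  defines "k \<equiv> q powi (sg e * cartan i j)"
  shows "\<Phi> m (X j (s - 1) v) - k \<odot> \<Phi> (m - 1) (X j s v) =
         k \<odot> X j (s - 1) (\<Phi> m v) - X j s (\<Phi> (m - 1) v)"
proof -
  note [simp] = module_hom.zero[OF endo] module_hom.add[OF endo] module_hom.scale[OF endo]
  have endo_\<Phi>: "endo f \<Longrightarrow> endo (\<lambda>v. \<Phi> m (f v))" for f m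
    using module_hom_compose[OF _ endo] by (auto simp: o_def)
  have scalar: "c powi s / c * (z1 - k * c * z2) = c powi (s - 1) * z1 - k * (c powi s * z2)"
    "c powi s / c * (k * z1 - c * z2) = k * (z1 * c powi (s - 1)) - z2 * c powi s"
    if "c \<noteq> 0" for c z1 z2 :: complex and s
    using that by (simp_all add: power_int_diff right_diff_distrib)
  have A: "\<Phi> m (A j (s - 1) v) - k \<odot> \<Phi> (m - 1) (A j s v) =
         k \<odot> A j (s - 1) (\<Phi> m v) - A j s (\<Phi> (m - 1) v)"
  proof (rule ext_u[of _ _ v], goal_cases)
    case (3 F G)
    show ?case
    proof (cases "\<exists>c. st j F = Some (e, c)")
      case True
      then obtain c where c: "st j F = Some (e, c)" by auto
      have nz: "c \<noteq> 0" using F.st_nz[OF 3(1) c] .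
      note K = F.exch_zcoeff[OF 3(1) c, of e' i "eig_ser q e' (st' i G)" m, folded k_def]
      show ?thesis
        using arg_cong[OF K, of "\<lambda>x. (c powi s / c * x) \<odot> u (nx j F) G"] scalar[OF nz, where s = s]
        by (simp add: A_on[OF 3 c] \<Phi>[OF closed_F[OF 3(1) c] 3(2)] \<Phi>[OF 3] scale_left_diff_distrib[symmetric]
            del: times_divide_eq_left)
    qed (simp add: A_off 3 \<Phi>)
  qed (intro endos endo_\<Phi>)+
  have B: "\<Phi> m (B j (s - 1) v) - k \<odot> \<Phi> (m - 1) (B j s v) =
         k \<odot> B j (s - 1) (\<Phi> m v) - B j s (\<Phi> (m - 1) v)"
  proof (rule ext_u[of _ _ v], goal_cases)
    case (3 F G)
    show ?case
    proof (cases "\<exists>c. st' j G = Some (e, c)")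
      case True
      then obtain c where c: "st' j G = Some (e, c)" by auto
      have nz: "c \<noteq> 0" using G.st_nz[OF 3(2) c] .
      note K = G.exch_zcoeff[OF 3(2) c, of e' i "eig_ser q e' (st i F)" m, folded k_def,
          unfolded mult.commute[of _ "eig_ser q e' (st i F)"]]
      let ?E = "eig_at q (st j F) c"
      show ?thesis
        using arg_cong[OF K, of "\<lambda>x. (?E * (c powi s / c * x)) \<odot> u F (nx' j G)"]
        unfolding scalar[OF nz]
        by (simp add: B_on[OF 3 c] \<Phi>[OF 3(1) closed_G[OF 3(2) c]] \<Phi>[OF 3]
            scale_left_diff_distrib right_diff_distrib mult_ac)
    qed (simp add: B_off 3 \<Phi>)
  qed (intro endos endo_\<Phi>)+
  show ?thesis
    using arg_cong2[OF A B, of "(+)"] by (simp add: X_def scale_right_distrib algebra_simps)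
qed

lemma X_k:
  assumes endo: "endo K" "endo K'"
    and K: "\<And>F G. F \<in> I \<Longrightarrow> G \<in> J \<Longrightarrow> K (u F G) = (a F * b G) \<odot> u F G"
    and K': "\<And>F G. F \<in> I \<Longrightarrow> G \<in> J \<Longrightarrow> K' (u F G) = (a' F * b' G) \<odot> u F G"
    and inv: "\<And>F. F \<in> I \<Longrightarrow> a F * a' F = 1" "\<And>G. G \<in> J \<Longrightarrow> b G * b' G = 1"
    and a: "\<And>F c. F \<in> I \<Longrightarrow> st j F = Some (e, c) \<Longrightarrow> a (nx j F) = m * a F"
    and b: "\<And>G c. G \<in> J \<Longrightarrow> st' j G = Some (e, c) \<Longrightarrow> b (nx' j G) = m * b G"
  shows "K (X j r (K' v)) = m \<odot> X j r v"
proof -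
  note [simp] = module_hom.zero[OF endo(1)] module_hom.add[OF endo(1)] module_hom.scale[OF endo(1)]
    module_hom.zero[OF endo(2)] module_hom.add[OF endo(2)] module_hom.scale[OF endo(2)]
  have endo_K: "endo f \<Longrightarrow> endo (\<lambda>v. K (f v))" for f
    using module_hom_compose[OF _ endo(1)] by (auto simp: o_def)
  have inv2: "a F * b G * (a' F * b' G) = 1" if "F \<in> I" "G \<in> J" for F G
    using inv that by (metis mult.left_commute mult.assoc mult_1_right)
  have A: "K (A j r (K' v)) = m \<odot> A j r v"
  proof (rule ext_u[of _ _ v], goal_cases)
    case (3 F G)
    show ?case
    proof (cases "\<exists>c. st j F = Some (e, c)")
      case True
      then obtain c where c: "st j F = Some (e, c)" by auto
      show ?thesis
        using arg_cong[OF inv2[OF 3], of "\<lambda>x. (m * c powi r * x) \<odot> u (nx j F) G"]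
        by (simp add: A_on[OF 3 c] K'[OF 3] K[OF closed_F[OF 3(1) c] 3(2)] a[OF 3(1) c] mult_ac)
    qed (simp add: A_off 3 K')
  qed (intro endos endo endo_K)+
  have B: "K (B j r (K' v)) = m \<odot> B j r v"
  proof (rule ext_u[of _ _ v], goal_cases)
    case (3 F G)
    show ?case
    proof (cases "\<exists>c. st' j G = Some (e, c)")
      case True
      then obtain c where c: "st' j G = Some (e, c)" by auto
      show ?thesis
        using arg_cong[OF inv2[OF 3], of "\<lambda>x. (m * eig_at q (st j F) c * c powi r * x) \<odot> u F (nx' j G)"]
        by (simp add: B_on[OF 3 c] K'[OF 3] K[OF 3(1) closed_G[OF 3(2) c]] b[OF 3(2) c] mult_ac)
    qed (simp add: B_off 3 K')
  qed (intro endos endo endo_K)+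
  show ?thesis using A B by (simp add: X_def scale_right_distrib)
qed

end

text \<open>\<open>A\<close>, \<open>B\<close>, \<open>A'\<close>, \<open>B'\<close> stand for
  \<open>x^+ \<otimes> 1\<close>, \<open>\<phi>^- \<otimes> x^+\<close>,
  \<open>1 \<otimes> x^-\<close>, \<open>x^- \<otimes> \<phi>^+\<close>. Thus \<open>A\<close> and
  \<open>B'\<close> move \<open>F\<close>, while \<open>B\<close> and \<open>A'\<close> move
  \<open>G\<close>. The condition on \<open>q\<close> makes \<open>q - 1 / q\<close>
  invertible.\<close>

locale drinfeld_coproduct =
  P: half_coproduct q I st nx J st' nx' scale Plus u A B +
  M: half_coproduct q J st' nx' I st nx scale Minus "\<lambda>G F. u F G" A' B'
  for q :: complex
    and I :: "'i set" and st :: "int \<Rightarrow> 'i \<Rightarrow> state" and nx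
    and J :: "'j set" and st' :: "int \<Rightarrow> 'j \<Rightarrow> state" and nx'
    and scale :: "complex \<Rightarrow> 'u::ab_group_add \<Rightarrow> 'u" (infixr "\<odot>" 75)
    and u A B A' B' +
  assumes q_sq: "q\<^sup>2 \<noteq> 1"
begin

section \<open>Commutators of raising and lowering operators\<close>

lemma A_A':
  "A i r (A' j s v) = A' j s (A i r v)"
proof (rule P.ext_u[of _ _ v], goal_cases)
  case (3 F G)
  show ?case
  proof (cases "\<exists>c. st i F = Some (Plus, c)")
    case True
    then obtain c where c: "st i F = Some (Plus, c)" by auto
    note F' = P.closed_F[OF 3(1) c]
    show ?thesis
    proof (cases "\<exists>d. st' j G = Some (Minus, d)")
      case True
      then obtain d where d: "st' j G = Some (Minus, d)" by auto
      show ?thesis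
        by (simp add: P.A_on[OF 3 c] P.A_on[OF 3(1) P.closed_G[OF 3(2) d] c] M.A_on[OF 3(2,1) d] M.A_on[OF 3(2) F' d] mult.commute)
    next
      case False
      then show ?thesis by (simp add: P.A_on[OF 3 c] M.A_off[OF 3(2,1)] M.A_off[OF 3(2) F'])
    qed
  next
    case False
    then have off: "G \<in> J \<Longrightarrow> A i n (u F G) = 0" for G n
      using P.A_off[OF 3(1), where i = i] by blast
    obtain x G1 where "G1 \<in> J" "A' j s (u F G) = x \<odot> u F G1" using M.A_line[OF 3(2,1)] by blast
    then show ?thesis using 3 by (simp add: off)
  qed
qed (intro P.endos M.endos)+

text \<open>Each of the two moves changes the weight of the other. By \<open>exch\<close> both
  factors of change are the same function of \<open>c\<close> and \<open>d\<close>, because the sign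
  of the move and the roles of the two parameters are reversed together. The cases are computed
  directly, since the factors in \<open>exch\<close> may vanish.\<close>

lemma eig_at_exch_opposite:
  assumes "F \<in> I" "G \<in> J" "st' i G = Some (Plus, c)" "st j F = Some (Minus, d)"
  shows "eig_at q (st' j G) d * eig_at q (st i (nx j F)) c = eig_at q (st i F) c * eig_at q (st' j (nx' i G)) d"
proof -
  note F' = P.closed_F[OF assms(1,4)] and G' = P.closed_G[OF assms(2,3)]
  note apart = P.apart_FG[OF assms(1,2,3)] P.apart_FG[OF F' assms(2,3)]
    M.apart_FG[OF assms(2,1,4)] M.apart_FG[OF G' assms(1,4)]
  have q: "q \<noteq> 0" by (rule P.F.q_nz)
  consider (same) "j = i" | (near) "\<bar>i - j\<bar> = 1" | (far) "2 \<le> \<bar>i - j\<bar>"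
    by linarith
  then show ?thesis
  proof cases
    case same
    then show ?thesis
      using apart assms P.F.st_nx[OF assms(1,4)] P.G.st_nx[OF assms(2,3)] q
      by (simp add: eig_at_Plus eig_at_Minus divide_simps power2_eq_square) (simp add: algebra_simps)
  next
    case near
    then have near': "\<bar>j - i\<bar> = 1" by simp
    show ?thesis
      using P.F.st_near[OF assms(1,4) near'] P.G.st_near[OF assms(2,3) near] apart q
      by (elim disjE conjE) (simp_all add: eig_at_Plus eig_at_Minus power_int_minus divide_simps power2_eq_square,
        simp_all add: algebra_simps)
  next
    case far
    then have "2 \<le> \<bar>j - i\<bar>" by simp
    then show ?thesis using P.F.st_far[OF assms(1), of j i] P.G.st_far[OF assms(2) _ far] assms by simp
  qed
qed

lemma B_B': "B i r (B' j s v) = B' j s (B i r v)"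
proof (rule P.ext_u[of _ _ v], goal_cases)
  case (3 F G)
  show ?case
  proof (cases "\<exists>c. st' i G = Some (Plus, c)")
    case True
    then obtain c where c: "st' i G = Some (Plus, c)" by auto
    note G' = P.closed_G[OF 3(2) c]
    show ?thesis
    proof (cases "\<exists>d. st j F = Some (Minus, d)")
      case True
      then obtain d where d: "st j F = Some (Minus, d)" by auto
      note F' = P.closed_F[OF 3(1) d]
      note K = eig_at_exch_opposite[OF 3 c d]
      show ?thesis
        using arg_cong[OF K, of "\<lambda>x. (c powi r * d powi s * x) \<odot> u (nx j F) (nx' i G)"]
        by (simp add: P.B_on[OF 3 c] P.B_on[OF F' 3(2) c] M.B_on[OF 3(2,1) d] M.B_on[OF G' 3(1) d] mult_ac)
    next
      case False
      then show ?thesis by (simp add: P.B_on[OF 3 c] M.B_off[OF 3(2,1)] M.B_off[OF G' 3(1)])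
    qed
  next
    case False
    then have off: "F \<in> I \<Longrightarrow> B i n (u F G) = 0" for F n
      using P.B_off[OF _ 3(2), where i = i] by blast
    obtain x F1 where "F1 \<in> I" "B' j s (u F G) = x \<odot> u F1 G" using M.B_line[OF 3(2,1)] by blast
    then show ?thesis using 3 by (simp add: off)
  qed
qed (intro P.endos M.endos)+

text \<open>Both operators move \<open>F\<close>, and \<open>G\<close> supplies the weight. For
  \<open>i = j\<close> the moves undo each other and the sign of the state decides which order
  survives, hence the factor \<open>- of_int (sg e)\<close>. For neighbours both orders vanish; for
  distant indices they agree.\<close>

lemma A_B':
  assumes FG: "F \<in> I" "G \<in> J"
  shows "A i r (B' j s (u F G)) - B' j s (A i r (u F G)) =
    (case st i F of None \<Rightarrow> 0
     | Some (e, c) \<Rightarrow> if i = j then (- of_int (sg e) * eig_at q (st' i G) c * c powi (r + s)) \<odot> u F G else 0)"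
proof -
  consider (same) "j = i" | (near) "\<bar>i - j\<bar> = 1" | (far) "2 \<le> \<bar>i - j\<bar>"
    by linarith
  then show ?thesis
  proof cases
    case same
    show ?thesis
    proof (cases "st i F")
      case None
      then show ?thesis using FG by (simp add: P.A_off M.B_off same)
    next
      case (Some p)
      obtain e c where p: "p = (e, c)" by fastforce
      note Some = Some[unfolded p]
      note F' = P.closed_F[OF FG(1) Some]
      note st' = P.F.st_nx[OF FG(1) Some]
      have nn: "nx i (nx i F) = F" using P.F.nx_nx[OF FG(1)] Some by simp
      have nz: "c \<noteq> 0" using P.F.st_nz[OF FG(1) Some] .
      show ?thesis
      proof (cases e)
        case Plus
        then show ?thesis using Some st' nn nz
          by (simp add: P.A_on[OF FG] M.B_off[OF FG(2,1)] M.B_on[OF FG(2) F'] same power_int_add mult_ac)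
      next
        case Minus
        then show ?thesis using Some st' nn nz
          by (simp add: P.A_off[OF FG] M.B_on[OF FG(2,1)] P.A_on[OF F' FG(2)] same power_int_add mult_ac)
      qed
    qed
  next
    case near
    then have ij: "i \<noteq> j" by auto
    have near': "\<bar>j - i\<bar> = 1" using near by simp
    have 1: "A i r (B' j s (u F G)) = 0"
    proof (cases "\<exists>d. st j F = Some (Minus, d)")
      case True
      then obtain d where d: "st j F = Some (Minus, d)" by auto
      \<comment> \<open>A move leaves at a neighbouring index either nothing or a state of its own
        sign, so lowering never opens a raising move there.\<close>
      from P.F.st_near[OF FG(1) d near'] have "\<And>c. st i (nx j F) \<noteq> Some (Plus, c)" by auto
      then show ?thesis by (simp add: M.B_on[OF FG(2,1) d] P.A_off[OF P.closed_F[OF FG(1) d] FG(2)])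
    qed (simp add: M.B_off[OF FG(2,1)])
    have 2: "B' j s (A i r (u F G)) = 0"
    proof (cases "\<exists>d. st i F = Some (Plus, d)")
      case True
      then obtain d where d: "st i F = Some (Plus, d)" by auto
      from P.F.st_near[OF FG(1) d near] have "\<And>c. st j (nx i F) \<noteq> Some (Minus, c)" by auto
      then show ?thesis by (simp add: P.A_on[OF FG d] M.B_off[OF FG(2) P.closed_F[OF FG(1) d]])
    qed (simp add: P.A_off[OF FG])
    show ?thesis using 1 2 ij by (simp split: option.split)
  next
    case far
    then have ij: "i \<noteq> j" by auto
    have far': "2 \<le> \<bar>j - i\<bar>" using far by simp
    have "A i r (B' j s (u F G)) = B' j s (A i r (u F G))"
    proof (cases "\<exists>c. st i F = Some (Plus, c)")
      case True
      then obtain c where c: "st i F = Some (Plus, c)" by auto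
      note F' = P.closed_F[OF FG(1) c]
      have j: "st j (nx i F) = st j F" using P.F.st_far[OF FG(1) _ far] c by simp
      show ?thesis
      proof (cases "\<exists>d. st j F = Some (Minus, d)")
        case True
        then obtain d where d: "st j F = Some (Minus, d)" by auto
        note F'' = P.closed_F[OF FG(1) d]
        have i: "st i (nx j F) = st i F" using P.F.st_far[OF FG(1) _ far'] d by simp
        have "nx i (nx j F) = nx j (nx i F)" using P.F.nx_far[OF FG(1) _ _ far] c d by simp
        with i j c d show ?thesis
          by (simp add: P.A_on[OF FG c] M.B_on[OF FG(2,1) d] P.A_on[OF F'' FG(2)] M.B_on[OF FG(2) F'] mult_ac)
      next
        case False
        with j show ?thesis by (simp add: P.A_on[OF FG c] M.B_off[OF FG(2,1)] M.B_off[OF FG(2) F'])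
      qed
    next
      case False
      then have i: "\<And>c. st j F \<noteq> None \<Longrightarrow> st i (nx j F) \<noteq> Some (Plus, c)" using P.F.st_far[OF FG(1) _ far'] by simp
      show ?thesis
      proof (cases "\<exists>d. st j F = Some (Minus, d)")
        case True
        then obtain d where d: "st j F = Some (Minus, d)" by auto
        with False i show ?thesis
          by (simp add: P.A_off[OF FG] M.B_on[OF FG(2,1) d] P.A_off[OF P.closed_F[OF FG(1) d] FG(2)])
      qed (use False in \<open>simp add: P.A_off[OF FG] M.B_off[OF FG(2,1)]\<close>)
    qed
    then show ?thesis using ij by (simp split: option.split)
  qed
qed

lemma A'_B:
  assumes FG: "F \<in> I" "G \<in> J"
  shows "B i r (A' j s (u F G)) - A' j s (B i r (u F G)) =
    (case st' i G of None \<Rightarrow> 0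
     | Some (e, c) \<Rightarrow> if i = j then (- of_int (sg e) * eig_at q (st i F) c * c powi (r + s)) \<odot> u F G else 0)"
proof -
  consider (same) "j = i" | (near) "\<bar>i - j\<bar> = 1" | (far) "2 \<le> \<bar>i - j\<bar>"
    by linarith
  then show ?thesis
  proof cases
    case same
    show ?thesis
    proof (cases "st' i G")
      case None
      then show ?thesis using FG by (simp add: P.B_off M.A_off same)
    next
      case (Some p)
      obtain e c where p: "p = (e, c)" by fastforce
      note Some = Some[unfolded p]
      note G' = P.closed_G[OF FG(2) Some]
      note st' = P.G.st_nx[OF FG(2) Some]
      have nn: "nx' i (nx' i G) = G" using P.G.nx_nx[OF FG(2)] Some by simp
      have nz: "c \<noteq> 0" using P.G.st_nz[OF FG(2) Some] .
      show ?thesis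
      proof (cases e)
        case Plus
        then show ?thesis using Some st' nn nz
          by (simp add: P.B_on[OF FG] M.A_off[OF FG(2,1)] M.A_on[OF G' FG(1)] same power_int_add mult_ac)
      next
        case Minus
        then show ?thesis using Some st' nn nz
          by (simp add: P.B_off[OF FG] M.A_on[OF FG(2,1)] P.B_on[OF FG(1) G'] same power_int_add mult_ac)
      qed
    qed
  next
    case near
    then have ij: "i \<noteq> j" by auto
    have near': "\<bar>j - i\<bar> = 1" using near by simp
    have 1: "B i r (A' j s (u F G)) = 0"
    proof (cases "\<exists>d. st' j G = Some (Minus, d)")
      case True
      then obtain d where d: "st' j G = Some (Minus, d)" by auto
      from P.G.st_near[OF FG(2) d near'] have "\<And>c. st' i (nx' j G) \<noteq> Some (Plus, c)" by auto
      then show ?thesis by (simp add: M.A_on[OF FG(2,1) d] P.B_off[OF FG(1) P.closed_G[OF FG(2) d]])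
    qed (simp add: M.A_off[OF FG(2,1)])
    have 2: "A' j s (B i r (u F G)) = 0"
    proof (cases "\<exists>d. st' i G = Some (Plus, d)")
      case True
      then obtain d where d: "st' i G = Some (Plus, d)" by auto
      from P.G.st_near[OF FG(2) d near] have "\<And>c. st' j (nx' i G) \<noteq> Some (Minus, c)" by auto
      then show ?thesis by (simp add: P.B_on[OF FG d] M.A_off[OF P.closed_G[OF FG(2) d] FG(1)])
    qed (simp add: P.B_off[OF FG])
    show ?thesis using 1 2 ij by (simp split: option.split)
  next
    case far
    then have ij: "i \<noteq> j" by auto
    have far': "2 \<le> \<bar>j - i\<bar>" using far by simp
    have "B i r (A' j s (u F G)) = A' j s (B i r (u F G))"
    proof (cases "\<exists>c. st' i G = Some (Plus, c)")
      case True
      then obtain c where c: "st' i G = Some (Plus, c)" by auto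
      note G' = P.closed_G[OF FG(2) c]
      have j: "st' j (nx' i G) = st' j G" using P.G.st_far[OF FG(2) _ far] c by simp
      show ?thesis
      proof (cases "\<exists>d. st' j G = Some (Minus, d)")
        case True
        then obtain d where d: "st' j G = Some (Minus, d)" by auto
        note G'' = P.closed_G[OF FG(2) d]
        have i: "st' i (nx' j G) = st' i G" using P.G.st_far[OF FG(2) _ far'] d by simp
        have "nx' i (nx' j G) = nx' j (nx' i G)" using P.G.nx_far[OF FG(2) _ _ far] c d by simp
        with i j c d show ?thesis
          by (simp add: P.B_on[OF FG c] M.A_on[OF FG(2,1) d] P.B_on[OF FG(1) G''] M.A_on[OF G' FG(1)] mult_ac)
      next
        case False
        with j show ?thesis by (simp add: P.B_on[OF FG c] M.A_off[OF FG(2,1)] M.A_off[OF G' FG(1)])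
      qed
    next
      case False
      then have i: "\<And>c. st' j G \<noteq> None \<Longrightarrow> st' i (nx' j G) \<noteq> Some (Plus, c)" using P.G.st_far[OF FG(2) _ far'] by simp
      show ?thesis
      proof (cases "\<exists>d. st' j G = Some (Minus, d)")
        case True
        then obtain d where d: "st' j G = Some (Minus, d)" by auto
        with False i show ?thesis
          by (simp add: P.B_off[OF FG] M.A_on[OF FG(2,1) d] P.B_off[OF FG(1) P.closed_G[OF FG(2) d]])
      qed (use False in \<open>simp add: P.B_off[OF FG] M.A_off[OF FG(2,1)]\<close>)
    qed
    then show ?thesis using ij by (simp split: option.split)
  qed
qed

text \<open>A residue coefficient \<open>q powi - sg e - q powi sg e\<close> is
  \<open>- sg e\<close> times \<open>q - 1 / q\<close>. After division the two residues are exactly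
  the contributions found in \<open>A_B'\<close> and \<open>A'_B\<close> for
  \<open>i = j\<close>.\<close>

lemma eig_ser_diff:
  assumes FG: "F \<in> I" "G \<in> J"
  shows "1 / (q - 1 / q) * (zcoeff Plus (eig_ser q Plus (st i F) * eig_ser q Plus (st' i G)) m
            - zcoeff Minus (eig_ser q Minus (st i F) * eig_ser q Minus (st' i G)) m) =
      (case st i F of None \<Rightarrow> 0 | Some (e, c) \<Rightarrow> - of_int (sg e) * eig_at q (st' i G) c * c powi m)
    + (case st' i G of None \<Rightarrow> 0 | Some (e, c) \<Rightarrow> - of_int (sg e) * eig_at q (st i F) c * c powi m)"
proof -
  have q: "q \<noteq> 0" by (rule P.F.q_nz)
  have "q - 1 / q \<noteq> 0" using q q_sq by (simp add: divide_simps power2_eq_square)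
  moreover have "q powi - sg e - q powi sg e = - of_int (sg e) * (q - 1 / q)" for e
    using q by (cases e) (simp_all add: power_int_minus inverse_eq_divide)
  ultimately have *: "(q powi - sg e - q powi sg e) * x / (q - 1 / q) = - (of_int (sg e) * x)" for e x
    by simp
  have one: "zcoeff Plus 1 m - zcoeff Minus 1 m = 0"
    using zcoeff_1_diff[of 1 m] by simp
  show ?thesis
  proof (cases "st i F")
    case None
    show ?thesis
    proof (cases "st' i G")
      case (Some p)
      then obtain e c where p: "st' i G = Some (e, c)" by (cases p) auto
      show ?thesis
        using eig_ser_1_diff[OF P.G.st_nz[OF FG(2) p], of q e m] 
        by (simp add: None p *)
    qed (simp add: None one)
  next
    case (Some p')
    then obtain e' c' where p': "st i F = Some (e', c')" by (cases p') auto
    note nz = P.F.st_nz[OF FG(1) p']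
    show ?thesis
    proof (cases "st' i G")
      case None
      then show ?thesis
        using eig_ser_1_diff[OF nz, of q e' m] by (simp add: p' *)
    next
      case (Some p)
      then obtain e c where p: "st' i G = Some (e, c)" by (cases p) auto
      show ?thesis
        using eig_ser_product_diff[OF q nz P.G.st_nz[OF FG(2) p] P.apart[OF FG p' p], of e' e m]
        by (simp add: p' p * add_divide_distrib mult.assoc)
    qed
  qed
qed

lemma X_X':
  assumes endo: "\<And>e. P.endo (\<Phi> e)"
    and \<Phi>: "\<And>e F G. F \<in> I \<Longrightarrow> G \<in> J \<Longrightarrow>
           \<Phi> e (u F G) = zcoeff e (eig_ser q e (st i F) * eig_ser q e (st' i G)) (r + s) \<odot> u F G"
  shows "P.X i r (M.X j s v) - M.X j s (P.X i r v) =
     (if i = j then (1 / (q - 1 / q)) \<odot> (\<Phi> Plus v - \<Phi> Minus v) else 0)"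
proof (rule P.ext_u[of _ _ v], goal_cases)
  case 1
  have "P.X i r = (\<lambda>v. A i r v + B i r v)" "M.X j s = (\<lambda>v. A' j s v + B' j s v)"
    by (auto simp: P.X_def M.X_def)
  then show ?case by (simp only:) (intro P.endos M.endos)
next
  case 2
  then show ?case by (cases "i = j") (simp_all, (intro P.endos endo)+)
next
  case (3 F G)
  have "P.X i r (M.X j s (u F G)) - M.X j s (P.X i r (u F G)) =
    (A i r (A' j s (u F G)) - A' j s (A i r (u F G))) + (B i r (B' j s (u F G)) - B' j s (B i r (u F G)))
    + ((A i r (B' j s (u F G)) - B' j s (A i r (u F G))) + (B i r (A' j s (u F G)) - A' j s (B i r (u F G))))"
    by (simp add: P.X_def M.X_def algebra_simps)
  also have "\<dots> = (A i r (B' j s (u F G)) - B' j s (A i r (u F G))) + (B i r (A' j s (u F G)) - A' j s (B i r (u F G)))"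
    by (simp add: A_A' B_B')
  also have "\<dots> = (if i = j then ((case st i F of None \<Rightarrow> 0 | Some (e, c) \<Rightarrow> - of_int (sg e) * eig_at q (st' i G) c * c powi (r + s))
    + (case st' i G of None \<Rightarrow> 0 | Some (e, c) \<Rightarrow> - of_int (sg e) * eig_at q (st i F) c * c powi (r + s))) \<odot> u F G else 0)"
    unfolding A_B'[OF 3] A'_B[OF 3] by (auto split: option.split simp: P.scale_left_distrib)
  also have "\<dots> = (if i = j then (1 / (q - 1 / q)) \<odot> (\<Phi> Plus (u F G) - \<Phi> Minus (u F G)) else 0)"
    unfolding eig_ser_diff[OF 3, symmetric] by (simp add: \<Phi>[OF 3] P.scale_left_diff_distrib[symmetric])
  finally show ?case .
qed

end

section \<open>Tableaux\<close>

text \<open>Where exactly one of \<open>i\<close>, \<open>i + 1\<close> is an entry, this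
  transposition performs both \<open>e_tilde\<close> and \<open>f_tilde\<close>. Using one
  involution for both makes a move its own inverse.\<close>

definition swap :: "int \<Rightarrow> int \<Rightarrow> int" where
  "swap i v = (if v = i then i + 1 else if v = i + 1 then i else v)"

lemma swap_swap [simp]: "swap i (swap i v) = v"
  by (simp add: swap_def)

lemma swap_eq_iff: "swap i v = w \<longleftrightarrow> v = swap i w"
  by (auto simp: swap_def)

definition tab_nx :: "int set \<Rightarrow> int \<Rightarrow> (int \<Rightarrow> int) \<Rightarrow> int \<Rightarrow> int" where
  "tab_nx J i T p = (if p \<in> J then swap i (T p) else T p)"

text \<open>\<open>A\<close> stands for \<open>a * q powi N\<close>. The parameter is always that of
  the pole. In the first case the tableau formula contains \<open>q powi (i + N + 3 - 2 * p)\<close>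
  instead, because \<open>psi\<close> is inverted there and the pole of its inverse differs from its
  own by \<open>q\<^sup>2\<close>.\<close>

definition tab_st :: "complex \<Rightarrow> complex \<Rightarrow> int set \<Rightarrow> int \<Rightarrow> (int \<Rightarrow> int) \<Rightarrow> state" where
  "tab_st A q J i T =
    (if i + 1 \<in> T ` J \<and> i \<notin> T ` J then Some (Plus, A * q powi (i + 1 - 2 * entry_pos J T (i + 1)))
     else if i \<in> T ` J \<and> i + 1 \<notin> T ` J then Some (Minus, A * q powi (i + 1 - 2 * entry_pos J T i))
     else None)"

lemma mem_tab_nx: "v \<in> tab_nx J i T ` J \<longleftrightarrow> swap i v \<in> T ` J"
proof
  assume "v \<in> tab_nx J i T ` J"
  then obtain p where "p \<in> J" "v = swap i (T p)" by (auto simp: tab_nx_def)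
  then show "swap i v \<in> T ` J" by simp
next
  assume "swap i v \<in> T ` J"
  then obtain p where "p \<in> J" "swap i v = T p" by auto
  then have "v = tab_nx J i T p" by (simp add: tab_nx_def swap_eq_iff)
  with \<open>p \<in> J\<close> show "v \<in> tab_nx J i T ` J" by blast
qed

lemma entry_pos_tab_nx: "entry_pos J (tab_nx J i T) v = entry_pos J T (swap i v)"
proof -
  have "p \<in> J \<and> tab_nx J i T p = v \<longleftrightarrow> p \<in> J \<and> T p = swap i v" for p
    by (auto simp: tab_nx_def swap_eq_iff)
  then show ?thesis by (simp add: entry_pos_def)
qed

lemma tab_nx_tab_nx: "tab_nx J i (tab_nx J i T) = T"
  by (auto simp: tab_nx_def)

lemma tab_nx_commute: "2 \<le> \<bar>i - j\<bar> \<Longrightarrow> tab_nx J i (tab_nx J j T) = tab_nx J j (tab_nx J i T)"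
  by (auto simp: tab_nx_def swap_def fun_eq_iff)

lemma entry_pos_eq: "strict_mono_on J T \<Longrightarrow> p \<in> J \<Longrightarrow> entry_pos J T (T p) = p" for p :: int
  unfolding entry_pos_def by (rule the_equality) (auto dest: strict_mono_on_eqD)

lemma strict_mono_on_tab_nx:
  assumes "strict_mono_on J T" "\<not> (i \<in> T ` J \<and> i + 1 \<in> T ` J)"
  shows "strict_mono_on J (tab_nx J i T)"
proof (rule strict_mono_onI)
  fix x y assume xy: "x \<in> J" "y \<in> J" "x < y"
  then have "T x < T y" using assms(1) by (auto dest: strict_mono_onD)
  moreover have "\<not> (T x = i \<and> T y = i + 1)" using assms(2) xy by (metis imageI)
  ultimately show "tab_nx J i T x < tab_nx J i T y" using xy by (auto simp: tab_nx_def swap_def)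
qed

definition interval :: "int set \<Rightarrow> bool" where
  "interval J \<longleftrightarrow> (\<forall>x\<in>J. \<forall>z\<in>J. {x..z} \<subseteq> J)"

lemma intervalD: "interval J \<Longrightarrow> x \<in> J \<Longrightarrow> z \<in> J \<Longrightarrow> x \<le> y \<Longrightarrow> y \<le> z \<Longrightarrow> y \<in> J"
  unfolding interval_def by (meson atLeastAtMost_iff subsetD)

lemma interval_atMost [simp]: "interval {..l}" and interval_atLeast [simp]: "interval {s..}"
  by (auto simp: interval_def)

text \<open>As \<open>J\<close> has no gaps, a position in between would hold an entry in between.
  This is what fixes the parameter shift between adjacent moves.\<close>

lemma entry_pos_succ:
  assumes J: "interval J" and T: "strict_mono_on J T" and v: "v \<in> T ` J" "w \<in> T ` J" "v < w"
    and gap: "\<And>x. v < x \<Longrightarrow> x < w \<Longrightarrow> x \<notin> T ` J"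
  shows "entry_pos J T w = entry_pos J T v + 1"
proof -
  obtain p r where p: "p \<in> J" "v = T p" and r: "r \<in> J" "w = T r" using v by auto
  have "p < r"
    using strict_mono_on_leD[OF T r(1) p(1)] p r v by linarith
  moreover have "\<not> p + 1 < r"
  proof
    assume less: "p + 1 < r"
    then have "p + 1 \<in> J" using intervalD[OF J p(1) r(1), of "p + 1"] by simp
    moreover from this have "T p < T (p + 1)" "T (p + 1) < T r"
      using strict_mono_onD[OF T] p r less by simp_all
    ultimately show False using gap[of "T (p + 1)"] p r by blast
  qed
  ultimately have "r = p + 1" by linarith
  then show ?thesis using entry_pos_eq[OF T p(1)] entry_pos_eq[OF T r(1)] p r by simp
qed

lemma tab_st_cases:
  assumes "strict_mono_on J T" "tab_st A q J i T = Some (e, c)"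
  obtains p where "p \<in> J" "c = A * q powi (i + 1 - 2 * p)" "e = Plus" "T p = i + 1" "i \<notin> T ` J"
  | p where "p \<in> J" "c = A * q powi (i + 1 - 2 * p)" "e = Minus" "T p = i" "i + 1 \<notin> T ` J"
proof -
  consider "i + 1 \<in> T ` J \<and> i \<notin> T ` J" | "i \<in> T ` J \<and> i + 1 \<notin> T ` J"
    using assms(2) by (auto simp: tab_st_def split: if_splits)
  then show thesis
  proof cases
    case 1
    then obtain p where "p \<in> J" "T p = i + 1" by auto
    with 1 that(1)[of p] entry_pos_eq[OF assms(1), of p] assms(2) show ?thesis by (simp add: tab_st_def)
  next
    case 2
    then obtain p where "p \<in> J" "T p = i" by auto
    with 2 that(2)[of p] entry_pos_eq[OF assms(1), of p] assms(2) show ?thesis by (simp add: tab_st_def)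
  qed
qed

text \<open>An \<open>i\<close>-move changes the membership of exactly one of \<open>j\<close>,
  \<open>j + 1\<close> when \<open>\<bar>i - j\<bar> = 1\<close>, so exactly one of the two states
  at \<open>j\<close> is \<open>None\<close>. The other involves the moved entry, at the same
  position, or the entry next to it, at the adjacent position. In the exponent
  \<open>i + 1 - 2 p\<close> the first case contributes \<open>j - i\<close>, the second
  \<open>j - i - 2 (j - i)\<close>; hence the shift by \<open>q\<close> or its inverse.\<close>

lemma thin_tableaux:
  assumes q: "q \<noteq> 0" and A: "A \<noteq> 0" and J: "interval J"
    and mono: "\<And>T. T \<in> I \<Longrightarrow> strict_mono_on J T"
    and closed: "\<And>T i. T \<in> I \<Longrightarrow> \<not> (i \<in> T ` J \<and> i + 1 \<in> T ` J) \<Longrightarrow> tab_nx J i T \<in> I"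
  shows "thin q I (tab_st A q J) (tab_nx J)"
proof
  show "q \<noteq> 0" by fact
next
  fix T i assume "T \<in> I" "tab_st A q J i T \<noteq> None"
  then show "tab_nx J i T \<in> I" by (intro closed) (auto simp: tab_st_def split: if_splits)
next
  fix T i e c assume "T \<in> I" "tab_st A q J i T = Some (e, c)"
  then show "c \<noteq> 0" using q A by (auto simp: tab_st_def split: if_splits)
next
  fix T i e c assume "T \<in> I" "tab_st A q J i T = Some (e, c)"
  then show "tab_st A q J i (tab_nx J i T) = Some (neg e, c)"
    by (auto simp: tab_st_def mem_tab_nx entry_pos_tab_nx swap_def split: if_splits)
next
  fix T i show "tab_nx J i (tab_nx J i T) = T" by (rule tab_nx_tab_nx)
next
  fix T and i j :: int assume "2 \<le> \<bar>i - j\<bar>"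
  then have "swap i j = j" "swap i (j + 1) = j + 1" by (auto simp: swap_def)
  then show "tab_st A q J j (tab_nx J i T) = tab_st A q J j T"
    by (simp add: tab_st_def mem_tab_nx entry_pos_tab_nx)
next
  fix T and i j :: int assume "2 \<le> \<bar>i - j\<bar>"
  then show "tab_nx J i (tab_nx J j T) = tab_nx J j (tab_nx J i T)" by (rule tab_nx_commute)
next
  fix T and i j :: int and e c assume T: "T \<in> I" and st: "tab_st A q J i T = Some (e, c)" and ij: "\<bar>i - j\<bar> = 1"
  note succ = entry_pos_succ[OF J mono[OF T]]
  have pw: "A * q powi m * q = A * q powi (m + 1)" "A * q powi m * inverse q = A * q powi (m - 1)"
    "A * q powi m / q = A * q powi (m - 1)" for m
    using q by (simp_all add: power_int_add power_int_diff divide_inverse)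
  have ee: "i + 1 + 1 = i + 2" "i - 1 + 1 = i" by simp_all
  note defs = tab_st_def mem_tab_nx entry_pos_tab_nx
  consider "j = i + 1" | "j = i - 1" using ij by linarith
  then show "tab_st A q J j T = None \<and> tab_st A q J j (tab_nx J i T) = Some (e, c * q powi - sg e) \<or>
    tab_st A q J j T = Some (neg e, c * q powi sg e) \<and> tab_st A q J j (tab_nx J i T) = None"
  proof cases
    case 1
    have sw: "swap i (i + 1) = i" "swap i (i + 2) = i + 2" by (auto simp: swap_def)
    show ?thesis
    proof (cases e)
      case Plus
      with st have m: "i + 1 \<in> T ` J" "i \<notin> T ` J" and c: "c = A * q powi (i + 1 - 2 * entry_pos J T (i + 1))"
        by (simp_all add: tab_st_def split: if_splits)
      show ?thesis
        using succ[of "i + 1" "i + 2"] m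
        by (cases "i + 2 \<in> T ` J"; simp add: defs sw 1 Plus c pw ee; (simp add: algebra_simps)?)
    next
      case Minus
      with st have m: "i + 1 \<notin> T ` J" "i \<in> T ` J" and c: "c = A * q powi (i + 1 - 2 * entry_pos J T i)"
        by (simp_all add: tab_st_def split: if_splits)
      have "x \<notin> T ` J" if "i < x" "x < i + 2" for x
        using that m by (cases "x = i + 1") auto
      then show ?thesis
        using succ[of "i" "i + 2"] m
        by (cases "i + 2 \<in> T ` J"; simp add: defs sw 1 Minus c pw ee; (simp add: algebra_simps)?)
    qed
  next
    case 2
    have sw: "swap i (i - 1) = i - 1" "swap i i = i + 1" by (auto simp: swap_def)
    show ?thesis
    proof (cases e)
      case Plus
      with st have m: "i + 1 \<in> T ` J" "i \<notin> T ` J" and c: "c = A * q powi (i + 1 - 2 * entry_pos J T (i + 1))"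
        by (simp_all add: tab_st_def split: if_splits)
      have "x \<notin> T ` J" if "i - 1 < x" "x < i + 1" for x
        using that m by (cases "x = i") auto
      then show ?thesis
        using succ[of "i - 1" "i + 1"] m
        by (cases "i - 1 \<in> T ` J"; simp add: defs sw 2 Plus c pw ee; (simp add: algebra_simps)?)
    next
      case Minus
      with st have m: "i + 1 \<notin> T ` J" "i \<in> T ` J" and c: "c = A * q powi (i + 1 - 2 * entry_pos J T i)"
        by (simp_all add: tab_st_def split: if_splits)
      show ?thesis
        using succ[of "i - 1" "i"] m
        by (cases "i - 1 \<in> T ` J"; simp add: defs sw 2 Minus c pw ee; (simp add: algebra_simps)?)
    qed
  qed
qed

lemma tab_plus_closed:
  assumes "T \<in> tab_plus l" "\<not> (i \<in> T ` {..l} \<and> i + 1 \<in> T ` {..l})"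
  shows "tab_nx {..l} i T \<in> tab_plus l"
proof -
  from assms(1) obtain N where N: "N \<le> l" "\<And>p. p \<le> N \<Longrightarrow> T p = p" by (auto simp: tab_plus_def)
  \<comment> \<open>Entries up to \<open>i - 1\<close> lie below the exchanged pair; dually,
    \<open>i + 2\<close> is the first value above it in \<open>tab_minus_closed\<close>.\<close>
  have "\<forall>p\<le>min N (i - 1). tab_nx {..l} i T p = p" using N by (auto simp: tab_nx_def swap_def)
  moreover have "min N (i - 1) \<le> l" using N by simp
  moreover have "strict_mono_on {..l} (tab_nx {..l} i T)"
    using assms by (intro strict_mono_on_tab_nx) (auto simp: tab_plus_def)
  moreover have "tab_nx {..l} i T \<in> extensional {..l}"
    using assms(1) by (auto simp: tab_plus_def extensional_def tab_nx_def)
  ultimately show ?thesis unfolding tab_plus_def by blast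
qed

lemma tab_minus_closed:
  assumes "T \<in> tab_minus s" "\<not> (i \<in> T ` {s+1..} \<and> i + 1 \<in> T ` {s+1..})"
  shows "tab_nx {s+1..} i T \<in> tab_minus s"
proof -
  from assms(1) obtain N where N: "N \<ge> s + 1" "\<And>p. p \<ge> N \<Longrightarrow> T p = p" by (auto simp: tab_minus_def)
  have "\<forall>p\<ge>max N (i + 2). tab_nx {s+1..} i T p = p" using N by (auto simp: tab_nx_def swap_def)
  moreover have "max N (i + 2) \<ge> s + 1" using N by simp
  moreover have "strict_mono_on {s+1..} (tab_nx {s+1..} i T)"
    using assms by (intro strict_mono_on_tab_nx) (auto simp: tab_minus_def)
  moreover have "tab_nx {s+1..} i T \<in> extensional {s+1..}"
    using assms(1) by (auto simp: tab_minus_def extensional_def tab_nx_def)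
  ultimately show ?thesis unfolding tab_minus_def by blast
qed

lemma thin_tab_plus: "q \<noteq> 0 \<Longrightarrow> A \<noteq> 0 \<Longrightarrow> thin q (tab_plus l) (tab_st A q {..l}) (tab_nx {..l})"
  by (rule thin_tableaux) (simp, simp, simp, simp add: tab_plus_def, rule tab_plus_closed)

lemma thin_tab_minus: "q \<noteq> 0 \<Longrightarrow> A \<noteq> 0 \<Longrightarrow> thin q (tab_minus s) (tab_st A q {s+1..}) (tab_nx {s+1..})"
  by (rule thin_tableaux) (simp, simp, simp, simp add: tab_minus_def, rule tab_minus_closed)

lemma strict_mono_on_diff_le:
  fixes T :: "int \<Rightarrow> int"
  assumes J: "interval J" and T: "strict_mono_on J T" and x: "x \<in> J" and y: "y \<in> J" and "x \<le> y"
  shows "T x + (y - x) \<le> T y"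
  using \<open>x \<le> y\<close> y
proof (induction y rule: int_ge_induct)
  case (step z)
  then have "z \<in> J" using intervalD[OF J x, of "z + 1" z] by simp
  moreover from this step have "T z < T (z + 1)" using T by (auto dest: strict_mono_onD)
  ultimately show ?case using step by simp
qed simp

lemma tab_plus_ge:
  assumes "T \<in> tab_plus l" "p \<le> l"
  shows "p \<le> T p"
proof -
  from assms(1) obtain N where N: "N \<le> l" "\<And>p. p \<le> N \<Longrightarrow> T p = p" and T: "strict_mono_on {..l} T"
    by (auto simp: tab_plus_def)
  show ?thesis
    using strict_mono_on_diff_le[OF _ T, of "min N p" p] assms(2) N by simp
qed

lemma tab_minus_le:
  assumes "T \<in> tab_minus s" "s + 1 \<le> p"
  shows "T p \<le> p"
proof -
  from assms(1) obtain N where N: "N \<ge> s + 1" "\<And>p. p \<ge> N \<Longrightarrow> T p = p" and T: "strict_mono_on {s+1..} T"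
    by (auto simp: tab_minus_def)
  show ?thesis
    using strict_mono_on_diff_le[OF _ T, of p "max N p"] assms(2) N(2)[of "max N p"] by simp
qed

lemma powi_inj:
  fixes q :: "'a :: field"
  assumes q: "q \<noteq> 0" "\<And>n::nat. n > 0 \<Longrightarrow> q ^ n \<noteq> 1" and eq: "q powi m = q powi n"
  shows "m = n"
proof -
  have *: False if "m < n" "q powi m = q powi n" for m n :: int
  proof -
    have "q powi (n - m) = 1" using that q by (simp add: power_int_diff)
    then have "q ^ nat (n - m) = 1" using that by (simp add: power_int_def)
    with q(2)[of "nat (n - m)"] that show False by simp
  qed
  from *[of m n] *[of n m] eq show ?thesis by (metis linorder_neqE)
qed

text \<open>At a common position \<open>p \<le> i\<close> the bound on \<open>S\<close> forces
  \<open>S p = p = i\<close>, and then \<open>S (p + 1) = i + 1\<close>, so \<open>S\<close>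
  contains both entries and admits no move. For \<open>p > i\<close> the bound on \<open>T\<close>
  forces \<open>T p = p = i + 1\<close> and \<open>T (p - 1) = i\<close>, with the same effect on
  \<open>T\<close>.\<close>

lemma tab_apart:
  assumes q: "q \<noteq> 0" "\<And>n::nat. n > 0 \<Longrightarrow> q ^ n \<noteq> 1" and A: "A \<noteq> 0"
    and T: "T \<in> tab_plus l" and S: "S \<in> tab_minus s"
    and c: "tab_st A q {..l} i T = Some (e, c)" and d: "tab_st A q {s+1..} i S = Some (e', d)"
  shows "c \<noteq> d"
proof
  assume "c = d"
  have mono: "strict_mono_on {..l} T" "strict_mono_on {s+1..} S" using T S by (auto simp: tab_plus_def tab_minus_def)
  obtain p where p: "p \<le> l" "c = A * q powi (i + 1 - 2 * p)" "T p = i \<or> T p = i + 1" 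
    "\<not> (i \<in> T ` {..l} \<and> i + 1 \<in> T ` {..l})"
    by (rule tab_st_cases[OF mono(1) c]) auto
  obtain r where r: "s + 1 \<le> r" "d = A * q powi (i + 1 - 2 * r)" "S r = i \<or> S r = i + 1" 
    "\<not> (i \<in> S ` {s+1..} \<and> i + 1 \<in> S ` {s+1..})"
    by (rule tab_st_cases[OF mono(2) d]) auto
  have "q powi (i + 1 - 2 * p) = q powi (i + 1 - 2 * r)" using \<open>c = d\<close> p r A by simp
  from powi_inj[OF q this] have pr: "r = p" by simp
  show False
  proof (cases "p \<le> i")
    case True
    then have Sp: "S p = i" "p = i" using tab_minus_le[OF S, of p] r pr by auto
    have "S p < S (p + 1)" "S (p + 1) \<le> p + 1"
      using strict_mono_onD[OF mono(2), of p "p + 1"] r pr tab_minus_le[OF S, of "p + 1"] by auto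
    then have "S (p + 1) = i + 1" using Sp by simp
    then have "i \<in> S ` {s+1..}" "i + 1 \<in> S ` {s+1..}"
      using Sp r pr by (metis atLeast_iff imageI, metis atLeast_iff imageI add_increasing2 zero_le_one)
    then show False using r by simp
  next
    case False
    then have Tp: "T p = i + 1" "p = i + 1" using tab_plus_ge[OF T, of p] p by auto
    have "T (p - 1) < T p" "p - 1 \<le> T (p - 1)"
      using strict_mono_onD[OF mono(1), of "p - 1" p] p tab_plus_ge[OF T, of "p - 1"] by auto
    then have "T (p - 1) = i" using Tp by simp
    then have "i \<in> T ` {..l}" "i + 1 \<in> T ` {..l}"
      using Tp p by (metis atMost_iff diff_le_eq imageI add_increasing2 zero_le_one order_trans, metis atMost_iff imageI)
    then show False using p by simp
  qed
qed

section \<open>Weights: separation of tableaux and finite support\<close>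

definition st_wt :: "state \<Rightarrow> int" where
  "st_wt x = (case x of None \<Rightarrow> 0 | Some (e, c) \<Rightarrow> - sg e)"

lemma st_wt_tab_st: "st_wt (tab_st A q J i T) = of_bool (i \<in> T ` J) - of_bool (i + 1 \<in> T ` J)"
  by (simp add: st_wt_def tab_st_def)

text \<open>\<open>J\<close> may be unbounded on either side, so the comparison starts at
  \<open>r\<close> and runs in both directions. At a first disagreement above \<open>r\<close> the
  smaller of the two values, below \<open>r\<close> the larger one, would be missing from the other
  image.\<close>

lemma strict_mono_on_image_eq:
  fixes T T' :: "int \<Rightarrow> int"
  assumes J: "interval J" and mono: "strict_mono_on J T" "strict_mono_on J T'"
    and im: "T ` J = T' ` J" and r: "r \<in> J" "T r = T' r" and p: "p \<in> J"
  shows "T p = T' p"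
proof -
  have up: False if "strict_mono_on J T" "strict_mono_on J T'" "T ` J = T' ` J" "p \<in> J" "p + 1 \<in> J" "T p = T' p" "T (p + 1) < T' (p + 1)" for p and T T' :: "int \<Rightarrow> int"
  proof -
    have "T (p + 1) \<in> T' ` J" using that(3,5) by blast
    then obtain x where x: "x \<in> J" "T (p + 1) = T' x" by blast
    have "T' p < T' x" "T' x < T' (p + 1)" using that x strict_mono_onD[of J T p "p + 1"] by auto
    then have "p < x" "x < p + 1"
      using strict_mono_on_less[OF that(2)] that x by blast+
    then show False by simp
  qed
  have down: False if "strict_mono_on J T" "strict_mono_on J T'" "T ` J = T' ` J" "p \<in> J" "p - 1 \<in> J" "T p = T' p" "T' (p - 1) < T (p - 1)" for p and T T' :: "int \<Rightarrow> int"
  proof -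
    have "T (p - 1) \<in> T' ` J" using that(3,5) by blast
    then obtain x where x: "x \<in> J" "T (p - 1) = T' x" by blast
    have "T' (p - 1) < T' x" "T' x < T' p" using that x strict_mono_onD[of J T "p - 1" p] by auto
    then have "p - 1 < x" "x < p"
      using strict_mono_on_less[OF that(2)] that x by blast+
    then show False by simp
  qed
  have "p \<in> J \<longrightarrow> T p = T' p" if "r \<le> p" for p using that
  proof (induction p rule: int_ge_induct)
    case (step z)
    have "T (z + 1) = T' (z + 1)" if z: "z + 1 \<in> J"
    proof -
      have "z \<in> J" using intervalD[OF J r(1) z] step by simp
      then show ?thesis
        using up[OF mono im, of z] up[OF mono(2,1) im[symmetric], of z] step z by (cases "T (z + 1)" "T' (z + 1)" rule: linorder_cases) auto
    qed
    then show ?case by blast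
  qed (use r in simp)
  moreover have "p \<in> J \<longrightarrow> T p = T' p" if "p \<le> r" for p using that
  proof (induction p rule: int_le_induct)
    case (step z)
    have "T (z - 1) = T' (z - 1)" if z: "z - 1 \<in> J"
    proof -
      have "z \<in> J" using intervalD[OF J z r(1)] step by simp
      then show ?thesis
        using down[OF mono im, of z] down[OF mono(2,1) im[symmetric], of z] step z by (cases "T (z - 1)" "T' (z - 1)" rule: linorder_cases) auto
    qed
    then show ?case by blast
  qed (use r in simp)
  ultimately show ?thesis using p by (metis linear)
qed

text \<open>A weight is a difference of the memberships of \<open>i\<close> and
  \<open>i + 1\<close>. It carries membership from one integer to the next, and the common entry
  \<open>T r\<close> is the starting point.\<close>

lemma tab_eqI:
  assumes J: "interval J" and mono: "strict_mono_on J T" "strict_mono_on J T'"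
    and wt: "\<And>i. st_wt (tab_st A q J i T) = st_wt (tab_st A q J i T')" 
    and r: "r \<in> J" "T r = T' r" and ext: "T \<in> extensional J" "T' \<in> extensional J"
  shows "T = T'"
proof -
  have down: "i \<in> T ` J \<longleftrightarrow> i \<in> T' ` J" if "i + 1 \<in> T ` J \<longleftrightarrow> i + 1 \<in> T' ` J" for i
    using wt[of i] that unfolding st_wt_tab_st by (auto simp: of_bool_def split: if_splits)
  have up: "i + 1 \<in> T ` J \<longleftrightarrow> i + 1 \<in> T' ` J" if "i \<in> T ` J \<longleftrightarrow> i \<in> T' ` J" for i
    using wt[of i] that unfolding st_wt_tab_st by (auto simp: of_bool_def split: if_splits)
  have base: "T r \<in> T ` J \<longleftrightarrow> T r \<in> T' ` J" using r by (metis imageI)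
  have "v \<in> T ` J \<longleftrightarrow> v \<in> T' ` J" for v
  proof (cases "T r \<le> v")
    case True
    then show ?thesis by (induction v rule: int_ge_induct) (use base up in auto)
  next
    case False
    then have "v \<le> T r" by simp
    then show ?thesis
    proof (induction v rule: int_le_induct)
      case (step z)
      then show ?case using down[of "z - 1"] by simp
    qed (rule base)
  qed
  then have "T ` J = T' ` J" by blast
  from strict_mono_on_image_eq[OF J mono this r] ext show ?thesis by (auto intro: extensionalityI)
qed

lemma tab_plus_eqI:
  assumes T: "T \<in> tab_plus l" "T' \<in> tab_plus l"
    and wt: "\<And>i. st_wt (tab_st A q {..l} i T) = st_wt (tab_st A q {..l} i T')"
  shows "T = T'"
proof -
  obtain N N' where "N \<le> l" "\<And>p. p \<le> N \<Longrightarrow> T p = p" "N' \<le> l" "\<And>p. p \<le> N' \<Longrightarrow> T' p = p"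
    using T by (auto simp: tab_plus_def)
  then show ?thesis
    using T by (intro tab_eqI[OF _ _ _ wt, of "min N N'"]) (auto simp: tab_plus_def)
qed

lemma tab_minus_eqI:
  assumes T: "T \<in> tab_minus s" "T' \<in> tab_minus s"
    and wt: "\<And>i. st_wt (tab_st A q {s+1..} i T) = st_wt (tab_st A q {s+1..} i T')"
  shows "T = T'"
proof -
  obtain N N' where "N \<ge> s + 1" "\<And>p. p \<ge> N \<Longrightarrow> T p = p" "N' \<ge> s + 1" "\<And>p. p \<ge> N' \<Longrightarrow> T' p = p"
    using T by (auto simp: tab_minus_def)
  then show ?thesis
    using T by (intro tab_eqI[OF _ _ _ wt, of "max N N'"]) (auto simp: tab_minus_def)
qed

text \<open>All integers up to \<open>N\<close> are entries and none lies above \<open>T l\<close>,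
  so moves are confined to the range between. Finiteness is what puts the weight into the lattice
  \<open>P\<close>.\<close>

lemma finite_tab_plus:
  assumes T: "T \<in> tab_plus l"
  shows "finite {i. tab_st A q {..l} i T \<noteq> None}"
proof -
  obtain N where N: "N \<le> l" "\<And>p. p \<le> N \<Longrightarrow> T p = p" and mono: "strict_mono_on {..l} T"
    using T by (auto simp: tab_plus_def)
  have "{i. tab_st A q {..l} i T \<noteq> None} \<subseteq> {N..T l}"
  proof
    fix i assume "i \<in> {i. tab_st A q {..l} i T \<noteq> None}"
    then have i: "i \<in> T ` {..l} \<or> i + 1 \<in> T ` {..l}" "\<not> (i \<in> T ` {..l} \<and> i + 1 \<in> T ` {..l})"
      by (auto simp: tab_st_def split: if_splits)
    have "N \<le> i"
    proof (rule ccontr)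
      assume "\<not> N \<le> i"
      then have "T i = i" "T (i + 1) = i + 1" "i \<le> l" "i + 1 \<le> l" using N by auto
      then show False using i(2) by (metis atMost_iff imageI)
    qed
    moreover have "v \<le> T l" if "v \<in> T ` {..l}" for v
      using that strict_mono_on_leD[OF mono] by auto
    then have "i \<le> T l" using i by fastforce
    ultimately show "i \<in> {N..T l}" by simp
  qed
  then show ?thesis by (rule finite_subset) simp
qed

lemma finite_tab_minus:
  assumes T: "T \<in> tab_minus s"
  shows "finite {i. tab_st A q {s+1..} i T \<noteq> None}"
proof -
  obtain N where N: "N \<ge> s + 1" "\<And>p. p \<ge> N \<Longrightarrow> T p = p" and mono: "strict_mono_on {s+1..} T"
    using T by (auto simp: tab_minus_def)
  have "{i. tab_st A q {s+1..} i T \<noteq> None} \<subseteq> {T (s + 1) - 1..N}"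
  proof
    fix i assume "i \<in> {i. tab_st A q {s+1..} i T \<noteq> None}"
    then have i: "i \<in> T ` {s+1..} \<or> i + 1 \<in> T ` {s+1..}" "\<not> (i \<in> T ` {s+1..} \<and> i + 1 \<in> T ` {s+1..})"
      by (auto simp: tab_st_def split: if_splits)
    have "i \<le> N"
    proof (rule ccontr)
      assume "\<not> i \<le> N"
      then have "T i = i" "T (i + 1) = i + 1" "s + 1 \<le> i" "s + 1 \<le> i + 1" using N by auto
      then show False using i(2) by (metis atLeast_iff imageI)
    qed
    moreover have "T (s + 1) \<le> v" if "v \<in> T ` {s+1..}" for v
      using that strict_mono_on_leD[OF mono] by auto
    then have "T (s + 1) - 1 \<le> i" using i by fastforce
    ultimately show "i \<in> {T (s + 1) - 1..N}" by simp
  qed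
  then show ?thesis by (rule finite_subset) simp
qed

text \<open>Written with \<open>psi\<close> in order to agree with \<open>tableau_eig\<close> at
  every point, poles included. \<open>q\<^sup>2 * c\<close> converts the pole parameter
  \<open>c\<close> back to the argument of the inverted \<open>psi\<close>.\<close>

definition eig_fun :: "complex \<Rightarrow> state \<Rightarrow> complex \<Rightarrow> complex" where
  "eig_fun q x z =
    (case x of
       None \<Rightarrow> 1
     | Some (e, c) \<Rightarrow> (case e of Plus \<Rightarrow> inverse (psi q (q\<^sup>2 * c * z)) | Minus \<Rightarrow> psi q (c * z)))"

lemma tableau_eig_eq:
  assumes q: "q \<noteq> 0"
  shows "tableau_eig q a N J i T = eig_fun q (tab_st (a * q powi N) q J i T)"
proof
  fix z
  have pw: "a * q powi N * q powi (i + 1 - 2 * p) = a * q powi (i + N + 1 - 2 * p)" for p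
    using power_int_add[of q N "i + 1 - 2 * p"] q by (simp add: algebra_simps)
  have pw': "q\<^sup>2 * (a * q powi (i + N + 1 - 2 * p)) = a * q powi (i + N + 3 - 2 * p)" for p
    using power_int_add[of q 2 "i + N + 1 - 2 * p"] q
    by (simp add: algebra_simps)
  show "tableau_eig q a N J i T z = eig_fun q (tab_st (a * q powi N) q J i T) z"
    by (simp add: pw pw'  tableau_eig_def eig_fun_def tab_st_def)
qed

lemma tableau_delta_eq:
  assumes q: "q \<noteq> 0" and T: "strict_mono_on J T"
  shows "tableau_delta q a N J e i T =
    (case tab_st (a * q powi N) q J i T of
       None \<Rightarrow> {}
     | Some (e', c) \<Rightarrow> if e' = e then {(c, tab_nx J i T)} else {})"
proof -
  have pw: "a * q powi N * q powi (i + 1 - 2 * p) = a * q powi (i + N + 1 - 2 * p)" for p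
    using power_int_add[of q N "i + 1 - 2 * p"] q by (simp add: algebra_simps)
  show ?thesis
  proof (cases e)
    case Plus
    show ?thesis
    proof (cases "i + 1 \<in> T ` J \<and> i \<notin> T ` J")
      case True
      then obtain p where p: "p \<in> J" "T p = i + 1" by auto
      have "(\<lambda>p. if p \<in> J \<and> T p = i + 1 then i else T p) = tab_nx J i T"
        using True by (auto simp: tab_nx_def swap_def fun_eq_iff)
      then have "e_tilde J i T = Some (tab_nx J i T)"
        using True by (simp add: e_tilde_def replace_entry_def)
      moreover have "p' \<in> J \<and> T p' = i + 1 \<longleftrightarrow> p' = p" for p'
        using strict_mono_on_eqD[OF T] p by metis
      ultimately have "tableau_delta q a N J e i T = {(a * q powi (i + N + 1 - 2 * p), tab_nx J i T)}"
        by (auto simp: tableau_delta_def Plus)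
      then show ?thesis using True entry_pos_eq[OF T p(1)] p by (simp add: tab_st_def pw Plus)
    next
      case False
      then have "e_tilde J i T = None" by (auto simp: e_tilde_def replace_entry_def)
      then show ?thesis using False by (auto simp: tableau_delta_def Plus tab_st_def)
    qed
  next
    case Minus
    show ?thesis
    proof (cases "i \<in> T ` J \<and> i + 1 \<notin> T ` J")
      case True
      then obtain p where p: "p \<in> J" "T p = i" by auto
      have "T p \<noteq> i + 1" if "p \<in> J" for p using True that by (metis imageI)
      then have "(\<lambda>p. if p \<in> J \<and> T p = i then i + 1 else T p) = tab_nx J i T"
        by (auto simp: tab_nx_def swap_def fun_eq_iff)
      then have "f_tilde J i T = Some (tab_nx J i T)"
        using True by (simp add: f_tilde_def replace_entry_def)
      moreover have "p' \<in> J \<and> T p' = i \<longleftrightarrow> p' = p" for p'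
        using strict_mono_on_eqD[OF T] p by metis
      ultimately have "tableau_delta q a N J e i T = {(a * q powi (i + N + 1 - 2 * p), tab_nx J i T)}"
        by (auto simp: tableau_delta_def Minus)
      then show ?thesis using True entry_pos_eq[OF T p(1)] p by (simp add: tab_st_def pw Minus)
    next
      case False
      then have "f_tilde J i T = None" by (auto simp: f_tilde_def replace_entry_def)
      then show ?thesis using False by (auto simp: tableau_delta_def Minus tab_st_def)
    qed
  qed
qed

section \<open>Modules with a basis of tableau type\<close>

lemma geo_Plus_expansion:
  assumes "c \<noteq> 0"
  shows "(\<lambda>z. 1 / (1 - c * z)) has_fps_expansion geo Plus c"
proof -
  have "(1 - fps_const c * fps_X) * geo Plus c = 1"
    using geo_eq[OF assms, of Plus] by (simp add: zden_def znum_def mult.commute)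
  then have *: "inverse (1 - fps_const c * fps_X) = geo Plus c" by (rule fps_inverse_unique)
  have "(\<lambda>z. inverse (1 - c * z)) has_fps_expansion inverse (1 - fps_const c * fps_X)"
    by (intro fps_expansion_intros) auto
  then show ?thesis unfolding * by (simp add: divide_inverse)
qed

lemma geo_Minus_expansion:
  assumes "c \<noteq> 0"
  shows "(\<lambda>z. z / (z - c)) has_fps_expansion geo Minus c"
proof -
  have nz: "fps_X - fps_const c \<noteq> 0"
    using zden_znum_nz[OF assms, of Minus] by (simp add: zden_def znum_def)
  have "geo Minus c * (fps_X - fps_const c) = (fps_X * inverse (fps_X - fps_const c)) * (fps_X - fps_const c)"
    using geo_eq[OF assms, of Minus] inverse_mult_eq_1[of "fps_X - fps_const c"] assms
    by (simp add: zden_def znum_def mult.assoc)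
  then have *: "fps_X * inverse (fps_X - fps_const c) = geo Minus c" using nz by simp
  have "(\<lambda>z. z * inverse (z - c)) has_fps_expansion fps_X * inverse (fps_X - fps_const c)"
    using assms by (intro fps_expansion_intros) auto
  then show ?thesis unfolding * by (simp add: divide_inverse)
qed

lemma eig_fun_eq:
  assumes "q \<noteq> 0" "c * z \<noteq> 1"
  shows "eig_fun q (Some (e, c)) z = q powi sg e + (q powi - sg e - q powi sg e) * (1 / (1 - c * z))"
proof (cases e)
  case Plus
  have "psi q (q\<^sup>2 * c * z) = q * (1 - c * z) / (1 - q\<^sup>2 * c * z)"
    using assms by (simp add: psi_def power2_eq_square right_diff_distrib)
  \<comment> \<open>This holds also at the pole \<open>q\<^sup>2 * c * z = 1\<close> of
    \<open>psi\<close>: division by zero gives \<open>0\<close> there, and the inverse of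
    \<open>0\<close> is \<open>0\<close>, which is the correct zero of the eigenvalue.\<close>
  then have "eig_fun q (Some (e, c)) z = (1 - q\<^sup>2 * c * z) / (q * (1 - c * z))"
    by (simp add: eig_fun_def Plus)
  also have "\<dots> = q powi sg e + (q powi - sg e - q powi sg e) * (1 / (1 - c * z))"
    using assms by (simp add: Plus power_int_minus power2_eq_square divide_simps; (simp add: algebra_simps)?)
  finally show ?thesis .
next
  case Minus
  show ?thesis
    using assms by (simp add: eig_fun_def psi_def Minus power_int_minus divide_simps power2_eq_square; (simp add: algebra_simps)?)
qed

lemma eventually_ne_at_0: "\<forall>\<^sub>F z in at (0::complex). c * z \<noteq> 1"
proof -
  have "isCont (\<lambda>z. c * z) 0" by (intro continuous_intros)
  then have "(\<lambda>z. c * z) \<midarrow>0\<rightarrow> 0" by (simp add: isCont_def)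
  then show ?thesis by (rule tendsto_imp_eventually_ne) simp
qed

lemma eventually_ne_at_0': "c \<noteq> 0 \<Longrightarrow> \<forall>\<^sub>F z in at (0::complex). z \<noteq> 0 \<and> z \<noteq> c"
  using eventually_ne_at_0[of "1 / c"] eventually_neq_at_within[of 0 0 UNIV]
  by (auto elim: eventually_elim2)

lemma eig_ser_expansion:
  assumes q: "q \<noteq> 0" and c: "\<And>e c. x = Some (e, c) \<Longrightarrow> c \<noteq> 0"
  shows "eig_fun q x has_laurent_expansion fps_to_fls (eig_ser q Plus x)"
    and "(\<lambda>u. eig_fun q x (1 / u)) has_laurent_expansion fps_to_fls (eig_ser q Minus x)"
proof -
  show "eig_fun q x has_laurent_expansion fps_to_fls (eig_ser q Plus x)"
  proof (cases x)
    case None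
    then have "eig_fun q x = (\<lambda>z. 1)" by (auto simp: eig_fun_def)
    then show ?thesis using has_laurent_expansion_fps[OF has_fps_expansion_const[of 1]] None
      by simp
  next
    case (Some p)
    obtain e c where p: "p = (e, c)" by fastforce
    note c = c[OF Some[unfolded p]]
    have "(\<lambda>z. q powi sg e + (q powi - sg e - q powi sg e) * (1 / (1 - c * z))) has_fps_expansion eig_ser q Plus x"
      unfolding eig_ser_Some Some p
      by (intro has_fps_expansion_add has_fps_expansion_mult has_fps_expansion_const geo_Plus_expansion c)
    from has_laurent_expansion_fps[OF this] show ?thesis
      by (rule has_laurent_expansion_cong[THEN iffD1, rotated 2])
        (use eventually_ne_at_0[of c] eig_fun_eq[OF q, of c _ e] in \<open>auto simp: Some p elim!: eventually_mono\<close>)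
  qed
  show "(\<lambda>u. eig_fun q x (1 / u)) has_laurent_expansion fps_to_fls (eig_ser q Minus x)"
  proof (cases x)
    case None
    then show ?thesis using has_laurent_expansion_fps[OF has_fps_expansion_const[of 1]]
      by (simp add: eig_fun_def)
  next
    case (Some p)
    obtain e c where p: "p = (e, c)" by fastforce
    note c = c[OF Some[unfolded p]]
    have "(\<lambda>z. q powi sg e + (q powi - sg e - q powi sg e) * (z / (z - c))) has_fps_expansion eig_ser q Minus x"
      unfolding eig_ser_Some Some p
      by (intro has_fps_expansion_add has_fps_expansion_mult has_fps_expansion_const geo_Minus_expansion c)
    from has_laurent_expansion_fps[OF this] show ?thesis
    proof (rule has_laurent_expansion_cong[THEN iffD1, rotated 2])
      show "\<forall>\<^sub>F u in at 0. q powi sg e + (q powi - sg e - q powi sg e) * (u / (u - c)) = eig_fun q x (1 / u)"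
        using eventually_ne_at_0'[OF c]
      proof eventually_elim
        case (elim u)
        have "1 / (1 - c * (1 / u)) = u / (u - c)" using elim by (simp add: divide_simps)
        with elim show ?case using eig_fun_eq[OF q, of c "1 / u" e] by (auto simp: Some p)
      qed
    qed simp
  qed
qed

text \<open>\<open>phi_acts\<close> only asserts that expansions exist; uniqueness of Laurent
  expansions identifies them with \<open>eig_ser\<close>.\<close>

lemma phi_acts_eig_ser:
  assumes "phi_acts t M i v (eig_fun q x)" and q: "q \<noteq> 0" and c: "\<And>e c. x = Some (e, c) \<Longrightarrow> c \<noteq> 0"
  shows "phi t M e i (sg e * int m) v = scl M (fps_nth (eig_ser q e x) m) v"
proof -
  from assms(1) obtain f g where f: "eig_fun q x has_laurent_expansion fps_to_fls f"
    and g: "(\<lambda>u. eig_fun q x (1 / u)) has_laurent_expansion fps_to_fls g"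
    and phi: "\<And>m. phi t M Plus i (int m) v = scl M (fps_nth f m) v" "\<And>m. phi t M Minus i (- int m) v = scl M (fps_nth g m) v"
    unfolding phi_acts_def by blast
  have "f = eig_ser q Plus x"
    using has_laurent_expansion_unique[OF f eig_ser_expansion(1)[OF q c]] by simp
  moreover have "g = eig_ser q Minus x"
    using has_laurent_expansion_unique[OF g eig_ser_expansion(2)[OF q c]] by simp
  ultimately show ?thesis using phi by (cases e) simp_all
qed

lemma eig_fun_at:
  assumes "q \<noteq> 0" "y \<noteq> 0" "regular_at x y"
  shows "eig_fun q x (inverse y) = eig_at q x y"
proof (cases x)
  case (Some p)
  obtain e c where p: "p = (e, c)" by fastforce
  from assms Some p have c: "c \<noteq> y" by simp
  then have "1 / (1 - c * inverse y) = y / (y - c)" "c * inverse y \<noteq> 1"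
    using assms by (auto simp: divide_simps)
  then show ?thesis
    using eig_fun_eq[of q c "inverse y" e] eig_at_partial_fraction[OF assms(1,2) c, of e] assms
    by (simp add: Some p)
qed (simp add: eig_fun_def)

lemma eig_fun_no_pole:
  assumes "q \<noteq> 0" "y \<noteq> 0" "regular_at x y"
  shows "\<not> is_pole (eig_fun q x) (inverse y)"
proof (cases x)
  case None
  then have "eig_fun q x = (\<lambda>z. 1)" by (auto simp: eig_fun_def)
  moreover have "(\<lambda>z::complex. 1::complex) \<midarrow>inverse y\<rightarrow> 1" by simp
  ultimately show ?thesis
    using not_tendsto_and_filterlim_at_infinity[of "at (inverse y)"] unfolding is_pole_def by (metis at_neq_bot)
next
  case (Some p)
  obtain e c where p: "p = (e, c)" by fastforce
  from assms Some p have c: "c * inverse y \<noteq> 1" by (auto simp: divide_simps)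
  have "((\<lambda>z. c * z) \<longlongrightarrow> c * inverse y) (at (inverse y))" by (intro tendsto_intros)
  then have ev: "\<forall>\<^sub>F z in at (inverse y). c * z \<noteq> 1" using c by (rule tendsto_imp_eventually_ne)
  have "((\<lambda>z. q powi sg e + (q powi - sg e - q powi sg e) * (1 / (1 - c * z))) \<longlongrightarrow>
     q powi sg e + (q powi - sg e - q powi sg e) * (1 / (1 - c * inverse y))) (at (inverse y))"
    using c by (intro tendsto_intros) auto
  then have "(eig_fun q x \<longlongrightarrow> q powi sg e + (q powi - sg e - q powi sg e) * (1 / (1 - c * inverse y))) (at (inverse y))"
    by (rule Lim_transform_eventually) (use ev eig_fun_eq[OF assms(1), of c _ e] in \<open>auto simp: Some p elim!: eventually_mono\<close>)
  then show ?thesis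
    using not_tendsto_and_filterlim_at_infinity[of "at (inverse y)"] unfolding is_pole_def by (metis at_neq_bot)
qed

lemma eig_ser_nth_0: "fps_nth (eig_ser q e x) 0 = q powi (sg e * st_wt x)"
  by (cases e; cases x) (auto simp: eig_ser_def st_wt_def geo_def split: prod.split)

section \<open>Coordinates with respect to an indexed basis\<close>

locale indexed_basis = vector_space scale
  for scale :: "complex \<Rightarrow> 'v::ab_group_add \<Rightarrow> 'v" (infixr "\<odot>" 75) +
  fixes I :: "'i set" and b :: "'i \<Rightarrow> 'v"
  assumes inj: "inj_on b I" and indep: "independent (b ` I)" and spanning: "span (b ` I) = UNIV"
begin

definition coord :: "'v \<Rightarrow> 'i \<Rightarrow> complex" where
  "coord v T = (if T \<in> I then representation (b ` I) v (b T) else 0)"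

lemma coord_add: "coord (v + w) T = coord v T + coord w T"
  and coord_scale: "coord (k \<odot> v) T = k * coord v T"
  by (simp_all add: coord_def representation_add[OF indep] representation_scale[OF indep] spanning)

lemma coord_zero [simp]: "coord 0 T = 0"
  by (simp add: coord_def representation_zero)

lemma coord_sum: "coord (sum f X) T = (\<Sum>x\<in>X. coord (f x) T)"
  by (induction X rule: infinite_finite_induct) (auto simp: coord_add)

lemma coord_basis: "T \<in> I \<Longrightarrow> coord (b T) T' = (if T' = T then 1 else 0)"
  using inj by (auto simp: coord_def representation_basis[OF indep] inj_on_def)

lemma coord_support: "coord v T \<noteq> 0 \<Longrightarrow> T \<in> I"
  by (auto simp: coord_def split: if_splits)

lemma finite_coord: "finite {T. coord v T \<noteq> 0}"
proof -
  have "b ` {T. coord v T \<noteq> 0} \<subseteq> {x. representation (b ` I) v x \<noteq> 0}"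
    by (auto simp: coord_def split: if_splits)
  then have "finite (b ` {T. coord v T \<noteq> 0})" using finite_representation finite_subset by blast
  moreover have "inj_on b {T. coord v T \<noteq> 0}" using inj coord_support by (auto simp: inj_on_def)
  ultimately show ?thesis by (rule finite_imageD)
qed

lemma coord_expansion: "(\<Sum>T | coord v T \<noteq> 0. coord v T \<odot> b T) = v"
proof -
  have "(\<Sum>T | coord v T \<noteq> 0. coord v T \<odot> b T) = (\<Sum>x\<in>b ` {T. coord v T \<noteq> 0}. representation (b ` I) v x \<odot> x)"
  proof -
    have "inj_on b {T. coord v T \<noteq> 0}"
      using inj by (rule inj_on_subset) (use coord_support in auto)
    then have "(\<Sum>x\<in>b ` {T. coord v T \<noteq> 0}. representation (b ` I) v x \<odot> x) =
        (\<Sum>T | coord v T \<noteq> 0. representation (b ` I) v (b T) \<odot> b T)"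
      by (simp add: sum.reindex)
    also have "\<dots> = (\<Sum>T | coord v T \<noteq> 0. coord v T \<odot> b T)"
      by (rule sum.cong) (auto simp: coord_def)
    finally show ?thesis ..
  qed
  also have "b ` {T. coord v T \<noteq> 0} = {x. representation (b ` I) v x \<noteq> 0}"
  proof (intro equalityI subsetI)
    fix x assume "x \<in> {x. representation (b ` I) v x \<noteq> 0}"
    moreover from this have "x \<in> b ` I" using representation_ne_zero by auto
    ultimately show "x \<in> b ` {T. coord v T \<noteq> 0}" by (auto simp: coord_def)
  qed (auto simp: coord_def split: if_splits)
  also have "(\<Sum>x | representation (b ` I) v x \<noteq> 0. representation (b ` I) v x \<odot> x) = v"
    using sum_nonzero_representation_eq[OF indep] spanning by simp
  finally show ?thesis .
qed

lemma coord_eqI: "(\<And>T. T \<in> I \<Longrightarrow> coord v T = coord w T) \<Longrightarrow> v = w"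
proof -
  assume eq: "\<And>T. T \<in> I \<Longrightarrow> coord v T = coord w T"
  have "coord v = coord w"
  proof
    fix T show "coord v T = coord w T" using eq coord_support[of v T] coord_support[of w T] by metis
  qed
  then show "v = w" using coord_expansion[of v] coord_expansion[of w] by metis
qed

lemma hom_eqI:
  assumes "module_hom scale s' L" "module_hom scale s' L'" "\<And>T. T \<in> I \<Longrightarrow> L (b T) = L' (b T)"
  shows "L v = L' v"
proof -
  interpret module_pair scale s'
    using assms(1) by (simp add: module_hom_def module_pair_def)
  show ?thesis
    by (rule module_hom_eq_on_span[where B = "b ` I"]) (use assms spanning in auto)
qed

definition extend :: "('i \<Rightarrow> 'v) \<Rightarrow> 'v \<Rightarrow> 'v" where
  "extend f = (SOME g. module_hom scale scale g \<and> (\<forall>T\<in>I. g (b T) = f T))"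

lemma module_hom_extend: "module_hom scale scale (extend f)"
  and extend_basis: "T \<in> I \<Longrightarrow> extend f (b T) = f T"
proof -
  interpret vector_space_pair scale scale ..
  obtain g where "Vector_Spaces.linear scale scale g" "\<And>x. x \<in> b ` I \<Longrightarrow> g x = f (inv_into I b x)"
    using linear_independent_extend[OF indep, of "\<lambda>x. f (inv_into I b x)"] by blast
  then have "module_hom scale scale g \<and> (\<forall>T\<in>I. g (b T) = f T)"
    using inj by (auto simp: linear_iff_module_hom)
  then have "module_hom scale scale (extend f) \<and> (\<forall>T\<in>I. extend f (b T) = f T)"
    unfolding extend_def by (rule someI[of "\<lambda>g. module_hom scale scale g \<and> (\<forall>T\<in>I. g (b T) = f T)"])
  then show "module_hom scale scale (extend f)" "T \<in> I \<Longrightarrow> extend f (b T) = f T" by auto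
qed

text \<open>Serves twice: for the diagonality of all \<open>k\<^sub>h\<close> on a factor and for
  the uniqueness of weight components in the tensor product.\<close>

lemma coord_eigenvector:
  assumes K: "module_hom scale scale K" "\<And>T. T \<in> I \<Longrightarrow> K (b T) = ev T \<odot> b T"
    and v: "K v = k \<odot> v" and T: "coord v T \<noteq> 0"
  shows "ev T = k"
proof -
  have "coord (K w) T = ev T * coord w T" for w
  proof -
    have "(\<Sum>T' | coord w T' \<noteq> 0. coord w T' \<odot> K (b T')) = K w"
      using arg_cong[OF coord_expansion[of w], of K] unfolding module_hom.sum[OF K(1)] module_hom.scale[OF K(1)] .
    then have "coord (K w) T = coord (\<Sum>T' | coord w T' \<noteq> 0. coord w T' \<odot> K (b T')) T" by simp
    also have "\<dots> = (\<Sum>T' | coord w T' \<noteq> 0. coord w T' * coord (K (b T')) T)"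
      by (simp only: coord_sum coord_scale)
    also have "\<dots> = (\<Sum>T' | coord w T' \<noteq> 0. if T' = T then ev T * coord w T else 0)"
      by (rule sum.cong) (use coord_support[of w] in \<open>auto simp: K(2) coord_scale coord_basis\<close>)
    also have "\<dots> = ev T * coord w T" using finite_coord by (simp add: sum.delta)
    finally show ?thesis .
  qed
  from this[of v] show ?thesis using v T by (simp add: coord_scale)
qed

end

section \<open>Exponentials of operator series on common eigenvectors\<close>

lemma ser_pow_eigenvector:
  assumes M: "vector_space s" and A: "\<And>k. k \<noteq> 0 \<Longrightarrow> module_hom s s (A k)"
    and v: "\<And>k. k \<noteq> 0 \<Longrightarrow> A k v = s (fps_nth F k) v" and F: "fps_nth F 0 = 0"
  shows "ser_pow A n m v = s (fps_nth (F ^ n) m) v"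
proof -
  interpret vector_space s by fact
  show ?thesis
  proof (induction n arbitrary: m)
    case 0
    then show ?case by simp
  next
    case (Suc n)
    have "ser_pow A (Suc n) m v = (\<Sum>k=1..m. A k (s (fps_nth (F ^ n) (m - k)) v))"
      using Suc by simp
    also have "\<dots> = (\<Sum>k=1..m. s (fps_nth F k * fps_nth (F ^ n) (m - k)) v)"
      by (rule sum.cong) (auto simp: module_hom.scale[OF A] v mult.commute)
    \<comment> \<open>The recursion starts at \<open>k = 1\<close>; the term \<open>k = 0\<close> of
      the Cauchy product is zero because \<open>F\<close> has no constant term.\<close>
    also have "\<dots> = (\<Sum>k=0..m. s (fps_nth F k * fps_nth (F ^ n) (m - k)) v)"
      by (rule sum.mono_neutral_left) (auto simp: F Suc_le_eq)
    also have "\<dots> = s (fps_nth (F ^ Suc n) m) v"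
      by (simp add: fps_mult_nth scale_sum_left)
    finally show ?case .
  qed
qed

lemma ser_exp_eigenvector:
  assumes "vector_space s" "\<And>k. k \<noteq> 0 \<Longrightarrow> module_hom s s (A k)"
    "\<And>k. k \<noteq> 0 \<Longrightarrow> A k v = s (fps_nth F k) v" "fps_nth F 0 = 0"
  shows "ser_exp s A m v = s (fps_nth (fps_exp 1 oo F) m) v"
proof -
  interpret vector_space s by fact
  show ?thesis
    by (simp add: ser_exp_def ser_pow_eigenvector[OF assms] fps_compose_nth scale_sum_left atLeast0AtMost)
qed

text \<open>The witness is the logarithm of \<open>G\<close>: the compositional inverse of
  \<open>fps_exp 1 - 1\<close> is the series of \<open>log (1 + X)\<close>, into which
  \<open>G - 1\<close> is substituted.\<close>

lemma fps_exp_surj: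
  fixes G :: "complex fps"
  assumes "fps_nth G 0 = 1"
  obtains F where "fps_nth F 0 = 0" "fps_exp 1 oo F = G"
proof
  let ?L = "fps_inv (fps_exp 1 - 1 :: complex fps)"
  show "fps_nth (?L oo (G - 1)) 0 = 0" by (simp add: fps_inv_def)
  have "(fps_exp 1 - 1) oo (?L oo (G - 1)) = ((fps_exp 1 - 1) oo ?L) oo (G - 1)"
    by (rule fps_compose_assoc) (simp_all add: assms fps_inv_def)
  also have "(fps_exp 1 - 1) oo ?L = fps_X" by (rule fps_inv_fps_exp_compose) simp
  also have "fps_X oo (G - 1) = G - 1" by (rule fps_X_fps_compose_startby0) (simp add: assms)
  finally have "(fps_exp 1 oo (?L oo (G - 1))) - 1 = G - 1"
    by (simp add: fps_compose_sub_distrib)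
  then show "fps_exp 1 oo (?L oo (G - 1)) = G" by simp
qed

lemma module_hom_phi:
  assumes M: "vector_space (scl M)" and k: "\<And>h. module_hom (scl M) (scl M) (kop M h)"
    and h: "\<And>m. m \<noteq> 0 \<Longrightarrow> module_hom (scl M) (scl M) (hop M i m)"
  shows "module_hom (scl M) (scl M) (phi t M e i m)"
proof -
  interpret vector_space "scl M" by fact
  interpret module_pair "scl M" "scl M" ..
  define A where "A = (\<lambda>n::nat. \<lambda>u. scl M (of_int (sg e) * (exp t - 1 / exp t)) (hop M i (sg e * int n) u))"
  have A: "module_hom (scl M) (scl M) (A n)" if "n \<noteq> 0" for n
  proof -
    have "sg e * int n \<noteq> 0" using that by (cases e) auto
    then show ?thesis unfolding A_def by (intro module_hom_scale h)
  qed
  have "module_hom (scl M) (scl M) (ser_pow A n m)" for n m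
  proof (induction n arbitrary: m)
    case 0
    then show ?case by (cases "m = 0") (simp_all add: module_hom_zero module_hom_iff module_axioms)
  next
    case (Suc n)
    have "module_hom (scl M) (scl M) (\<lambda>v. A k (ser_pow A n (m - k) v))" if "k \<in> {1..m}" for k
      using module_hom_compose[OF Suc[of "m - k"] A[of k]] that by (simp add: o_def)
    then have "module_hom (scl M) (scl M) (\<lambda>v. \<Sum>k=1..m. A k (ser_pow A n (m - k) v))"
      by (intro module_hom_sum) (auto intro: module_axioms)
    then show ?case by simp
  qed
  then have "module_hom (scl M) (scl M) (ser_exp (scl M) A m)" for m
    unfolding ser_exp_def by (intro module_hom_sum module_hom_scale) (auto intro: module_axioms)
  from module_hom_compose[OF this k] show ?thesis
    unfolding phi_def A_def[symmetric]
    by (cases "0 \<le> sg e * m") (simp_all add: o_def module_hom_zero)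
qed

lemma phi_eigenvector:
  assumes M: "vector_space (scl M)" and k: "\<And>h. module_hom (scl M) (scl M) (kop M h)"
    and h: "\<And>m. m \<noteq> 0 \<Longrightarrow> module_hom (scl M) (scl M) (hop M i m)"
    and kv: "kop M (Poly_Mapping.single i (of_int (sg e))) v = scl M \<kappa> v"
    and hv: "\<And>n::nat. n \<noteq> 0 \<Longrightarrow> scl M (of_int (sg e) * (exp t - 1 / exp t)) (hop M i (sg e * int n) v) = scl M (fps_nth F n) v"
    and F: "fps_nth F 0 = 0"
  shows "phi t M e i m v = scl M (zcoeff e (fps_const \<kappa> * (fps_exp 1 oo F)) m) v"
proof (cases "0 \<le> sg e * m")
  case True
  interpret vector_space "scl M" by fact
  interpret module_pair "scl M" "scl M" ..
  define A where "A = (\<lambda>n::nat. \<lambda>u. scl M (of_int (sg e) * (exp t - 1 / exp t)) (hop M i (sg e * int n) u))"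
  have A: "module_hom (scl M) (scl M) (A n)" if "n \<noteq> 0" for n
  proof -
    have "sg e * int n \<noteq> 0" using that by (cases e) auto
    then show ?thesis unfolding A_def by (intro module_hom_scale h)
  qed
  have Av: "A n v = scl M (fps_nth F n) v" if "n \<noteq> 0" for n
    using hv[OF that] by (simp only: A_def)
  show ?thesis
    using True ser_exp_eigenvector[OF M A Av F] module_hom.scale[OF k] kv
    by (simp add: phi_def A_def[symmetric] zcoeff_def mult.commute)
next
  case False
  interpret vector_space "scl M" by fact
  show ?thesis using False by (simp add: phi_def zcoeff_def)
qed

lemma phi_zero:
  assumes "vector_space (scl M)"
  shows "phi t M e i 0 v = kop M (Poly_Mapping.single i (of_int (sg e))) v"
proof -
  interpret vector_space "scl M" by fact
  show ?thesis by (simp add: phi_def ser_exp_def)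
qed

section \<open>The Cartan part on one tensor factor\<close>

locale thin_module = thin "exp t" I st nx + uq_module t M + indexed_basis "scl M" I b
  for t I st nx and M :: "('v::ab_group_add) uq_ops" and b :: "'i \<Rightarrow> 'v" +
  assumes phi_b: "T \<in> I \<Longrightarrow> phi_acts t M i (b T) (eig_fun (exp t) (st i T))"
    and x_b: "T \<in> I \<Longrightarrow> xop M e i r (b T) =
       (case st i T of None \<Rightarrow> 0
        | Some (e', c) \<Rightarrow> if e' = e then scl M (c powi r) (b (nx i T)) else 0)"
    and wt_inj: "T \<in> I \<Longrightarrow> T' \<in> I \<Longrightarrow> (\<And>i. st_wt (st i T) = st_wt (st i T')) \<Longrightarrow> T = T'"
    and generic: "\<And>n::nat. n > 0 \<Longrightarrow> exp t ^ n \<noteq> 1"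
begin

lemma phi_coeff: "T \<in> I \<Longrightarrow> phi t M e i (sg e * int m) (b T) = scl M (fps_nth (eig_ser (exp t) e (st i T)) m) (b T)"
  using phi_acts_eig_ser[OF phi_b] st_nz by simp

lemma hom_k: "module_hom (scl M) (scl M) (kop M h)"
  using lin_k[of h] by (simp add: Vector_Spaces.linear_def)

lemma hom_x: "module_hom (scl M) (scl M) (xop M e i r)"
  using lin_x[of e i r] by (simp add: Vector_Spaces.linear_def)

lemma hom_phi: "module_hom (scl M) (scl M) (phi t M e i m)"
  using lin_h by (intro module_hom_phi vs hom_k) (simp add: Vector_Spaces.linear_def)

lemma k_single: "T \<in> I \<Longrightarrow> kop M (Poly_Mapping.single i (of_int (sg e))) (b T) = scl M (exp t powi (sg e * st_wt (st i T))) (b T)"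
  using phi_coeff[of T e i 0] by (simp add: phi_zero[OF vs] eig_ser_nth_0)

text \<open>A diagonal matrix coefficient, which makes sense before \<open>k\<^sub>h\<close> is
  known to be diagonal.\<close>

definition \<kappa> :: "cartan_space \<Rightarrow> 'i \<Rightarrow> complex" where
  "\<kappa> h T = coord (kop M h (b T)) T"

text \<open>The weights of the basis vectors are pairwise distinct, so that all \<open>k\<^sub>h\<close> are diagonal.\<close>

lemma k_b: 
  assumes T: "T \<in> I"
  shows "kop M h (b T) = scl M (\<kappa> h T) (b T)"
proof -
  have "T' = T" if T': "coord (kop M h (b T)) T' \<noteq> 0" for T'
  proof (rule wt_inj)
    show "T' \<in> I" "T \<in> I" using coord_support[OF T'] T by auto
    fix i
    let ?K = "kop M (Poly_Mapping.single i (of_int (sg Plus)))"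
    have "?K (kop M h (b T)) = kop M h (?K (b T))" by (simp add: k_add add.commute)
    also have "\<dots> = scl M (exp t powi (sg Plus * st_wt (st i T))) (kop M h (b T))"
      by (simp only: k_single[OF T] module_hom.scale[OF hom_k])
    finally have eq: "exp t powi (sg Plus * st_wt (st i T')) = exp t powi (sg Plus * st_wt (st i T))"
      by (intro coord_eigenvector[OF hom_k k_single _ T'])
    have "sg Plus * st_wt (st i T') = sg Plus * st_wt (st i T)"
      by (rule powi_inj[OF _ _ eq]) (simp_all add: generic)
    then show "st_wt (st i T') = st_wt (st i T)" by simp
  qed
  then show ?thesis
    by (intro coord_eqI) (auto simp: coord_scale coord_basis[OF T] \<kappa>_def)
qed

lemma b_cancel: "T \<in> I \<Longrightarrow> scl M x (b T) = scl M y (b T) \<longleftrightarrow> x = y"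
  by (metis coord_basis coord_scale mult_1_right)

lemma \<kappa>_zero: "T \<in> I \<Longrightarrow> \<kappa> 0 T = 1"
  by (simp add: \<kappa>_def k_zero coord_basis)

lemma \<kappa>_add: "T \<in> I \<Longrightarrow> \<kappa> (h + h') T = \<kappa> h T * \<kappa> h' T"
  by (simp add: \<kappa>_def[of "h + h'"] k_add[symmetric] k_b module_hom.scale[OF hom_k] coord_scale coord_basis mult.commute)

lemma \<kappa>_uminus: "T \<in> I \<Longrightarrow> \<kappa> h T * \<kappa> (- h) T = 1"
  using \<kappa>_add[of T h "- h"] by (simp add: \<kappa>_zero)

lemma \<kappa>_single: "T \<in> I \<Longrightarrow> \<kappa> (Poly_Mapping.single i (of_int (sg e))) T = exp t powi (sg e * st_wt (st i T))"
  using k_single[of T i e] k_b[of T] b_cancel by simp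

text \<open>No formula for the eigenvalue at rational \<open>h\<close> is needed: applying the
  relation \<open>k_x\<close> of the given module to \<open>b T\<close> already determines how a
  move changes it.\<close>

lemma \<kappa>_nx:
  assumes T: "T \<in> I" and st: "st j T = Some (e, c)"
  shows "\<kappa> h (nx j T) = qrat t (of_int (sg e) * simple_root j h) * \<kappa> h T"
proof -
  have T': "nx j T \<in> I" using closed[OF T] st by simp
  have x: "xop M e j 0 (b T) = b (nx j T)" using x_b[OF T] st by simp
  have "scl M (\<kappa> (- h) T * \<kappa> h (nx j T)) (b (nx j T)) = scl M (qrat t (of_int (sg e) * simple_root j h)) (b (nx j T))"
    using k_x[of h e j 0 "b T"] by (simp add: k_b[OF T] k_b[OF T'] x module_hom.scale[OF hom_k] module_hom.scale[OF hom_x])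
  then have "\<kappa> (- h) T * \<kappa> h (nx j T) = qrat t (of_int (sg e) * simple_root j h)"
    using b_cancel[OF T'] by simp
  then have "\<kappa> h T * \<kappa> (- h) T * \<kappa> h (nx j T) = \<kappa> h T * qrat t (of_int (sg e) * simple_root j h)"
    by (simp only: mult.assoc)
  then show ?thesis unfolding \<kappa>_uminus[OF T] by (simp only: mult_1_left mult.commute)
qed

end

section \<open>The tensor product\<close>

definition described_by ::
    "complex \<Rightarrow> 'i delta_data \<Rightarrow> (int \<Rightarrow> 'i \<Rightarrow> state) \<Rightarrow> (int \<Rightarrow> 'i \<Rightarrow> 'i) \<Rightarrow> bool" where
  "described_by q D st nx \<longleftrightarrow>
    (\<forall>T\<in>idx D. \<forall>i. eig D i T = eig_fun q (st i T) \<and>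
      (\<forall>e. delta D e i T =
         (case st i T of None \<Rightarrow> {} | Some (e', c) \<Rightarrow> if e' = e then {(c, nx i T)} else {})))"

lemma thin_moduleI:
  assumes "thin (exp t) (idx D) st nx" "uq_module t M" "delta_basis t M D b" "described_by (exp t) D st nx"
    and "\<And>T T'. T \<in> idx D \<Longrightarrow> T' \<in> idx D \<Longrightarrow> (\<And>i. st_wt (st i T) = st_wt (st i T')) \<Longrightarrow> T = T'"
    and "\<And>n::nat. n > 0 \<Longrightarrow> exp t ^ n \<noteq> 1"
  shows "thin_module t (idx D) st nx M b"
proof -
  interpret thin "exp t" "idx D" st nx by fact
  interpret uq_module t M by fact
  interpret vector_space "scl M" by (rule vs)
  show ?thesis
    by unfold_locales
      (use assms(3-6) in \<open>auto simp: delta_basis_def described_by_def is_basis_def split: option.split\<close>)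
qed

lemma coproduct_well_definedI:
  assumes D: "described_by q D st nx" and E: "described_by q E st' nx'"
    and thin: "thin q (idx D) st nx" "thin q (idx E) st' nx'"
    and apart: "\<And>T S i e1 c e2 d. T \<in> idx D \<Longrightarrow> S \<in> idx E \<Longrightarrow> st i T = Some (e1, c) \<Longrightarrow> st' i S = Some (e2, d) \<Longrightarrow> c \<noteq> d"
  shows "coproduct_well_defined D E"
proof -
  interpret D: thin q "idx D" st nx by fact
  interpret E: thin q "idx E" st' nx' by fact
  have 1: "\<not> is_pole (eig D i T) (inverse c)" 
    if "T \<in> idx D" "S \<in> idx E" "(c, S') \<in> delta E Plus i S" for T S i c S'
  proof -
    from that E have c: "st' i S = Some (Plus, c)" by (auto simp: described_by_def split: option.splits if_splits)
    have "eig D i T = eig_fun q (st i T)" using D that by (simp add: described_by_def)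
    then show ?thesis
      using eig_fun_no_pole[OF D.q_nz E.st_nz[OF that(2) c], of "st i T"] apart[OF that(1,2) _ c]
      by (auto simp: regular_at_def)
  qed
  have 2: "\<not> is_pole (eig E i S) (inverse c)" 
    if "T \<in> idx D" "S \<in> idx E" "(c, T') \<in> delta D Minus i T" for T S i c T'
  proof -
    from that D have c: "st i T = Some (Minus, c)" by (auto simp: described_by_def split: option.splits if_splits)
    have "eig E i S = eig_fun q (st' i S)" using E that by (simp add: described_by_def)
    then show ?thesis
      using eig_fun_no_pole[OF D.q_nz D.st_nz[OF that(1) c], of "st' i S"] apart[OF that(1,2) c]
      by (force simp: regular_at_def)
  qed
  show ?thesis using 1 2 unfolding coproduct_well_defined_def by auto
qed

locale thin_tensor =
  V: thin_module t I st nx V b + W: thin_module t J st' nx' W b'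
  for t and I :: "'i set" and st nx and V :: "('v::ab_group_add) uq_ops" and b
    and J :: "'j set" and st' nx' and W :: "('w::ab_group_add) uq_ops" and b' +
  fixes sU :: "complex \<Rightarrow> 'u::ab_group_add \<Rightarrow> 'u" and \<tau> :: "'v \<Rightarrow> 'w \<Rightarrow> 'u"
  assumes tensor: "is_tensor_product (scl V) (scl W) sU \<tau>"
    and apart: "T \<in> I \<Longrightarrow> S \<in> J \<Longrightarrow> st i T = Some (e1, c) \<Longrightarrow> st' i S = Some (e2, d) \<Longrightarrow> c \<noteq> d"
    and finite_st: "T \<in> I \<Longrightarrow> finite {i. st i T \<noteq> None}" "S \<in> J \<Longrightarrow> finite {i. st' i S \<noteq> None}"
begin

abbreviation "q \<equiv> exp t"

definition u :: "'i \<Rightarrow> 'j \<Rightarrow> 'u" where "u T S = \<tau> (b T) (b' S)"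

lemma hom_\<tau>: "module_hom (scl V) sU (\<lambda>v. \<tau> v w)" "module_hom (scl W) sU (\<tau> v)"
  using tensor by (auto simp: is_tensor_product_def Vector_Spaces.linear_def)

lemmas \<tau>_simps = module_hom.zero[OF hom_\<tau>(1)] module_hom.add[OF hom_\<tau>(1)] module_hom.scale[OF hom_\<tau>(1)] module_hom.sum[OF hom_\<tau>(1)]
  module_hom.zero[OF hom_\<tau>(2)] module_hom.add[OF hom_\<tau>(2)] module_hom.scale[OF hom_\<tau>(2)] module_hom.sum[OF hom_\<tau>(2)]

sublocale U: indexed_basis sU "I \<times> J" "\<lambda>(T, S). u T S"
proof -
  have B: "is_basis (scl V) (b ` I)" "is_basis (scl W) (b' ` J)"
    using V.indep V.spanning W.indep W.spanning by (simp_all add: is_basis_def)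
  with tensor have inj: "inj_on (\<lambda>(v, w). \<tau> v w) (b ` I \<times> b' ` J)"
    and basis: "is_basis sU ((\<lambda>(v, w). \<tau> v w) ` (b ` I \<times> b' ` J))" and "vector_space sU"
    unfolding is_tensor_product_def by blast+
  interpret vector_space sU by fact
  have eq: "(\<lambda>(T, S). u T S) = (\<lambda>(v, w). \<tau> v w) \<circ> map_prod b b'" by (auto simp: u_def)
  have im: "map_prod b b' ` (I \<times> J) = b ` I \<times> b' ` J" by (rule map_prod_surj_on) simp_all
  show "indexed_basis sU (I \<times> J) (\<lambda>(T, S). u T S)"
  proof
    have "inj_on (map_prod b b') (I \<times> J)" using V.inj W.inj by (rule map_prod_inj_on)
    then show "inj_on (\<lambda>(T, S). u T S) (I \<times> J)" unfolding eq by (rule comp_inj_on) (simp add: im inj)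
    have "(\<lambda>(T, S). u T S) ` (I \<times> J) = (\<lambda>(v, w). \<tau> v w) ` (b ` I \<times> b' ` J)"
      unfolding eq im[symmetric] by (rule image_comp[symmetric])
    then show "independent ((\<lambda>(T, S). u T S) ` (I \<times> J))" "span ((\<lambda>(T, S). u T S) ` (I \<times> J)) = UNIV"
      using basis by (simp_all add: is_basis_def)
  qed
qed

lemma bilinear_eqI:
  fixes \<beta> \<beta>' :: "'v \<Rightarrow> 'w \<Rightarrow> 'u"
  assumes "\<And>w. module_hom (scl V) sU (\<lambda>v. \<beta> v w)" "\<And>w. module_hom (scl V) sU (\<lambda>v. \<beta>' v w)"
    "\<And>v. module_hom (scl W) sU (\<beta> v)" "\<And>v. module_hom (scl W) sU (\<beta>' v)"
    and eq: "\<And>T S. T \<in> I \<Longrightarrow> S \<in> J \<Longrightarrow> \<beta> (b T) (b' S) = \<beta>' (b T) (b' S)"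
  shows "\<beta> v w = \<beta>' v w"
proof (rule V.hom_eqI[of sU "\<lambda>v. \<beta> v w" "\<lambda>v. \<beta>' v w"])
  fix T assume "T \<in> I"
  then show "\<beta> (b T) w = \<beta>' (b T) w"
    by (rule W.hom_eqI[OF assms(3,4) eq])
qed (rule assms)+

abbreviation ext2 :: "('i \<Rightarrow> 'j \<Rightarrow> 'u) \<Rightarrow> 'u \<Rightarrow> 'u" where
  "ext2 f \<equiv> U.extend (\<lambda>(T, S). f T S)"

lemma ext2_u: "T \<in> I \<Longrightarrow> S \<in> J \<Longrightarrow> ext2 f (u T S) = f T S"
  using U.extend_basis[of "(T, S)" "\<lambda>(T, S). f T S"] by simp

text \<open>The parameter \<open>g\<close> is the constant \<open>1\<close> in the unweighted
  summand and an eigenvalue of the other factor in the weighted one. Together with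
  \<open>moveS\<close> this covers all four summands of the coproduct.\<close>

definition moveT :: "sign \<Rightarrow> (complex \<Rightarrow> int \<Rightarrow> 'j \<Rightarrow> complex) \<Rightarrow> int \<Rightarrow> int \<Rightarrow> 'u \<Rightarrow> 'u" where
  "moveT e g i r = ext2 (\<lambda>T S. case st i T of None \<Rightarrow> 0
      | Some (e', c) \<Rightarrow> if e' = e then sU (g c i S * c powi r) (u (nx i T) S) else 0)"

definition moveS :: "sign \<Rightarrow> (complex \<Rightarrow> int \<Rightarrow> 'i \<Rightarrow> complex) \<Rightarrow> int \<Rightarrow> int \<Rightarrow> 'u \<Rightarrow> 'u" where
  "moveS e g i r = ext2 (\<lambda>T S. case st' i S of None \<Rightarrow> 0
      | Some (e', c) \<Rightarrow> if e' = e then sU (g c i T * c powi r) (u T (nx' i S)) else 0)"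

lemma hom_move: "module_hom sU sU (moveT e g i r)" "module_hom sU sU (moveS e g' i r)"
  by (simp_all add: moveT_def moveS_def U.module_hom_extend)

lemma moveT_u: "T \<in> I \<Longrightarrow> S \<in> J \<Longrightarrow> moveT e g i r (u T S) = (case st i T of None \<Rightarrow> 0
      | Some (e', c) \<Rightarrow> if e' = e then sU (g c i S * c powi r) (u (nx i T) S) else 0)"
  and moveS_u: "T \<in> I \<Longrightarrow> S \<in> J \<Longrightarrow> moveS e g' i r (u T S) = (case st' i S of None \<Rightarrow> 0
      | Some (e', c) \<Rightarrow> if e' = e then sU (g' c i T * c powi r) (u T (nx' i S)) else 0)"
  by (simp_all add: moveT_def moveS_def ext2_u)

lemma span_u: "U.span {u T S |T S. T \<in> I \<and> S \<in> J} = UNIV"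
proof -
  have "{u T S |T S. T \<in> I \<and> S \<in> J} = (\<lambda>(T, S). u T S) ` (I \<times> J)" by force
  then show ?thesis using U.spanning by simp
qed

sublocale D: drinfeld_coproduct q I st nx J st' nx' sU u
  "moveT Plus (\<lambda>c i S. 1)" "moveS Plus (\<lambda>c i T. eig_at q (st i T) c)"
  "moveS Minus (\<lambda>c i T. 1)" "moveT Minus (\<lambda>c i S. eig_at q (st' i S) c)"
proof
  show "q\<^sup>2 \<noteq> 1" using V.generic[of 2] by simp
  have "{u T S |S T. S \<in> J \<and> T \<in> I} = {u T S |T S. T \<in> I \<and> S \<in> J}" by blast
  then show "U.span {u T S |S T. S \<in> J \<and> T \<in> I} = UNIV" using span_u by simp
  show "c \<noteq> d" if "S \<in> J" "T \<in> I" "st' i S = Some (e1, c)" "st i T = Some (e2, d)" for S T i e1 c e2 d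
    using apart[OF that(2,1,4,3)] by simp
qed (auto simp: moveT_u moveS_u span_u apart module_hom.add[OF hom_move(1)] module_hom.add[OF hom_move(2)]
    module_hom.scale[OF hom_move(1)] module_hom.scale[OF hom_move(2)] split: option.split)

text \<open>The generating series of the eigenvalues of the \<open>h\<^sub>i\<^sub>,\<^sub>m\<close> is the logarithm of that of
  \<open>\<phi>\<^sub>i\<close>.\<close>

definition log_ser :: "sign \<Rightarrow> int \<Rightarrow> 'i \<Rightarrow> 'j \<Rightarrow> complex fps" where
  "log_ser e i T S = (SOME F. fps_nth F 0 = 0 \<and>
     fps_const (q powi (sg e * (st_wt (st i T) + st_wt (st' i S)))) * (fps_exp 1 oo F) =
     eig_ser q e (st i T) * eig_ser q e (st' i S))"

lemma log_ser:
  "fps_nth (log_ser e i T S) 0 = 0 \<and>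
     fps_const (q powi (sg e * (st_wt (st i T) + st_wt (st' i S)))) * (fps_exp 1 oo log_ser e i T S) =
     eig_ser q e (st i T) * eig_ser q e (st' i S)"
proof -
  define k G where "k = q powi (sg e * (st_wt (st i T) + st_wt (st' i S)))"
    and "G = eig_ser q e (st i T) * eig_ser q e (st' i S)"
  have k: "k \<noteq> 0" by (simp add: k_def)
  have "fps_nth G 0 = k" by (simp add: G_def k_def eig_ser_nth_0 power_int_add distrib_left)
  then have "fps_nth (fps_const (1 / k) * G) 0 = 1" using k by simp
  then obtain F where F: "fps_nth F 0 = 0" "fps_exp 1 oo F = fps_const (1 / k) * G"
    by (rule fps_exp_surj)
  have "fps_const k * (fps_exp 1 oo F) = G"
    unfolding F(2) mult.assoc[symmetric] fps_const_mult using k by simp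
  with F(1) show ?thesis
    unfolding log_ser_def k_def[symmetric] G_def[symmetric]
    by (intro someI[of "\<lambda>F. fps_nth F 0 = 0 \<and> fps_const k * (fps_exp 1 oo F) = G" F]) simp
qed

text \<open>Dividing by \<open>q - 1 / q\<close> undoes the scaling of
  \<open>h\<^sub>i\<^sub>,\<^sub>m\<close> in the exponent of \<open>\<phi>\<^sub>i\<close>, and the
  sign for \<open>m < 0\<close> undoes the minus sign in the exponent of
  \<open>\<phi>\<^sub>i^-\<close>. For \<open>m = 0\<close> the value is zero, as the logarithm has
  no constant term.\<close>

definition U_ops :: "'u uq_ops" where
  "U_ops = \<lparr>scl = sU,
     xop = (\<lambda>e. case e of Plus \<Rightarrow> D.P.X | Minus \<Rightarrow> D.M.X),
     kop = (\<lambda>h. ext2 (\<lambda>T S. sU (V.\<kappa> h T * W.\<kappa> h S) (u T S))),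
     hop = (\<lambda>i m. ext2 (\<lambda>T S. sU
       ((if 0 < m then fps_nth (log_ser Plus i T S) (nat m) else - fps_nth (log_ser Minus i T S) (nat (- m)))
          / (q - 1 / q)) (u T S)))\<rparr>"

lemma scl_U [simp]: "scl U_ops = sU"
  by (simp add: U_ops_def)

lemma xop_U: "xop U_ops Plus = D.P.X" "xop U_ops Minus = D.M.X"
  by (simp_all add: U_ops_def)

lemma hom_kop_U: "module_hom sU sU (kop U_ops h)"
  and hom_hop_U: "module_hom sU sU (hop U_ops i m)"
  by (simp_all add: U_ops_def U.module_hom_extend)

lemma hom_phi_U: "module_hom sU sU (phi t U_ops e i m)"
  using module_hom_phi[of U_ops] hom_kop_U hom_hop_U U.vector_space_axioms by simp

lemma hom_xop_U: "module_hom sU sU (xop U_ops e i r)"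
proof (cases e)
  case Plus
  have "D.P.X i r = (\<lambda>v. moveT Plus (\<lambda>c i S. 1) i r v + moveS Plus (\<lambda>c i T. eig_at q (st i T) c) i r v)"
    by (auto simp: D.P.X_def)
  then show ?thesis by (simp only: Plus xop_U) (intro D.P.endos)
next
  case Minus
  have "D.M.X i r = (\<lambda>v. moveS Minus (\<lambda>c i T. 1) i r v + moveT Minus (\<lambda>c i S. eig_at q (st' i S) c) i r v)"
    by (auto simp: D.M.X_def)
  then show ?thesis by (simp only: Minus xop_U) (intro D.M.endos)
qed

lemma kop_u: "T \<in> I \<Longrightarrow> S \<in> J \<Longrightarrow> kop U_ops h (u T S) = sU (V.\<kappa> h T * W.\<kappa> h S) (u T S)"
  by (simp add: U_ops_def ext2_u)

lemma phi_u:
  assumes "T \<in> I" "S \<in> J"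
  shows "phi t U_ops e i m (u T S) = sU (zcoeff e (eig_ser q e (st i T) * eig_ser q e (st' i S)) m) (u T S)"
proof -
  have q: "q - 1 / q \<noteq> 0"
    using V.generic[of 2] by (simp add: divide_simps power2_eq_square)
  have "phi t U_ops e i m (u T S) = scl U_ops (zcoeff e
     (fps_const (q powi (sg e * (st_wt (st i T) + st_wt (st' i S)))) * (fps_exp 1 oo log_ser e i T S)) m) (u T S)"
  proof (rule phi_eigenvector)
    show "kop U_ops (Poly_Mapping.single i (of_int (sg e))) (u T S) =
      scl U_ops (q powi (sg e * (st_wt (st i T) + st_wt (st' i S)))) (u T S)"
      by (simp add: kop_u[OF assms] V.\<kappa>_single[OF assms(1)] W.\<kappa>_single[OF assms(2)] distrib_left power_int_add)
    show "scl U_ops (of_int (sg e) * (q - 1 / q)) (hop U_ops i (sg e * int n) (u T S)) =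
      scl U_ops (fps_nth (log_ser e i T S) n) (u T S)" if "n \<noteq> 0" for n
    proof -
      have "hop U_ops i (sg e * int n) (u T S) = sU (of_int (sg e) * fps_nth (log_ser e i T S) n / (q - 1 / q)) (u T S)"
        using that by (cases e) (simp_all add: U_ops_def ext2_u[OF assms])
      moreover have "of_int (sg e) * D * (of_int (sg e) * x / D) = x" if "D \<noteq> 0" for D x :: complex
        using that by (cases e) simp_all
      ultimately show ?thesis using q by (simp only: scl_U U.scale_scale not_False_eq_True)
    qed
  qed (use log_ser hom_kop_U hom_hop_U U.vector_space_axioms in simp_all)
  then show ?thesis using log_ser[of e i T S] by simp
qed

lemma U_endo_eqI:
  assumes "module_hom sU sU L" "module_hom sU sU L'" "\<And>T S. T \<in> I \<Longrightarrow> S \<in> J \<Longrightarrow> L (u T S) = L' (u T S)"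
  shows "L v = L' v"
  by (rule D.P.ext_u) (use assms in auto)

lemma hom_comp: "module_hom sU sU f \<Longrightarrow> module_hom sU sU g \<Longrightarrow> module_hom sU sU (\<lambda>v. g (f v))"
  using module_hom_compose[of sU sU f sU g] by (simp add: o_def)

lemma linear_U: "module_hom sU sU f \<Longrightarrow> Vector_Spaces.linear sU sU f"
  using U.vector_space_axioms by (simp add: Vector_Spaces.linear_def)

lemma uq_module_U: "uq_module t U_ops"
proof (rule uq_module.intro)
  show "vector_space (scl U_ops)" using U.vector_space_axioms by simp
  show "Vector_Spaces.linear (scl U_ops) (scl U_ops) (xop U_ops e i r)" for e i r
    using hom_xop_U by (simp add: linear_U)
  show "Vector_Spaces.linear (scl U_ops) (scl U_ops) (kop U_ops h)" for h
    using hom_kop_U by (simp add: linear_U)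
  show "Vector_Spaces.linear (scl U_ops) (scl U_ops) (hop U_ops i m)" for i m
    using hom_hop_U by (simp add: linear_U)
  show "kop U_ops h (kop U_ops h' v) = kop U_ops (h + h') v" for h h' v
    by (rule U_endo_eqI[of "\<lambda>v. kop U_ops h (kop U_ops h' v)"])
      (auto intro: hom_comp hom_kop_U simp: kop_u module_hom.scale[OF hom_kop_U] V.\<kappa>_add W.\<kappa>_add mult_ac)
  show "kop U_ops 0 v = v" for v
    by (rule U_endo_eqI[of "kop U_ops 0" "\<lambda>v. v"])
      (auto intro: hom_kop_U D.P.endo_intros simp: kop_u V.\<kappa>_zero W.\<kappa>_zero)
  show "kop U_ops h (phi t U_ops e i m v) = phi t U_ops e i m (kop U_ops h v)" for h e i m v
    by (rule U_endo_eqI[of "\<lambda>v. kop U_ops h (phi t U_ops e i m v)" "\<lambda>v. phi t U_ops e i m (kop U_ops h v)"])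
      (auto intro: hom_comp hom_kop_U hom_phi_U simp: kop_u phi_u module_hom.scale[OF hom_kop_U]
        module_hom.scale[OF hom_phi_U] mult.commute)
  show "phi t U_ops e i m (phi t U_ops e' j n v) = phi t U_ops e' j n (phi t U_ops e i m v)" for e i m e' j n v
    by (rule U_endo_eqI[of "\<lambda>v. phi t U_ops e i m (phi t U_ops e' j n v)" "\<lambda>v. phi t U_ops e' j n (phi t U_ops e i m v)"])
      (auto intro: hom_comp hom_phi_U simp: phi_u module_hom.scale[OF hom_phi_U] mult.commute)
  \<comment> \<open>The half for the sign minus has the two factors interchanged, so its eigenvalues
    are needed as products in the other order.\<close>
  have kop_u': "kop U_ops h (u T S) = sU (W.\<kappa> h S * V.\<kappa> h T) (u T S)" if "S \<in> J" "T \<in> I" for h S T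
    using kop_u[OF that(2,1)] by (simp add: mult.commute)
  show "kop U_ops h (xop U_ops e j r (kop U_ops (- h) v)) =
      scl U_ops (qrat t (of_int (sg e) * simple_root j h)) (xop U_ops e j r v)" for h e j r v
  proof (cases e)
    case Plus
    show ?thesis unfolding Plus xop_U scl_U
      by (rule D.P.X_k[OF hom_kop_U hom_kop_U kop_u kop_u V.\<kappa>_uminus W.\<kappa>_uminus V.\<kappa>_nx W.\<kappa>_nx])
  next
    case Minus
    show ?thesis unfolding Minus xop_U scl_U
      by (rule D.M.X_k[OF hom_kop_U hom_kop_U kop_u' kop_u' W.\<kappa>_uminus V.\<kappa>_uminus W.\<kappa>_nx V.\<kappa>_nx])
  qed
  have phi_u': "phi t U_ops e i m (u T S) = sU (zcoeff e (eig_ser q e (st' i S) * eig_ser q e (st i T)) m) (u T S)"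
    if "S \<in> J" "T \<in> I" for e i m S T
    using phi_u[OF that(2,1)] by (simp add: mult.commute)
  show "phi t U_ops e' i m (xop U_ops e j (s - 1) v)
      - scl U_ops (q powi (sg e * cartan i j)) (phi t U_ops e' i (m - 1) (xop U_ops e j s v)) =
      scl U_ops (q powi (sg e * cartan i j)) (xop U_ops e j (s - 1) (phi t U_ops e' i m v))
      - xop U_ops e j s (phi t U_ops e' i (m - 1) v)" for e' i m e j s v
  proof (cases e)
    case Plus
    show ?thesis unfolding Plus xop_U scl_U by (rule D.P.X_phi[OF hom_phi_U phi_u])
  next
    case Minus
    show ?thesis unfolding Minus xop_U scl_U by (rule D.M.X_phi[OF hom_phi_U phi_u'])
  qed
  show "xop U_ops Plus i r (xop U_ops Minus j s v) - xop U_ops Minus j s (xop U_ops Plus i r v) =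
      (if i = j then scl U_ops (1 / (q - 1 / q)) (phi t U_ops Plus i (r + s) v - phi t U_ops Minus i (r + s) v) else 0)" for i r j s v
    unfolding xop_U scl_U
    by (rule D.X_X'[where \<Phi> = "\<lambda>e. phi t U_ops e i (r + s)"]) (use hom_phi_U phi_u in auto)
  show "xop U_ops e i r (xop U_ops e j (s - 1) v) - scl U_ops (q powi (sg e * cartan i j)) (xop U_ops e i (r - 1) (xop U_ops e j s v)) =
      scl U_ops (q powi (sg e * cartan i j)) (xop U_ops e j (s - 1) (xop U_ops e i r v)) - xop U_ops e j s (xop U_ops e i (r - 1) v)" for e i r j s v
    using D.P.X_quad D.M.X_quad by (cases e) (simp_all only: xop_U scl_U)
  show "(\<Sum>(r1, r2)\<leftarrow>[(r, r'), (r', r)].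
        xop U_ops e i r1 (xop U_ops e i r2 (xop U_ops e j s v))
        - scl U_ops (q + 1 / q) (xop U_ops e i r1 (xop U_ops e j s (xop U_ops e i r2 v)))
        + xop U_ops e j s (xop U_ops e i r1 (xop U_ops e i r2 v))) = 0" if "\<bar>i - j\<bar> = 1" for i j r r' e s v
    using D.P.X_serre[OF that] D.M.X_serre[OF that] by (cases e) (simp_all only: xop_U scl_U)
  show "xop U_ops e i r (xop U_ops e j s v) = xop U_ops e j s (xop U_ops e i r v)" if "2 \<le> \<bar>i - j\<bar>" for i j e r s v
    using D.P.X_far[OF that] D.M.X_far[OF that] by (cases e) (simp_all only: xop_U)
qed

section \<open>Weight decomposition and local nilpotency\<close>

definition weight :: "'i \<Rightarrow> 'j \<Rightarrow> weight" where
  "weight T S = Abs_poly_mapping (\<lambda>i. st_wt (st i T) + st_wt (st' i S))"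

lemma lookup_weight:
  assumes "T \<in> I" "S \<in> J"
  shows "Poly_Mapping.lookup (weight T S) i = st_wt (st i T) + st_wt (st' i S)"
proof -
  have "{i. st_wt (st i T) + st_wt (st' i S) \<noteq> 0} \<subseteq> {i. st i T \<noteq> None} \<union> {i. st' i S \<noteq> None}"
    by (auto simp: st_wt_def split: option.splits)
  then have "finite {i. st_wt (st i T) + st_wt (st' i S) \<noteq> 0}"
    using finite_st assms by (meson finite_UnI finite_subset)
  then show ?thesis unfolding weight_def by (simp add: lookup_Abs_poly_mapping)
qed

lemma kop_h_u:
  assumes "T \<in> I" "S \<in> J"
  shows "kop U_ops (h_elt i) (u T S) = sU (q powi Poly_Mapping.lookup (weight T S) i) (u T S)"
  using kop_u[OF assms, of "h_elt i"] V.\<kappa>_single[OF assms(1), of i Plus] W.\<kappa>_single[OF assms(2), of i Plus]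
  by (simp add: h_elt_def lookup_weight[OF assms] power_int_add)

lemma weight_space_coord:
  assumes v: "v \<in> weight_space t U_ops \<nu>" and c: "U.coord v (T, S) \<noteq> 0"
  shows "weight T S = \<nu>"
proof (rule poly_mapping_eqI)
  fix i
  have TS: "T \<in> I" "S \<in> J" using U.coord_support[OF c] by auto
  have "q powi Poly_Mapping.lookup (weight T S) i = q powi Poly_Mapping.lookup \<nu> i"
    using U.coord_eigenvector[OF hom_kop_U[of "h_elt i"], of "\<lambda>(T, S). q powi Poly_Mapping.lookup (weight T S) i", OF _ _ c] v
    by (auto simp: kop_h_u weight_space_def)
  then show "Poly_Mapping.lookup (weight T S) i = Poly_Mapping.lookup \<nu> i"
    using powi_inj[of q] V.generic by auto
qed

lemma integrable_U: "integrable_module t U_ops"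
  unfolding integrable_module_def
proof (intro conjI allI)
  fix e i v
  have "(xop U_ops e i 0 ^^ 3) v = 0"
    using D.P.X_cube D.M.X_cube by (cases e) (simp_all add: numeral_3_eq_3 xop_U)
  then show "\<exists>n. (xop U_ops e i 0 ^^ n) v = 0" by blast
next
  fix v
  define comp where "comp \<nu> = (\<Sum>x | U.coord v x \<noteq> 0 \<and> weight (fst x) (snd x) = \<nu>. sU (U.coord v x) (u (fst x) (snd x)))" for \<nu>
  let ?X = "{x. U.coord v x \<noteq> 0}"
  let ?N = "(\<lambda>x. weight (fst x) (snd x)) ` ?X"
  have fin: "finite ?N" using U.finite_coord by simp
  have supp: "{\<nu>. comp \<nu> \<noteq> 0} \<subseteq> ?N"
  proof
    fix \<nu> assume "\<nu> \<in> {\<nu>. comp \<nu> \<noteq> 0}"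
    then have "{x. U.coord v x \<noteq> 0 \<and> weight (fst x) (snd x) = \<nu>} \<noteq> {}" by (force simp: comp_def)
    then show "\<nu> \<in> ?N" by blast
  qed
  define F where "F = Abs_poly_mapping comp"
  have F: "Poly_Mapping.lookup F = comp"
    unfolding F_def by (rule lookup_Abs_poly_mapping) (use fin supp finite_subset in blast)
  have comp_weight: "comp \<nu> \<in> weight_space t U_ops \<nu>" for \<nu>
    unfolding weight_space_def comp_def
    by (auto simp: module_hom.sum[OF hom_kop_U] module_hom.scale[OF hom_kop_U] U.scale_sum_right kop_h_u
        mult.commute dest!: U.coord_support intro!: sum.cong)
  have "(\<Sum>\<nu>\<in>Poly_Mapping.keys F. Poly_Mapping.lookup F \<nu>) = (\<Sum>\<nu>\<in>?N. comp \<nu>)"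
    by (rule sum.mono_neutral_cong_left) (use fin supp F in \<open>auto simp: in_keys_iff\<close>)
  also have "\<dots> = (\<Sum>x\<in>?X. sU (U.coord v x) (u (fst x) (snd x)))"
    unfolding comp_def using sum.image_gen[OF U.finite_coord, symmetric] by simp
  also have "\<dots> = v" using U.coord_expansion[of v] by (simp add: case_prod_unfold)
  finally have sum_F: "v = (\<Sum>\<nu>\<in>Poly_Mapping.keys F. Poly_Mapping.lookup F \<nu>)" ..
  \<comment> \<open>Proved for an arbitrary decomposition \<open>G\<close>: a vector of weight
    \<open>\<nu>\<close> has coordinates only at basis vectors of that weight, so the components are
    forced by the coordinates of \<open>v\<close>. Comparing \<open>G\<close> with \<open>F\<close>
    then gives uniqueness.\<close>
  have coord_comp: "U.coord (Poly_Mapping.lookup G \<nu>) x = (if weight (fst x) (snd x) = \<nu> then U.coord v x else 0)"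
    if G: "\<And>\<nu>. Poly_Mapping.lookup G \<nu> \<in> weight_space t U_ops \<nu>" "v = (\<Sum>\<nu>\<in>Poly_Mapping.keys G. Poly_Mapping.lookup G \<nu>)"
    for G \<nu> x
  proof -
    have off: "U.coord (Poly_Mapping.lookup G \<nu>) x = 0" if "weight (fst x) (snd x) \<noteq> \<nu>" for \<nu>
      using weight_space_coord[OF G(1), of \<nu> "fst x" "snd x"] that by auto
    have "U.coord v x = (\<Sum>\<nu>\<in>Poly_Mapping.keys G. U.coord (Poly_Mapping.lookup G \<nu>) x)"
      by (subst G(2)) (rule U.coord_sum)
    also have "\<dots> = (\<Sum>\<nu>\<in>Poly_Mapping.keys G. if \<nu> = weight (fst x) (snd x) then U.coord (Poly_Mapping.lookup G \<nu>) x else 0)"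
      using off by (intro sum.cong) auto
    also have "\<dots> = U.coord (Poly_Mapping.lookup G (weight (fst x) (snd x))) x"
      by (simp add: in_keys_iff)
    finally show ?thesis using off by auto
  qed
  show "\<exists>!F. (\<forall>\<nu>. Poly_Mapping.lookup F \<nu> \<in> weight_space t U_ops \<nu>) \<and>
      v = (\<Sum>\<nu>\<in>Poly_Mapping.keys F. Poly_Mapping.lookup F \<nu>)"
  proof (rule ex1I)
    show "(\<forall>\<nu>. Poly_Mapping.lookup F \<nu> \<in> weight_space t U_ops \<nu>) \<and> v = (\<Sum>\<nu>\<in>Poly_Mapping.keys F. Poly_Mapping.lookup F \<nu>)"
      using comp_weight F sum_F by simp
    fix G assume G: "(\<forall>\<nu>. Poly_Mapping.lookup G \<nu> \<in> weight_space t U_ops \<nu>) \<and> v = (\<Sum>\<nu>\<in>Poly_Mapping.keys G. Poly_Mapping.lookup G \<nu>)"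
    show "G = F"
    proof (rule poly_mapping_eqI)
      fix \<nu>
      show "Poly_Mapping.lookup G \<nu> = Poly_Mapping.lookup F \<nu>"
        by (rule U.coord_eqI) (use coord_comp[of G] coord_comp[of F] G comp_weight F sum_F in simp)
    qed
  qed
qed

section \<open>Agreement of the constructed operators with the coproduct\<close>

lemma coproduct_action_U:
  assumes D: "described_by q D st nx" "idx D = I" and E: "described_by q E st' nx'" "idx E = J"
  shows "coproduct_action t V D b W E b' \<tau> U_ops"
  unfolding coproduct_action_def
proof (intro conjI allI ballI)
  have comp: "module_hom s1 s2 f \<Longrightarrow> module_hom s2 s3 g \<Longrightarrow> module_hom s1 s3 (\<lambda>v. g (f v))" for s1 s2 s3 and f g
    using module_hom_compose[of s1 s2 f s3 g] by (simp add: o_def)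
  fix h v w
  show "kop U_ops h (\<tau> v w) = \<tau> (kop V h v) (kop W h w)"
    by (rule bilinear_eqI[of "\<lambda>v w. kop U_ops h (\<tau> v w)" "\<lambda>v w. \<tau> (kop V h v) (kop W h w)"])
      (auto intro: comp hom_\<tau> V.hom_k W.hom_k hom_kop_U
        simp: kop_u[unfolded u_def] V.k_b W.k_b \<tau>_simps mult.commute)
next
  have comp: "module_hom s1 s2 f \<Longrightarrow> module_hom s2 s3 g \<Longrightarrow> module_hom s1 s3 (\<lambda>v. g (f v))" for s1 s2 s3 and f g
    using module_hom_compose[of s1 s2 f s3 g] by (simp add: o_def)
  fix e i m v w
  let ?R = "\<lambda>v w. \<Sum>j\<le>m. \<tau> (phi t V e i (sg e * int j) v) (phi t W e i (sg e * int (m - j)) w)"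
  show "phi t U_ops e i (sg e * int m) (\<tau> v w) = ?R v w"
  proof (rule bilinear_eqI[of "\<lambda>v w. phi t U_ops e i (sg e * int m) (\<tau> v w)" ?R])
    interpret VU: module_pair "scl V" sU ..
    interpret WU: module_pair "scl W" sU ..
    show "module_hom (scl V) sU (\<lambda>v. ?R v w)" for w
      by (intro VU.module_hom_sum comp[OF V.hom_phi hom_\<tau>(1)]) simp
    show "module_hom (scl W) sU (?R v)" for v
      by (intro WU.module_hom_sum comp[OF W.hom_phi hom_\<tau>(2)]) simp
    fix T S assume TS: "T \<in> I" "S \<in> J"
    have "zcoeff e F (sg e * int m) = fps_nth F m" for F by (cases e) (simp_all add: zcoeff_def)
    then have "phi t U_ops e i (sg e * int m) (u T S) =
        sU (fps_nth (eig_ser q e (st i T) * eig_ser q e (st' i S)) m) (u T S)"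
      by (simp add: phi_u[OF TS])
    also have "\<dots> = ?R (b T) (b' S)"
      by (simp add: V.phi_coeff[OF TS(1)] W.phi_coeff[OF TS(2)] \<tau>_simps u_def fps_mult_nth U.scale_sum_left atLeast0AtMost
          mult.commute del: of_nat_diff)
    finally show "phi t U_ops e i (sg e * int m) (\<tau> (b T) (b' S)) = ?R (b T) (b' S)" by (simp add: u_def)
  qed (intro comp[OF hom_\<tau>(1) hom_phi_U] comp[OF hom_\<tau>(2) hom_phi_U])+
next
  fix T S i r assume "T \<in> idx D" "S \<in> idx E"
  then have TS: "T \<in> I" "S \<in> J" using D E by auto
  have dD: "delta D e i T = (case st i T of None \<Rightarrow> {} | Some (e', c) \<Rightarrow> if e' = e then {(c, nx i T)} else {})"
    "eig D i T = eig_fun q (st i T)" for e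
    using D TS by (auto simp: described_by_def)
  have dE: "delta E e i S = (case st' i S of None \<Rightarrow> {} | Some (e', c) \<Rightarrow> if e' = e then {(c, nx' i S)} else {})"
    "eig E i S = eig_fun q (st' i S)" for e
    using E TS by (auto simp: described_by_def)
  \<comment> \<open>The evaluation points are poles of the other factor, hence regular here; there
    the prescribed value of the rational function equals the weight \<open>eig_at\<close> used in
    the construction.\<close>
  have eT: "eig_fun q (st i T) (inverse c) = eig_at q (st i T) c" if "st' i S = Some (e, c)" for e c
    by (rule eig_fun_at) (use W.st_nz[OF TS(2) that] D.P.apart_FG[OF TS that] in auto)
  have eS: "eig_fun q (st' i S) (inverse c) = eig_at q (st' i S) c" if "st i T = Some (e, c)" for e c
    by (rule eig_fun_at) (use V.st_nz[OF TS(1) that] D.M.apart_FG[OF TS(2,1) that] in auto)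
  show "xop U_ops Plus i r (\<tau> (b T) (b' S)) = \<tau> (xop V Plus i r (b T)) (b' S)
     + (\<Sum>(c, S')\<in>delta E Plus i S. scl U_ops (eig D i T (inverse c) * c powi r) (\<tau> (b T) (b' S')))"
    unfolding u_def[symmetric] xop_U D.P.X_def D.P.A_u[OF TS] D.P.B_u[OF TS] dD dE V.x_b[OF TS(1)]
    by (auto simp: \<tau>_simps u_def eT split: option.split)
  show "xop U_ops Minus i r (\<tau> (b T) (b' S)) =
     (\<Sum>(c, T')\<in>delta D Minus i T. scl U_ops (eig E i S (inverse c) * c powi r) (\<tau> (b T') (b' S)))
     + \<tau> (b T) (xop W Minus i r (b' S))"
    unfolding u_def[symmetric] xop_U D.M.X_def D.M.A_u[OF TS(2,1)] D.M.B_u[OF TS(2,1)] dD dE W.x_b[OF TS(2)]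
    by (auto simp: \<tau>_simps u_def eS split: option.split)
qed

end

section \<open>Specialisation to the two fundamental modules\<close>

lemma described_tab_plus:
  assumes "q \<noteq> 0"
  shows "described_by q (tab_plus_data q l a) (tab_st (a * q powi l) q {..l}) (tab_nx {..l})"
  using tableau_eig_eq[OF assms] tableau_delta_eq[OF assms, of "{..l}"]
  by (auto simp: described_by_def tab_plus_data_def tab_plus_def)

lemma described_tab_minus:
  assumes "q \<noteq> 0"
  shows "described_by q (tab_minus_data q s a) (tab_st (a * q powi s) q {s+1..}) (tab_nx {s+1..})"
  using tableau_eig_eq[OF assms] tableau_delta_eq[OF assms, of "{s+1..}"]
  by (auto simp: described_by_def tab_minus_data_def tab_minus_def)

theorem proposition3p2:
  fixes t a :: complex and l :: int
    and V :: "('v::ab_group_add) uq_ops" and W :: "('w::ab_group_add) uq_ops"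
    and b :: "(int \<Rightarrow> int) \<Rightarrow> 'v" and b' :: "(int \<Rightarrow> int) \<Rightarrow> 'w"
    and sU :: "complex \<Rightarrow> 'u::ab_group_add \<Rightarrow> 'u" and \<tau> :: "'v \<Rightarrow> 'w \<Rightarrow> 'u"
  assumes "\<And>n::nat. n > 0 \<Longrightarrow> exp t ^ n \<noteq> 1"
    and "l \<ge> 1" and "a \<noteq> 0"
    and "fundamental_plus t l a V"
    and "delta_basis t V (tab_plus_data (exp t) l a) b"
    and "fundamental_minus t 0 (a * exp t powi l) W"
    and "delta_basis t W (tab_minus_data (exp t) 0 (a * exp t powi l)) b'"
    and "is_tensor_product (scl V) (scl W) sU \<tau>"
  shows "coproduct_well_defined (tab_plus_data (exp t) l a)
           (tab_minus_data (exp t) 0 (a * exp t powi l)) \<and>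
         (\<exists>U :: 'u uq_ops. scl U = sU \<and>
            coproduct_action t V (tab_plus_data (exp t) l a) b
              W (tab_minus_data (exp t) 0 (a * exp t powi l)) b' \<tau> U \<and>
            uq_module t U \<and> integrable_module t U)"
proof -
  let ?D = "tab_plus_data (exp t) l a" and ?E = "tab_minus_data (exp t) 0 (a * exp t powi l)"
  define A where "A = a * exp t powi l"
  have A: "A \<noteq> 0" using assms(3) by (simp add: A_def)
  have idx: "idx ?D = tab_plus l" "idx ?E = tab_minus 0" by (simp_all add: tab_plus_data_def tab_minus_data_def)
  let ?st = "tab_st A (exp t) {..l}" and ?st' = "tab_st A (exp t) {0+1..}"
  have D: "described_by (exp t) ?D ?st (tab_nx {..l})"
    using described_tab_plus[of "exp t" l a] by (simp add: A_def)
  \<comment> \<open>The base index of the second family is \<open>0\<close>, so its factor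
    \<open>q powi 0\<close> is trivial and \<open>a * exp t powi l\<close> is the same
    \<open>A\<close> as in the first one. This common value is what \<open>tab_apart\<close>
    compares positions with.\<close>
  have E: "described_by (exp t) ?E ?st' (tab_nx {0+1..})"
    using described_tab_minus[of "exp t" 0 "a * exp t powi l"] by (simp add: A_def)
  have thin: "thin (exp t) (idx ?D) ?st (tab_nx {..l})" "thin (exp t) (idx ?E) ?st' (tab_nx {0+1..})"
    unfolding idx by (rule thin_tab_plus[OF _ A] thin_tab_minus[OF _ A]; simp)+
  have apart: "c \<noteq> d" if "T \<in> idx ?D" "S \<in> idx ?E" "?st i T = Some (e1, c)" "?st' i S = Some (e2, d)" for T S i e1 c e2 d
    by (rule tab_apart[OF _ assms(1) A that(1)[unfolded idx] that(2)[unfolded idx] that(3,4)]) simp_all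
  have uq: "uq_module t V" "uq_module t W"
    using assms(4,6) by (simp_all add: fundamental_plus_def fundamental_minus_def)
  interpret V: thin_module t "idx ?D" ?st "tab_nx {..l}" V b
  proof (rule thin_moduleI[OF thin(1) uq(1) assms(5) D _ assms(1)])
    fix T T' assume "T \<in> idx ?D" "T' \<in> idx ?D" "\<And>i. st_wt (?st i T) = st_wt (?st i T')"
    then show "T = T'" unfolding idx by (rule tab_plus_eqI)
  qed
  interpret W: thin_module t "idx ?E" ?st' "tab_nx {0+1..}" W b'
  proof (rule thin_moduleI[OF thin(2) uq(2) assms(7) E _ assms(1)])
    fix T T' assume "T \<in> idx ?E" "T' \<in> idx ?E" "\<And>i. st_wt (?st' i T) = st_wt (?st' i T')"
    then show "T = T'" unfolding idx by (rule tab_minus_eqI)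
  qed
  interpret thin_tensor t "idx ?D" ?st "tab_nx {..l}" V b "idx ?E" ?st' "tab_nx {0+1..}" W b' sU \<tau>
    by unfold_locales
      (rule assms(8), erule (3) apart, unfold idx, erule finite_tab_plus, erule finite_tab_minus)
  have well_defined: "coproduct_well_defined ?D ?E"
    by (rule coproduct_well_definedI[OF D E thin]) (rule apart)
  show ?thesis
    using well_defined coproduct_action_U[OF D refl E refl] uq_module_U integrable_U scl_U by blast
qed

end
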